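(* Let $k$ be a finite field and $A$ a finitary $k$-algebra. Consider the following conditions: (I) each indecomposable $A$-module has simple socle; (I$'$) each indecomposable $A$-module has simple top; (II) each indecomposable $A$-module has simple top or simple socle; (III) $D_{r}(A)$ is a subring of $\mathcal{H}(A)$ for all integers $r\geq 1$; (IV) $D_{r}(A)$ is a subring of $\mathcal{H}(A)$ for some integer $r\geq 2$; (V) $D(A)$ is a subring of $\mathcal{H}(A)$. Then the three conditions "(I) or (I$'$)", (III) and (IV) are equivalent; each of them implies (II); and (II) implies (V).
   Context: $k$ is a finite field with $q$ elements and $v=q^{1/2}$. For a $k$-algebra $A$, "$A$-module" means finite dimensional (over $k$) left $A$-module, and $A$-mod is the category of these. $A$ is finitary if $\mathrm{Ext}^1(S_1,S_2)$ is a finite group for any two (not necessarily different) simple objects $S_1,S_2$ of $A$-mod. The Hall algebra $\mathcal{H}(A)$ is the $\mathbb{Z}[v,v^{-1}]$-algebra with basis the set of isomorphism classes $[X]$ of $A$-modules and multiplication $[M]\diamond[N]=\sum_{[X]}F^X_{M,N}[X]$, where $F^X_{M,N}$ is the number of submodules $U$ of $X$ with $U\cong N$ and $X/U\cong M$. For an $A$-module $M$, $s(M)$ is the number of indecomposable direct summands in a decomposition of $M$ into indecomposables (with $s(0)=0$). For an integer $r\geq 1$, $D_r(A)$ is the $\mathbb{Z}[v,v^{-1}]$-span in $\mathcal{H}(A)$ of the $[M]$ with $s(M)\geq r+1$, and $D(A)=D_1(A)$. "Subring" means an additive subgroup closed under multiplication (it need not contain the identity $[0]$). The top of a module is its quotient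 by its radical. *)

theory Defs
  imports Complex_Main "HOL-Algebra.QuotRing" "HOL-Algebra.Module"
begin

section \<open>Algebras over a field and their finite dimensional left modules\<close>

definition k_algebra :: "'k ring \<Rightarrow> ('k, 'a) module \<Rightarrow> bool" where
  "k_algebra K A \<longleftrightarrow> field K \<and> ring A \<and> module K A \<and>
     (\<forall>c\<in>carrier K. \<forall>a\<in>carrier A. \<forall>b\<in>carrier A.
        (c \<odot>\<^bsub>A\<^esub> a) \<otimes>\<^bsub>A\<^esub> b = c \<odot>\<^bsub>A\<^esub> (a \<otimes>\<^bsub>A\<^esub> b) \<and>
        a \<otimes>\<^bsub>A\<^esub> (c \<odot>\<^bsub>A\<^esub> b) = c \<odot>\<^bsub>A\<^esub> (a \<otimes>\<^bsub>A\<^esub> b))"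

text \<open>The library locale \<open>module\<close> requires a commutative ring of scalars; the
  following is the same notion without commutativity. As there, the fields \<open>mult\<close> and \<open>one\<close>
  of the record of a module play no role.\<close>

locale left_module = R?: ring R + M?: abelian_group M
    for R :: "('a, 'r) ring_scheme" (structure) and M :: "('a, 'm, 'e) module_scheme" (structure) +
  assumes smult_closed:
      "\<lbrakk>a \<in> carrier R; x \<in> carrier M\<rbrakk> \<Longrightarrow> a \<odot>\<^bsub>M\<^esub> x \<in> carrier M"
    and smult_l_distr:
      "\<lbrakk>a \<in> carrier R; b \<in> carrier R; x \<in> carrier M\<rbrakk> \<Longrightarrow>
       (a \<oplus>\<^bsub>R\<^esub> b) \<odot>\<^bsub>M\<^esub> x = a \<odot>\<^bsub>M\<^esub> x \<oplus>\<^bsub>M\<^esub> b \<odot>\<^bsub>M\<^esub> x"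
    and smult_r_distr:
      "\<lbrakk>a \<in> carrier R; x \<in> carrier M; y \<in> carrier M\<rbrakk> \<Longrightarrow>
       a \<odot>\<^bsub>M\<^esub> (x \<oplus>\<^bsub>M\<^esub> y) = a \<odot>\<^bsub>M\<^esub> x \<oplus>\<^bsub>M\<^esub> a \<odot>\<^bsub>M\<^esub> y"
    and smult_assoc1:
      "\<lbrakk>a \<in> carrier R; b \<in> carrier R; x \<in> carrier M\<rbrakk> \<Longrightarrow>
       (a \<otimes>\<^bsub>R\<^esub> b) \<odot>\<^bsub>M\<^esub> x = a \<odot>\<^bsub>M\<^esub> (b \<odot>\<^bsub>M\<^esub> x)"
    and smult_one:
      "x \<in> carrier M \<Longrightarrow> \<one>\<^bsub>R\<^esub> \<odot>\<^bsub>M\<^esub> x = x"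

definition restrict_scalars :: "('k, 'a) module \<Rightarrow> ('a, 'm) module \<Rightarrow> ('k, 'm) module" where
  "restrict_scalars A M =
     \<lparr>carrier = carrier M, mult = mult M, one = one M, zero = zero M, add = add M,
      smult = (\<lambda>c m. (c \<odot>\<^bsub>A\<^esub> \<one>\<^bsub>A\<^esub>) \<odot>\<^bsub>M\<^esub> m)\<rparr>"

definition finite_dimensional :: "'k ring \<Rightarrow> ('k, 'm) module \<Rightarrow> bool" where
  "finite_dimensional K V \<longleftrightarrow>
     (\<exists>B. finite B \<and> B \<subseteq> carrier V \<and>
        (\<forall>W. submodule W K V \<and> B \<subseteq> W \<longrightarrow> W = carrier V))"

text \<open>The objects of the category A-mod. The underlying set of a module is a set of natural
  numbers: over a finite field every finite dimensional module is a finite set, so this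
  represents every isomorphism class.\<close>

definition fd_modules :: "'k ring \<Rightarrow> ('k, 'a) module \<Rightarrow> ('a, nat) module set" where
  "fd_modules K A = {M. left_module A M \<and> finite_dimensional K (restrict_scalars A M)}"

definition module_hom ::
    "('a, 'r) ring_scheme \<Rightarrow> ('a, 'm) module \<Rightarrow> ('a, 'n) module \<Rightarrow> ('m \<Rightarrow> 'n) set" where
  "module_hom R M N = {f \<in> carrier M \<rightarrow> carrier N.
     (\<forall>x\<in>carrier M. \<forall>y\<in>carrier M. f (x \<oplus>\<^bsub>M\<^esub> y) = f x \<oplus>\<^bsub>N\<^esub> f y) \<and>
     (\<forall>a\<in>carrier R. \<forall>x\<in>carrier M. f (a \<odot>\<^bsub>M\<^esub> x) = a \<odot>\<^bsub>N\<^esub> f x)}"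

definition module_iso ::
    "('a, 'r) ring_scheme \<Rightarrow> ('a, 'm) module \<Rightarrow> ('a, 'n) module \<Rightarrow> ('m \<Rightarrow> 'n) set" where
  "module_iso R M N = {f \<in> module_hom R M N. bij_betw f (carrier M) (carrier N)}"

definition isomorphic ::
    "('a, 'r) ring_scheme \<Rightarrow> ('a, 'm) module \<Rightarrow> ('a, 'n) module \<Rightarrow> bool" where
  "isomorphic R M N \<longleftrightarrow> module_iso R M N \<noteq> {}"

definition sub_module :: "('a, 'm) module \<Rightarrow> 'm set \<Rightarrow> ('a, 'm) module" where
  "sub_module M U = M\<lparr>carrier := U\<rparr>"

definition quot_module :: "('a, 'm) module \<Rightarrow> 'm set \<Rightarrow> ('a, 'm set) module" where
  "quot_module M U =
     \<lparr>carrier = a_rcosets\<^bsub>M\<^esub> U, mult = undefined, one = undefined,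
      zero = U, add = set_add M,
      smult = (\<lambda>a C. \<Union>x\<in>C. U +>\<^bsub>M\<^esub> (a \<odot>\<^bsub>M\<^esub> x))\<rparr>"


section \<open>Simple modules, socle, top\<close>

definition simple_module :: "('a, 'r) ring_scheme \<Rightarrow> ('a, 'm) module \<Rightarrow> bool" where
  "simple_module R M \<longleftrightarrow> left_module R M \<and> carrier M \<noteq> {\<zero>\<^bsub>M\<^esub>} \<and>
     (\<forall>U. submodule U R M \<longrightarrow> U = {\<zero>\<^bsub>M\<^esub>} \<or> U = carrier M)"

text \<open>The socle is the sum of all simple submodules, that is, the smallest submodule
  containing them.\<close>

definition socle :: "('a, 'r) ring_scheme \<Rightarrow> ('a, 'm) module \<Rightarrow> 'm set" where
  "socle R M = \<Inter>{W. submodule W R M \<and>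
     (\<forall>S. submodule S R M \<and> simple_module R (sub_module M S) \<longrightarrow> S \<subseteq> W)}"

definition maximal_submodule ::
    "('a, 'r) ring_scheme \<Rightarrow> ('a, 'm) module \<Rightarrow> 'm set \<Rightarrow> bool" where
  "maximal_submodule R M U \<longleftrightarrow> submodule U R M \<and> U \<noteq> carrier M \<and>
     (\<forall>W. submodule W R M \<and> U \<subseteq> W \<longrightarrow> W = U \<or> W = carrier M)"

definition radical :: "('a, 'r) ring_scheme \<Rightarrow> ('a, 'm) module \<Rightarrow> 'm set" where
  "radical R M = carrier M \<inter> \<Inter>{U. maximal_submodule R M U}"

definition simple_socle :: "('a, 'r) ring_scheme \<Rightarrow> ('a, 'm) module \<Rightarrow> bool" where
  "simple_socle R M \<longleftrightarrow> simple_module R (sub_module M (socle R M))"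

definition simple_top :: "('a, 'r) ring_scheme \<Rightarrow> ('a, 'm) module \<Rightarrow> bool" where
  "simple_top R M \<longleftrightarrow> simple_module R (quot_module M (radical R M))"


section \<open>Decomposition into indecomposables\<close>

definition indecomposable :: "('a, 'r) ring_scheme \<Rightarrow> ('a, 'm) module \<Rightarrow> bool" where
  "indecomposable R M \<longleftrightarrow> left_module R M \<and> carrier M \<noteq> {\<zero>\<^bsub>M\<^esub>} \<and>
     (\<forall>U V. submodule U R M \<and> submodule V R M \<and>
        U <+>\<^bsub>M\<^esub> V = carrier M \<and> U \<inter> V = {\<zero>\<^bsub>M\<^esub>} \<longrightarrow> U = {\<zero>\<^bsub>M\<^esub>} \<or> V = {\<zero>\<^bsub>M\<^esub>})"

definition internal_direct_sum ::
    "('a, 'r) ring_scheme \<Rightarrow> ('a, 'm) module \<Rightarrow> nat \<Rightarrow> (nat \<Rightarrow> 'm set) \<Rightarrow> bool" where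
  "internal_direct_sum R M n U \<longleftrightarrow> (\<forall>i<n. submodule (U i) R M) \<and>
     (\<forall>x\<in>carrier M. \<exists>!u. u \<in> (\<Pi>\<^sub>E i\<in>{..<n}. U i) \<and> x = finsum M u {..<n})"

text \<open>Well defined on finite dimensional modules by the Krull-Schmidt theorem.\<close>

definition num_summands :: "('a, 'r) ring_scheme \<Rightarrow> ('a, 'm) module \<Rightarrow> nat" where
  "num_summands R M =
     (THE n. \<exists>U. internal_direct_sum R M n U \<and>
               (\<forall>i<n. indecomposable R (sub_module M (U i))))"


section \<open>Finitary algebras\<close>

text \<open>Yoneda extensions \<open>0 \<rightarrow> N \<rightarrow> E \<rightarrow> M \<rightarrow> 0\<close> in A-mod, with maps \<open>f\<close> and \<open>g\<close>.\<close>

definition extensions ::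
    "'k ring \<Rightarrow> ('k, 'a) module \<Rightarrow> ('a, nat) module \<Rightarrow> ('a, nat) module \<Rightarrow>
     (('a, nat) module \<times> (nat \<Rightarrow> nat) \<times> (nat \<Rightarrow> nat)) set" where
  "extensions K A M N = {(E, f, g). E \<in> fd_modules K A \<and>
     f \<in> module_hom A N E \<and> inj_on f (carrier N) \<and>
     g \<in> module_hom A E M \<and> g ` carrier E = carrier M \<and>
     f ` carrier N = {x \<in> carrier E. g x = \<zero>\<^bsub>M\<^esub>}}"

definition ext_equiv ::
    "'k ring \<Rightarrow> ('k, 'a) module \<Rightarrow> ('a, nat) module \<Rightarrow> ('a, nat) module \<Rightarrow>
     (('a, nat) module \<times> (nat \<Rightarrow> nat) \<times> (nat \<Rightarrow> nat)) rel" where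
  "ext_equiv K A M N = {((E, f, g), (E', f', g')).
     (E, f, g) \<in> extensions K A M N \<and> (E', f', g') \<in> extensions K A M N \<and>
     (\<exists>h\<in>module_iso A E E'. (\<forall>x\<in>carrier N. h (f x) = f' x) \<and>
                            (\<forall>x\<in>carrier E. g' (h x) = g x))}"

text \<open>The underlying set of the group \<open>Ext\<^sup>1(M, N)\<close>; finiteness does not involve the
  Baer sum.\<close>

definition Ext1 ::
    "'k ring \<Rightarrow> ('k, 'a) module \<Rightarrow> ('a, nat) module \<Rightarrow> ('a, nat) module \<Rightarrow>
     (('a, nat) module \<times> (nat \<Rightarrow> nat) \<times> (nat \<Rightarrow> nat)) set set" where
  "Ext1 K A M N = extensions K A M N // ext_equiv K A M N"

definition finitary :: "'k ring \<Rightarrow> ('k, 'a) module \<Rightarrow> bool" where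
  "finitary K A \<longleftrightarrow>
     (\<forall>S1\<in>fd_modules K A. \<forall>S2\<in>fd_modules K A.
        simple_module A S1 \<and> simple_module A S2 \<longrightarrow> finite (Ext1 K A S1 S2))"


section \<open>The Hall algebra\<close>

definition iso_class ::
    "'k ring \<Rightarrow> ('k, 'a) module \<Rightarrow> ('a, nat) module \<Rightarrow> ('a, nat) module set" where
  "iso_class K A M = {N \<in> fd_modules K A. isomorphic A N M}"

definition iso_classes :: "'k ring \<Rightarrow> ('k, 'a) module \<Rightarrow> ('a, nat) module set set" where
  "iso_classes K A = iso_class K A ` fd_modules K A"

definition hall_number ::
    "('a, 'r) ring_scheme \<Rightarrow> ('a, nat) module \<Rightarrow> ('a, nat) module \<Rightarrow> ('a, nat) module \<Rightarrow> nat" where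
  "hall_number R X M N = card {U. submodule U R X \<and>
     isomorphic R (sub_module X U) N \<and> isomorphic R (quot_module X U) M}"

text \<open>The number \<open>v\<close> and the subring \<open>\<int>[v, v\<inverse>]\<close> of the real numbers.\<close>

definition hall_v :: "'k ring \<Rightarrow> real" where
  "hall_v K = sqrt (real (card (carrier K)))"

definition hall_coeffs :: "'k ring \<Rightarrow> real set" where
  "hall_coeffs K = {(\<Sum>i\<in>I. of_int (c i) * hall_v K powi i) | I c. finite (I :: int set)}"

definition class_rep :: "('a, nat) module set \<Rightarrow> ('a, nat) module" where
  "class_rep C = (SOME M. M \<in> C)"

text \<open>Elements are the finitely supported coefficient functions on the set of isomorphism
  classes, extended by zero to all sets of modules. The multiplication is the bilinear
  extension of \<open>[M] \<diamondop> [N] = \<Sum>\<^bsub>[X]\<^esub> F\<^sup>X\<^bsub>M,N\<^esub> [X]\<close>; the sum over \<open>[X]\<close> is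
  finite when the algebra is finitary.\<close>

definition hall_basis :: "('a, nat) module set \<Rightarrow> ('a, nat) module set \<Rightarrow> real" where
  "hall_basis C = (\<lambda>X. if X = C then 1 else 0)"

definition hall_mult ::
    "'k ring \<Rightarrow> ('k, 'a) module \<Rightarrow> (('a, nat) module set \<Rightarrow> real) \<Rightarrow>
     (('a, nat) module set \<Rightarrow> real) \<Rightarrow> (('a, nat) module set \<Rightarrow> real)" where
  "hall_mult K A f g = (\<lambda>X. if X \<in> iso_classes K A then
       (\<Sum>M\<in>{M. f M \<noteq> 0}. \<Sum>N\<in>{N. g N \<noteq> 0}.
          f M * g N * real (hall_number A (class_rep X) (class_rep M) (class_rep N)))
     else 0)"

definition hall_algebra ::
    "'k ring \<Rightarrow> ('k, 'a) module \<Rightarrow> (real, ('a, nat) module set \<Rightarrow> real) module" where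
  "hall_algebra K A =
     \<lparr>carrier = {f. finite {X. f X \<noteq> 0} \<and> {X. f X \<noteq> 0} \<subseteq> iso_classes K A \<and>
                    range f \<subseteq> hall_coeffs K},
      mult = hall_mult K A,
      one = hall_basis {M \<in> fd_modules K A. carrier M = {\<zero>\<^bsub>M\<^esub>}},
      zero = (\<lambda>X. 0),
      add = (\<lambda>f g X. f X + g X),
      smult = (\<lambda>c f X. c * f X)\<rparr>"

definition hall_span ::
    "'k ring \<Rightarrow> ('k, 'a) module \<Rightarrow> ('a, nat) module set set \<Rightarrow>
     (('a, nat) module set \<Rightarrow> real) set" where
  "hall_span K A S =
     {\<Oplus>\<^bsub>hall_algebra K A\<^esub>C\<in>F. c C \<odot>\<^bsub>hall_algebra K A\<^esub> hall_basis C | F c.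
        finite F \<and> F \<subseteq> S \<and> (\<forall>C\<in>F. c C \<in> hall_coeffs K)}"

definition D_r ::
    "'k ring \<Rightarrow> ('k, 'a) module \<Rightarrow> nat \<Rightarrow> (('a, nat) module set \<Rightarrow> real) set" where
  "D_r K A r =
     hall_span K A {iso_class K A M | M. M \<in> fd_modules K A \<and> num_summands A M \<ge> r + 1}"

definition D :: "'k ring \<Rightarrow> ('k, 'a) module \<Rightarrow> (('a, nat) module set \<Rightarrow> real) set" where
  "D K A = D_r K A 1"

text \<open>Unlike the library notion \<open>subring\<close>, the identity is not required to belong to \<open>S\<close>.\<close>

definition nonunital_subring :: "'a set \<Rightarrow> ('a, 'b) ring_scheme \<Rightarrow> bool" where
  "nonunital_subring S R \<longleftrightarrow> subgroup S (add_monoid R) \<and>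
     (\<forall>x\<in>S. \<forall>y\<in>S. x \<otimes>\<^bsub>R\<^esub> y \<in> S)"

end

theory Submission
  imports Defs "HOL-Library.Nat_Bijection"
begin

text \<open>
  A product \<open>[M] \<diamondop> [N]\<close> is a combination, with positive coefficients, of the middle terms \<open>X\<close> of
  the short exact sequences \<open>0 \<rightarrow> N \<rightarrow> X \<rightarrow> M \<rightarrow> 0\<close>. Nothing cancels, so \<open>D\<^sub>r\<close> is a subring exactly
  when \<open>s(M) > r\<close> and \<open>s(N) > r\<close> force \<open>s(X) > r\<close> for all such sequences (\<open>D_r_subring_iff\<close>; the
  condition is called \<open>ext_closed\<close>). The theorem thus becomes a statement about the number \<open>s\<close> of
  indecomposable summands of finite modules.

  A finite nonzero module has simple socle iff it is uniform, that is, any two nonzero submodules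
  meet, and simple top iff it is hollow, that is, two proper submodules never generate it. If every
  indecomposable is uniform, then \<open>s\<close> is Goldie's uniform dimension, which does not grow when
  passing to a submodule: \<open>s(N) \<le> s(X)\<close> (\<open>dec_le_uniform\<close>). If every indecomposable is hollow, the
  dual dimension gives \<open>s(M) \<le> s(X)\<close> (\<open>dec_le_hollow\<close>). Either way \<open>ext_closed\<close> holds for all \<open>r\<close>.
  If each indecomposable is uniform or hollow and \<open>X\<close> is indecomposable, then \<open>N\<close> or \<open>M\<close> inherits
  this property and has at most one summand, which is the case \<open>r = 1\<close>.

  Conversely, let \<open>P\<close> be an indecomposable that is not hollow and \<open>Q\<close> one that is not uniform.
  Writing \<open>P = V + W\<close> with proper \<open>V\<close>, \<open>W\<close>, the submodule \<open>V \<inter> W\<close> is nonzero and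
  \<open>P/(V \<inter> W)\<close> splits into two nonzero parts; dually \<open>Q\<close> contains a direct sum of two nonzero
  submodules and is not equal to it. So \<open>P\<^sup>r\<^sup>-\<^sup>1 \<oplus> Q\<close>, with \<open>r\<close> summands, has a submodule with at
  least \<open>r + 1\<close> summands whose quotient has at least \<open>2 r - 1\<close>. For \<open>r \<ge> 2\<close> this violates
  \<open>ext_closed\<close> (\<open>simple_top_or_socle_if_ext_closed\<close>).

  Two general facts support the argument. The number \<open>s\<close> is well defined by the theorem of Krull and
  Schmidt (\<open>dec_unique\<close>), through Fitting's lemma and an exchange argument. And a product in the
  Hall algebra is a finite sum (\<open>finite_extension_classes\<close>). The hypothesis on \<open>A\<close> speaks about
  extensions of simple modules only; it spreads to all modules by way of derivations
  \<open>A \<rightarrow> Hom(M, N)\<close>. These are left exact in both arguments, so that finiteness passes from simple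
  to arbitrary finite modules, and the actions on \<open>N \<times> M\<close> with fixed addition, submodule and
  quotient are a torsor under them.
\<close>

section \<open>Submodules\<close>

locale lmod = left_module R M
  for R :: "('a, 'r) ring_scheme" and M :: "('a, 'm) module" (structure)
begin

lemma smult_in [simp, intro]:
  "\<lbrakk>a \<in> carrier R; x \<in> carrier M\<rbrakk> \<Longrightarrow> a \<odot> x \<in> carrier M"
  by (rule smult_closed)

lemma smult_zero [simp]:
  assumes a: "a \<in> carrier R" shows "a \<odot> \<zero> = \<zero>"
proof -
  have "a \<odot> \<zero> \<oplus> a \<odot> \<zero> = a \<odot> \<zero>"
    using smult_r_distr[OF a M.zero_closed M.zero_closed] by simp
  then show ?thesis using a by (metis M.add.r_cancel_one smult_in M.zero_closed)
qed

lemma zero_smult [simp]: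
  assumes x: "x \<in> carrier M" shows "\<zero>\<^bsub>R\<^esub> \<odot> x = \<zero>"
proof -
  have "\<zero>\<^bsub>R\<^esub> \<odot> x \<oplus> \<zero>\<^bsub>R\<^esub> \<odot> x = \<zero>\<^bsub>R\<^esub> \<odot> x"
    using smult_l_distr[OF R.zero_closed R.zero_closed x] by simp
  then show ?thesis using x by (metis M.add.r_cancel_one smult_in R.zero_closed)
qed

lemma minus_eq_smult:
  assumes x: "x \<in> carrier M" shows "\<ominus> x = (\<ominus>\<^bsub>R\<^esub> \<one>\<^bsub>R\<^esub>) \<odot> x"
proof -
  have "(\<ominus>\<^bsub>R\<^esub> \<one>\<^bsub>R\<^esub>) \<odot> x \<oplus> x = \<zero>"
    using smult_l_distr[of "\<ominus>\<^bsub>R\<^esub> \<one>\<^bsub>R\<^esub>" "\<one>\<^bsub>R\<^esub>" x] x by (simp add: R.l_neg smult_one)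
  then show ?thesis using x by (simp add: M.minus_equality)
qed

lemma minus_eq_zero_iff [simp]:
  assumes "x \<in> carrier M" "y \<in> carrier M" shows "x \<ominus> y = \<zero> \<longleftrightarrow> x = y"
  using assms M.add.inv_solve_right[of "\<zero>" x y] by (auto simp: a_minus_def M.r_neg)

lemma minus_add_cancel [simp]:
  assumes "x \<in> carrier M" "y \<in> carrier M" shows "x \<ominus> y \<oplus> y = x"
  using assms by (simp add: a_minus_def M.a_assoc M.l_neg)

lemma add_swap_middle:
  assumes "x \<in> carrier M" "y \<in> carrier M" "z \<in> carrier M" "w \<in> carrier M"
  shows "(x \<oplus> y) \<oplus> (z \<oplus> w) = (x \<oplus> z) \<oplus> (y \<oplus> w)"
  using assms by (simp add: M.a_ac)

lemma minus_swap_middle: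
  assumes "x \<in> carrier M" "y \<in> carrier M" "z \<in> carrier M" "w \<in> carrier M"
  shows "(x \<oplus> y) \<ominus> (z \<oplus> w) = (x \<ominus> z) \<oplus> (y \<ominus> w)"
  using assms by (simp add: a_minus_def M.minus_add M.a_ac)

text \<open>Closure under negation comes for free, since \<open>- x = (- 1) x\<close>.\<close>

lemma submoduleI:
  assumes "U \<subseteq> carrier M" "\<zero> \<in> U"
    and "\<And>x y. \<lbrakk>x \<in> U; y \<in> U\<rbrakk> \<Longrightarrow> x \<oplus> y \<in> U"
    and "\<And>a x. \<lbrakk>a \<in> carrier R; x \<in> U\<rbrakk> \<Longrightarrow> a \<odot> x \<in> U"
  shows "submodule U R M"
proof -
  have "\<ominus> x \<in> U" if "x \<in> U" for x
    using assms that minus_eq_smult by (metis R.add.inv_closed R.one_closed subsetD)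
  then show ?thesis
    using assms by (intro submodule.intro subgroup.intro submodule_axioms.intro)
      (simp_all add: a_inv_def[symmetric])
qed

lemma submoduleD:
  assumes "submodule U R M"
  shows submodule_subset: "U \<subseteq> carrier M"
    and submodule_carr: "x \<in> U \<Longrightarrow> x \<in> carrier M"
    and submodule_zero: "\<zero> \<in> U"
    and submodule_add: "\<lbrakk>x \<in> U; y \<in> U\<rbrakk> \<Longrightarrow> x \<oplus> y \<in> U"
    and submodule_smult: "\<lbrakk>a \<in> carrier R; x \<in> U\<rbrakk> \<Longrightarrow> a \<odot> x \<in> U"
    and submodule_neg: "x \<in> U \<Longrightarrow> \<ominus> x \<in> U"
    and submodule_minus: "\<lbrakk>x \<in> U; y \<in> U\<rbrakk> \<Longrightarrow> x \<ominus> y \<in> U"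
proof -
  interpret U: submodule U R M by fact
  show 1: "U \<subseteq> carrier M" using U.subset by simp
  then show "x \<in> U \<Longrightarrow> x \<in> carrier M" by blast
  show "\<zero> \<in> U" using U.one_closed by simp
  show 2: "\<And>x y. \<lbrakk>x \<in> U; y \<in> U\<rbrakk> \<Longrightarrow> x \<oplus> y \<in> U" using U.m_closed by simp
  show 3: "\<And>a x. \<lbrakk>a \<in> carrier R; x \<in> U\<rbrakk> \<Longrightarrow> a \<odot> x \<in> U" by simp
  show 4: "\<And>x. x \<in> U \<Longrightarrow> \<ominus> x \<in> U"
    using 1 3 minus_eq_smult by (metis R.add.inv_closed R.one_closed subsetD)
  show "\<lbrakk>x \<in> U; y \<in> U\<rbrakk> \<Longrightarrow> x \<ominus> y \<in> U" using 2 4 by (simp add: a_minus_def)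
qed

lemma submodule_add_left_iff:
  assumes "submodule U R M" "x \<in> U" "y \<in> carrier M"
  shows "x \<oplus> y \<in> U \<longleftrightarrow> y \<in> U"
proof
  assume "x \<oplus> y \<in> U"
  then have "\<ominus> x \<oplus> (x \<oplus> y) \<in> U"
    using assms submodule_add submodule_neg by blast
  then show "y \<in> U" using assms submodule_carr by (metis M.r_neg1)
qed (use assms submodule_add in blast)

lemma submodule_add_right_iff:
  assumes "submodule U R M" "x \<in> U" "y \<in> carrier M"
  shows "y \<oplus> x \<in> U \<longleftrightarrow> y \<in> U"
  using submodule_add_left_iff[OF assms] M.a_comm assms submodule_carr by metis

lemma submodule_triv [simp]: "submodule {\<zero>} R M"
  by (rule submoduleI) auto

lemma submodule_whole [simp]: "submodule (carrier M) R M"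
  by (rule submoduleI) auto

lemma submodule_Int:
  "\<lbrakk>submodule U R M; submodule V R M\<rbrakk> \<Longrightarrow> submodule (U \<inter> V) R M"
  by (rule submoduleI) (auto intro: submoduleD)

lemma set_add_iff: "x \<in> U <+>\<^bsub>M\<^esub> V \<longleftrightarrow> (\<exists>u\<in>U. \<exists>v\<in>V. x = u \<oplus> v)"
  by (auto simp: set_add_def')

lemma set_addI: "\<lbrakk>u \<in> U; v \<in> V\<rbrakk> \<Longrightarrow> u \<oplus> v \<in> U <+>\<^bsub>M\<^esub> V"
  by (auto simp: set_add_def')

lemma submodule_set_add [intro]:
  assumes U: "submodule U R M" and V: "submodule V R M"
  shows "submodule (U <+>\<^bsub>M\<^esub> V) R M"
proof (rule submoduleI)
  show "U <+>\<^bsub>M\<^esub> V \<subseteq> carrier M"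
    using submodule_carr[OF U] submodule_carr[OF V] by (auto simp: set_add_iff)
  show "\<zero> \<in> U <+>\<^bsub>M\<^esub> V"
    using submodule_zero[OF U] submodule_zero[OF V] set_addI by (metis M.l_zero M.zero_closed)
  fix x y assume "x \<in> U <+>\<^bsub>M\<^esub> V" "y \<in> U <+>\<^bsub>M\<^esub> V"
  then obtain u v u' v' where *: "u \<in> U" "v \<in> V" "u' \<in> U" "v' \<in> V"
      "x = u \<oplus> v" "y = u' \<oplus> v'" by (auto simp: set_add_iff)
  then have "x \<oplus> y = (u \<oplus> u') \<oplus> (v \<oplus> v')"
    using submodule_carr[OF U] submodule_carr[OF V] by (simp add: M.a_ac)
  then show "x \<oplus> y \<in> U <+>\<^bsub>M\<^esub> V" using * submodule_add[OF U] submodule_add[OF V] set_addI by metis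
next
  fix a x assume a: "a \<in> carrier R" and "x \<in> U <+>\<^bsub>M\<^esub> V"
  then obtain u v where *: "u \<in> U" "v \<in> V" "x = u \<oplus> v" by (auto simp: set_add_iff)
  then have "a \<odot> x = a \<odot> u \<oplus> a \<odot> v"
    using a submodule_carr[OF U] submodule_carr[OF V] by (simp add: smult_r_distr)
  then show "a \<odot> x \<in> U <+>\<^bsub>M\<^esub> V"
    using * a submodule_smult[OF U] submodule_smult[OF V] set_addI by metis
qed

lemma set_add_comm:
  assumes "U \<subseteq> carrier M" "V \<subseteq> carrier M" shows "U <+>\<^bsub>M\<^esub> V = V <+>\<^bsub>M\<^esub> U"
proof -
  have "u \<oplus> v = v \<oplus> u" if "u \<in> U" "v \<in> V" for u v
    using that assms by (auto intro: M.a_comm)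
  then show ?thesis by (auto simp: set_add_iff) metis+
qed

lemma set_add_assoc:
  assumes "U \<subseteq> carrier M" "V \<subseteq> carrier M" "W \<subseteq> carrier M"
  shows "(U <+>\<^bsub>M\<^esub> V) <+>\<^bsub>M\<^esub> W = U <+>\<^bsub>M\<^esub> (V <+>\<^bsub>M\<^esub> W)"
  using assms by (simp add: set_add_def M.add.set_mult_assoc)

lemma set_add_zero:
  assumes "U \<subseteq> carrier M" shows "U <+>\<^bsub>M\<^esub> {\<zero>} = U" "{\<zero>} <+>\<^bsub>M\<^esub> U = U"
  using assms by (auto simp: set_add_def' subset_iff)

lemma set_add_upper:
  assumes "submodule U R M" "submodule V R M"
  shows set_add_upper1: "U \<subseteq> U <+>\<^bsub>M\<^esub> V" and set_add_upper2: "V \<subseteq> U <+>\<^bsub>M\<^esub> V"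
proof -
  show "U \<subseteq> U <+>\<^bsub>M\<^esub> V"
    using set_addI[of _ U "\<zero>" V] submoduleD[OF assms(1)] submodule_zero[OF assms(2)]
    by (metis M.r_zero subsetI)
  show "V \<subseteq> U <+>\<^bsub>M\<^esub> V"
    using set_addI[of "\<zero>" U _ V] submoduleD[OF assms(2)] submodule_zero[OF assms(1)]
    by (metis M.l_zero subsetI)
qed

lemma set_add_least:
  assumes "submodule W R M" "U \<subseteq> W" "V \<subseteq> W" shows "U <+>\<^bsub>M\<^esub> V \<subseteq> W"
  using assms submodule_add[OF assms(1)] by (fastforce simp: set_add_iff)

lemma set_add_mono: "\<lbrakk>U \<subseteq> U'; V \<subseteq> V'\<rbrakk> \<Longrightarrow> U <+>\<^bsub>M\<^esub> V \<subseteq> U' <+>\<^bsub>M\<^esub> V'"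
  by (fastforce simp: set_add_iff)

lemma sub_module_left_module:
  assumes "submodule U R M" shows "left_module R (sub_module M U)"
proof -
  interpret U: submodule U R M by fact
  have "abelian_group (sub_module M U)"
    using M.a_comm_group U.subgroup_is_group M.add.group_axioms M.add.comm_monoid_axioms
      M.a_comm_monoid comm_monoid.submonoid_is_comm_monoid[OF M.a_comm_monoid U.subgroup_is_submonoid]
    unfolding abelian_group_def abelian_monoid_def abelian_group_axioms_def comm_group_def
    by (auto simp: sub_module_def M.a_group)
  then show ?thesis
    unfolding left_module_def left_module_axioms_def
    using R.ring_axioms submoduleD[OF assms]
    by (auto simp: sub_module_def smult_l_distr smult_r_distr smult_assoc1 smult_one)
qed

lemma submodule_sub_module_iff:
  assumes "submodule B R M"
  shows "submodule U R (sub_module M B) \<longleftrightarrow> submodule U R M \<and> U \<subseteq> B"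
proof -
  interpret B: lmod R "sub_module M B" by (intro lmod.intro sub_module_left_module[OF assms])
  have [simp]: "carrier (sub_module M B) = B" "add (sub_module M B) = add M"
    "zero (sub_module M B) = zero M" "smult (sub_module M B) = smult M"
    by (auto simp: sub_module_def)
  show ?thesis
  proof
    assume U: "submodule U R (sub_module M B)"
    have "U \<subseteq> B" using B.submoduleD(1)[OF U] by simp
    moreover have "submodule U R M"
      by (rule submoduleI)
        (use B.submoduleD[OF U] submoduleD(1)[OF assms] \<open>U \<subseteq> B\<close> in auto)
    ultimately show "submodule U R M \<and> U \<subseteq> B" by blast
  next
    assume U: "submodule U R M \<and> U \<subseteq> B"
    then show "submodule U R (sub_module M B)"
      by (intro B.submoduleI) (auto intro: submoduleD)
  qed
qed

end

lemma sub_module_simps [simp]: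
  "carrier (sub_module M B) = B" "add (sub_module M B) = add M"
  "zero (sub_module M B) = zero M" "smult (sub_module M B) = smult M"
  by (auto simp: sub_module_def)

lemma sub_module_sub_module [simp]: "sub_module (sub_module M B) U = sub_module M U"
  by (simp add: sub_module_def)

lemma sub_module_carrier [simp]: "sub_module M (carrier M) = M"
  by (simp add: sub_module_def)

lemma set_add_sub_module [simp]: "set_add (sub_module M B) = set_add M"
  by (intro ext) (simp add: set_add_def')

section \<open>Linear maps on a submodule\<close>

text \<open>Maps are defined on a submodule \<open>B\<close> of an ambient module, so that restrictions and
  projections need no change of the module.\<close>

definition lin_on ::
  "('a, 'r) ring_scheme \<Rightarrow> ('a, 'm) module \<Rightarrow> 'm set \<Rightarrow> ('a, 'n) module \<Rightarrow> ('m \<Rightarrow> 'n) \<Rightarrow> bool" where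
  "lin_on R M B N f \<longleftrightarrow> f \<in> B \<rightarrow> carrier N \<and>
     (\<forall>x\<in>B. \<forall>y\<in>B. f (x \<oplus>\<^bsub>M\<^esub> y) = f x \<oplus>\<^bsub>N\<^esub> f y) \<and>
     (\<forall>a\<in>carrier R. \<forall>x\<in>B. f (a \<odot>\<^bsub>M\<^esub> x) = a \<odot>\<^bsub>N\<^esub> f x)"

lemma module_hom_iff_lin_on: "f \<in> module_hom R M N \<longleftrightarrow> lin_on R M (carrier M) N f"
  by (simp add: module_hom_def lin_on_def)

lemma lin_on_subset: "\<lbrakk>lin_on R M B N f; C \<subseteq> B\<rbrakk> \<Longrightarrow> lin_on R M C N f"
  by (fastforce simp: lin_on_def)

lemma lin_on_compose:
  "\<lbrakk>lin_on R M B N f; lin_on R N C L g; f ` B \<subseteq> C\<rbrakk> \<Longrightarrow> lin_on R M B L (\<lambda>x. g (f x))"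
  by (auto simp: lin_on_def image_subset_iff Pi_iff)

locale lin_map = M: lmod R M + N: lmod R N
  for R :: "('a, 'r) ring_scheme" and M :: "('a, 'm) module" and B :: "'m set"
    and N :: "('a, 'n) module" and f :: "'m \<Rightarrow> 'n" +
  assumes dom: "submodule B R M" and lin: "lin_on R M B N f"
begin

lemma map_in [simp]: "x \<in> B \<Longrightarrow> f x \<in> carrier N"
  and map_add: "\<lbrakk>x \<in> B; y \<in> B\<rbrakk> \<Longrightarrow> f (x \<oplus>\<^bsub>M\<^esub> y) = f x \<oplus>\<^bsub>N\<^esub> f y"
  and map_smult: "\<lbrakk>a \<in> carrier R; x \<in> B\<rbrakk> \<Longrightarrow> f (a \<odot>\<^bsub>M\<^esub> x) = a \<odot>\<^bsub>N\<^esub> f x"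
  using lin by (auto simp: lin_on_def)

lemma map_zero [simp]: "f \<zero>\<^bsub>M\<^esub> = \<zero>\<^bsub>N\<^esub>"
proof -
  have "\<zero>\<^bsub>M\<^esub> \<in> B" by (rule M.submodule_zero[OF dom])
  then show ?thesis
    using map_smult[of "\<zero>\<^bsub>R\<^esub>" "\<zero>\<^bsub>M\<^esub>"] by (metis M.R.zero_closed M.M.zero_closed M.zero_smult N.zero_smult map_in)
qed

lemma map_neg: "x \<in> B \<Longrightarrow> f (\<ominus>\<^bsub>M\<^esub> x) = \<ominus>\<^bsub>N\<^esub> f x"
  using map_smult[of "\<ominus>\<^bsub>R\<^esub> \<one>\<^bsub>R\<^esub>" x] M.submodule_carr[OF dom]
  by (simp add: M.minus_eq_smult N.minus_eq_smult)

lemma map_minus: "\<lbrakk>x \<in> B; y \<in> B\<rbrakk> \<Longrightarrow> f (x \<ominus>\<^bsub>M\<^esub> y) = f x \<ominus>\<^bsub>N\<^esub> f y"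
  using map_add[of x "\<ominus>\<^bsub>M\<^esub> y"] M.submodule_neg[OF dom] by (simp add: map_neg a_minus_def)

lemma image_submodule:
  assumes U: "submodule U R M" "U \<subseteq> B" shows "submodule (f ` U) R N"
proof (rule N.submoduleI)
  show "f ` U \<subseteq> carrier N" using U by auto
  show "\<zero>\<^bsub>N\<^esub> \<in> f ` U" using M.submodule_zero[OF U(1)] map_zero by (metis imageI)
next
  fix x y assume "x \<in> f ` U" "y \<in> f ` U"
  then obtain u v where u: "u \<in> U" "v \<in> U" "x = f u" "y = f v" by blast
  then have "x \<oplus>\<^bsub>N\<^esub> y = f (u \<oplus>\<^bsub>M\<^esub> v)"
    using U map_add[of u v] by (simp add: subset_iff)
  then show "x \<oplus>\<^bsub>N\<^esub> y \<in> f ` U" using u M.submodule_add[OF U(1)] by blast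
next
  fix a x assume a: "a \<in> carrier R" and "x \<in> f ` U"
  then obtain u where u: "u \<in> U" "x = f u" by blast
  then have "a \<odot>\<^bsub>N\<^esub> x = f (a \<odot>\<^bsub>M\<^esub> u)" using a U map_smult by auto
  then show "a \<odot>\<^bsub>N\<^esub> x \<in> f ` U"
    using M.submodule_smult[OF U(1) a u(1)] by blast
qed

lemma preimage_submodule:
  assumes W: "submodule W R N" shows "submodule {x \<in> B. f x \<in> W} R M"
  using M.submoduleD[OF dom] N.submoduleD[OF W]
  by (intro M.submoduleI) (auto simp: map_add map_smult)

lemma image_set_add:
  assumes "U \<subseteq> B" "V \<subseteq> B" shows "f ` (U <+>\<^bsub>M\<^esub> V) = f ` U <+>\<^bsub>N\<^esub> f ` V"
proof -
  have "f (u \<oplus>\<^bsub>M\<^esub> v) = f u \<oplus>\<^bsub>N\<^esub> f v" if "u \<in> U" "v \<in> V" for u v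
    using that assms map_add by blast
  then have "(\<Union>u\<in>U. \<Union>v\<in>V. {f (u \<oplus>\<^bsub>M\<^esub> v)}) = (\<Union>u\<in>U. \<Union>v\<in>V. {f u \<oplus>\<^bsub>N\<^esub> f v})" by simp
  then show ?thesis by (simp add: set_add_def' image_UN)
qed

lemma inj_onI_kernel:
  assumes "\<And>x. \<lbrakk>x \<in> B; f x = \<zero>\<^bsub>N\<^esub>\<rbrakk> \<Longrightarrow> x = \<zero>\<^bsub>M\<^esub>" shows "inj_on f B"
proof (rule inj_onI)
  fix x y assume xy: "x \<in> B" "y \<in> B" "f x = f y"
  then have "f (x \<ominus>\<^bsub>M\<^esub> y) = \<zero>\<^bsub>N\<^esub>" by (simp add: map_minus)
  then have "x \<ominus>\<^bsub>M\<^esub> y = \<zero>\<^bsub>M\<^esub>" using assms xy M.submodule_minus[OF dom] by blast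
  then show "x = y" using xy M.submodule_carr[OF dom] by simp
qed

lemma inj_on_kernel: "\<lbrakk>inj_on f B; x \<in> B; f x = \<zero>\<^bsub>N\<^esub>\<rbrakk> \<Longrightarrow> x = \<zero>\<^bsub>M\<^esub>"
  by (metis M.submodule_zero dom inj_onD map_zero)

lemma map_eq_iff_minus: "\<lbrakk>x \<in> B; y \<in> B\<rbrakk> \<Longrightarrow> f x = f y \<longleftrightarrow> f (x \<ominus>\<^bsub>M\<^esub> y) = \<zero>\<^bsub>N\<^esub>"
  by (simp add: map_minus)

end

section \<open>Direct decompositions and projections\<close>

definition direct ::
  "('a, 'r) ring_scheme \<Rightarrow> ('a, 'm) module \<Rightarrow> 'm set \<Rightarrow> 'm set \<Rightarrow> 'm set \<Rightarrow> bool" where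
  "direct R M V W B \<longleftrightarrow> submodule V R M \<and> submodule W R M \<and> V <+>\<^bsub>M\<^esub> W = B \<and> V \<inter> W = {\<zero>\<^bsub>M\<^esub>}"

context lmod
begin

lemma directD:
  assumes "direct R M V W B"
  shows "submodule V R M" "submodule W R M" "V <+>\<^bsub>M\<^esub> W = B" "V \<inter> W = {\<zero>}"
    "submodule B R M" "V \<subseteq> B" "W \<subseteq> B"
  using assms set_add_upper1[of V W] set_add_upper2[of V W] submodule_set_add[of V W]
  unfolding direct_def by auto

lemma direct_sym: "direct R M V W B \<Longrightarrow> direct R M W V B"
  unfolding direct_def using set_add_comm submoduleD(1) by blast

lemma directI:
  assumes "submodule V R M" "submodule W R M" "V <+>\<^bsub>M\<^esub> W = B"
    and "\<And>x. \<lbrakk>x \<in> V; x \<in> W\<rbrakk> \<Longrightarrow> x = \<zero>"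
  shows "direct R M V W B"
  using assms submodule_zero unfolding direct_def by blast

lemma direct_unique:
  assumes "direct R M V W B" and el: "v \<in> V" "v' \<in> V" "w \<in> W" "w' \<in> W"
    and eq: "v \<oplus> w = v' \<oplus> w'"
  shows "v = v' \<and> w = w'"
proof -
  note D = directD[OF assms(1)]
  have c: "v \<in> carrier M" "v' \<in> carrier M" "w \<in> carrier M" "w' \<in> carrier M"
    using el D submodule_carr by blast+
  have "v \<ominus> v' = (v \<oplus> w) \<ominus> (v' \<oplus> w)"
    using c by (simp add: minus_swap_middle)
  also have "\<dots> = w' \<ominus> w"
    unfolding eq using c by (simp add: minus_swap_middle)
  finally have "v \<ominus> v' = w' \<ominus> w" .
  moreover have "v \<ominus> v' \<in> V" "w' \<ominus> w \<in> W"
    using el D submodule_minus by blast+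
  ultimately have "v \<ominus> v' = \<zero>" "w' \<ominus> w = \<zero>" using D(4) by auto
  then show ?thesis using c by simp
qed

text \<open>The modular law: a summand \<open>V\<close> of \<open>B\<close> is a summand of every intermediate module.\<close>

lemma direct_Int:
  assumes d: "direct R M V W B" and U: "submodule U R M" "V \<subseteq> U" "U \<subseteq> B"
  shows "direct R M V (U \<inter> W) U"
proof -
  note D = directD[OF d]
  show ?thesis
  proof (rule directI)
    show "submodule V R M" "submodule (U \<inter> W) R M" using D U submodule_Int by auto
    show "V <+>\<^bsub>M\<^esub> (U \<inter> W) = U"
    proof
      show "V <+>\<^bsub>M\<^esub> (U \<inter> W) \<subseteq> U" using set_add_least[OF U(1,2)] by blast
      show "U \<subseteq> V <+>\<^bsub>M\<^esub> (U \<inter> W)"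
      proof
        fix u assume u: "u \<in> U"
        then have "u \<in> V <+>\<^bsub>M\<^esub> W" using D(3) U(3) by blast
        then obtain y w where yw: "y \<in> V" "w \<in> W" "u = y \<oplus> w" by (auto simp: set_add_iff)
        then have "w \<in> U"
          using submodule_add_left_iff[OF U(1), of y w] U(2) u submodule_carr[OF D(2)] by blast
        then show "u \<in> V <+>\<^bsub>M\<^esub> (U \<inter> W)" using yw set_addI by blast
      qed
    qed
  qed (use D in blast)
qed

lemma direct_projections:
  assumes dir: "direct R M V W B"
  obtains p q where "lin_on R M B M p" "lin_on R M B M q" "p ` B \<subseteq> V" "q ` B \<subseteq> W"
    "\<And>x. x \<in> B \<Longrightarrow> x = p x \<oplus> q x"
    "\<And>v w. \<lbrakk>v \<in> V; w \<in> W\<rbrakk> \<Longrightarrow> p (v \<oplus> w) = v \<and> q (v \<oplus> w) = w"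
    "\<And>v. v \<in> V \<Longrightarrow> p v = v \<and> q v = \<zero>" "\<And>w. w \<in> W \<Longrightarrow> p w = \<zero> \<and> q w = w"
proof -
  note D = directD[OF dir]
  have cV: "x \<in> V \<Longrightarrow> x \<in> carrier M" and cW: "x \<in> W \<Longrightarrow> x \<in> carrier M" for x
    using D submodule_carr by blast+
  have "\<exists>v w. v \<in> V \<and> w \<in> W \<and> x = v \<oplus> w" if "x \<in> B" for x
    using that unfolding D(3)[symmetric] set_add_iff by blast
  then obtain p q where pq: "\<And>x. x \<in> B \<Longrightarrow> p x \<in> V \<and> q x \<in> W \<and> x = p x \<oplus> q x"
    by metis
  have key: "p (v \<oplus> w) = v \<and> q (v \<oplus> w) = w" if "v \<in> V" "w \<in> W" for v w
  proof -
    have "v \<oplus> w \<in> B" using that D(3) set_addI by blast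
    then show ?thesis
      using direct_unique[OF dir, of "p (v \<oplus> w)" v "q (v \<oplus> w)" w] pq that by metis
  qed
  have add: "p (x \<oplus> y) = p x \<oplus> p y \<and> q (x \<oplus> y) = q x \<oplus> q y" if "x \<in> B" "y \<in> B" for x y
  proof -
    have "x \<oplus> y = (p x \<oplus> q x) \<oplus> (p y \<oplus> q y)" using pq that by metis
    also have "\<dots> = (p x \<oplus> p y) \<oplus> (q x \<oplus> q y)"
      using pq[OF that(1)] pq[OF that(2)] cV cW by (intro add_swap_middle) auto
    finally show ?thesis
      using key pq that submodule_add[OF D(1)] submodule_add[OF D(2)] by metis
  qed
  have smult: "p (a \<odot> x) = a \<odot> p x \<and> q (a \<odot> x) = a \<odot> q x"
    if "a \<in> carrier R" "x \<in> B" for a x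
  proof -
    have "a \<odot> x = a \<odot> (p x \<oplus> q x)" using pq that by metis
    also have "\<dots> = a \<odot> p x \<oplus> a \<odot> q x"
      using pq[OF that(2)] that(1) cV cW by (intro smult_r_distr) auto
    finally show ?thesis
      using key pq that submodule_smult[OF D(1)] submodule_smult[OF D(2)] by metis
  qed
  show ?thesis
  proof (rule that[of p q])
    show "lin_on R M B M p" "lin_on R M B M q"
      using pq add smult cV cW by (auto simp: lin_on_def)
    show "p ` B \<subseteq> V" "q ` B \<subseteq> W" using pq by auto
    show "\<And>x. x \<in> B \<Longrightarrow> x = p x \<oplus> q x" using pq by blast
    show "\<And>v w. \<lbrakk>v \<in> V; w \<in> W\<rbrakk> \<Longrightarrow> p (v \<oplus> w) = v \<and> q (v \<oplus> w) = w" by (rule key)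
    show "p v = v \<and> q v = \<zero>" if "v \<in> V" for v
      using key[OF that submodule_zero[OF D(2)]] cV[OF that] by simp
    show "p w = \<zero> \<and> q w = w" if "w \<in> W" for w
      using key[OF submodule_zero[OF D(1)] that] cW[OF that] by simp
  qed
qed

end

lemma (in lin_map) image_direct:
  assumes "direct R M V W C" "C \<subseteq> B" "inj_on f C"
  shows "direct R N (f ` V) (f ` W) (f ` C)"
proof -
  note D = M.directD[OF assms(1)]
  have "f ` V \<inter> f ` W = f ` (V \<inter> W)"
    using inj_on_image_Int[OF assms(3) D(6,7)] by simp
  then show ?thesis
    using D assms(2) image_submodule[of V] image_submodule[of W] image_set_add[of V W]
    unfolding direct_def by auto
qed

section \<open>Indecomposable submodules and Fitting's lemma\<close>

text \<open>Indecomposability of a submodule, seen inside the ambient module. Summands of summands are then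
  submodules of the same module, and no change of structure is needed.\<close>

definition indec :: "('a, 'r) ring_scheme \<Rightarrow> ('a, 'm) module \<Rightarrow> 'm set \<Rightarrow> bool" where
  "indec R M U \<longleftrightarrow> submodule U R M \<and> U \<noteq> {\<zero>\<^bsub>M\<^esub>} \<and>
     (\<forall>V W. direct R M V W U \<longrightarrow> V = {\<zero>\<^bsub>M\<^esub>} \<or> W = {\<zero>\<^bsub>M\<^esub>})"

lemma indecD:
  assumes "indec R M U"
  shows "submodule U R M" "U \<noteq> {\<zero>\<^bsub>M\<^esub>}"
    "direct R M V W U \<Longrightarrow> V = {\<zero>\<^bsub>M\<^esub>} \<or> W = {\<zero>\<^bsub>M\<^esub>}"
  using assms unfolding indec_def by blast+

context lmod
begin

lemma indecomposable_iff_indec: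
  assumes U: "submodule U R M"
  shows "indecomposable R (sub_module M U) \<longleftrightarrow> indec R M U"
proof -
  have "submodule V R M \<and> submodule W R M \<and> V <+>\<^bsub>M\<^esub> W = U \<and> V \<inter> W = {\<zero>} \<longleftrightarrow>
     (submodule V R M \<and> V \<subseteq> U) \<and> (submodule W R M \<and> W \<subseteq> U) \<and> V <+>\<^bsub>M\<^esub> W = U \<and> V \<inter> W = {\<zero>}"
    for V W using set_add_upper1[of V W] set_add_upper2[of V W] by blast
  then show ?thesis
    using assms sub_module_left_module[OF assms]
    by (simp add: indecomposable_def indec_def direct_def submodule_sub_module_iff[OF U])
qed

lemma indecomposable_iff_indec_carrier: "indecomposable R M \<longleftrightarrow> indec R M (carrier M)"
  using indecomposable_iff_indec[OF submodule_whole] by simp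

lemma funpow_in:
  assumes "f ` V \<subseteq> V" shows "(f ^^ n) ` V \<subseteq> V"
  using assms by (induction n) auto

lemma lin_on_funpow:
  assumes "submodule V R M" "lin_on R M V M f" "f ` V \<subseteq> V" shows "lin_on R M V M (f ^^ n)"
proof (induction n)
  case 0 then show ?case using submodule_carr[OF assms(1)] by (auto simp: lin_on_def)
next
  case (Suc n)
  then show ?case
    using lin_on_compose[OF Suc assms(2) funpow_in[OF assms(3)]] by (simp add: comp_def)
qed

text \<open>Choose \<open>n\<close> such that the image of \<open>f\<^sup>n\<close> is as small as possible, and let \<open>g\<close> be \<open>f\<^sup>n\<^sup>+\<^sup>1\<close>. Then
  \<open>g\<close> maps its image bijectively onto itself, so kernel and image of \<open>g\<close> are complementary, and
  one of them vanishes.\<close>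

lemma fitting:
  assumes V: "indec R M V" "finite V" and f: "lin_on R M V M f" "f ` V \<subseteq> V"
  shows "inj_on f V \<or> (\<exists>n. (f ^^ n) ` V = {\<zero>})"
proof -
  note sV = indecD(1)[OF V(1)]
  obtain n where n: "\<And>m. card ((f ^^ n) ` V) \<le> card ((f ^^ m) ` V)"
    using ex_has_least_nat[of "\<lambda>_. True" 0 "\<lambda>n. card ((f ^^ n) ` V)"] by auto
  \<comment> \<open>The exponent is positive because the kernel of \<open>f\<^sup>0\<close> says nothing about that of \<open>f\<close>.\<close>
  define g where "g = f ^^ Suc n"
  have gV: "g ` V \<subseteq> V" unfolding g_def by (rule funpow_in[OF f(2)])
  interpret g: lin_map R M V M g
    using lin_on_funpow[OF sV f, of "Suc n"] sV lmod_axioms by (intro lin_map.intro lin_map_axioms.intro) (auto simp: g_def)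
  have fin: "finite (g ` V)" using V(2) by simp
  have "g ` g ` V = (f ^^ (Suc n + Suc n)) ` V" unfolding g_def funpow_add image_comp ..
  moreover have "card (g ` V) \<le> card ((f ^^ n) ` V)"
    unfolding g_def funpow_Suc_right image_comp[symmetric]
    using f(2) V(2) by (intro card_mono) auto
  ultimately have "card (g ` V) \<le> card (g ` g ` V)" using n by (metis le_trans)
  then have gg: "g ` g ` V = g ` V"
    using gV fin by (intro card_seteq) auto
  then have inj: "inj_on g (g ` V)" using fin by (intro finite_surj_inj) auto
  define K where "K = {x \<in> V. g x \<in> {\<zero>}}"
  have "direct R M K (g ` V) V"
  proof (rule directI)
    show sK: "submodule K R M" unfolding K_def by (rule g.preimage_submodule) simp
    show sI: "submodule (g ` V) R M" using g.image_submodule[OF sV] by simp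
    show "x = \<zero>" if "x \<in> K" "x \<in> g ` V" for x
      using inj_onD[OF inj, of x "\<zero>"] that submodule_zero[OF sI] by (auto simp: K_def)
    show "K <+>\<^bsub>M\<^esub> g ` V = V"
    proof
      show "K <+>\<^bsub>M\<^esub> g ` V \<subseteq> V" by (rule set_add_least[OF sV]) (use gV in \<open>auto simp: K_def\<close>)
      show "V \<subseteq> K <+>\<^bsub>M\<^esub> g ` V"
      proof
        fix x assume x: "x \<in> V"
        then have "g x \<in> g ` g ` V" using gg by blast
        then obtain y where y: "y \<in> g ` V" "g x = g y" by blast
        then have yV: "y \<in> V" using gV by blast
        have "x \<ominus> y \<in> K"
          using x yV y(2) submodule_minus[OF sV] g.map_eq_iff_minus by (auto simp: K_def)
        then have "x \<ominus> y \<oplus> y \<in> K <+>\<^bsub>M\<^esub> g ` V" using y(1) by (rule set_addI)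
        then show "x \<in> K <+>\<^bsub>M\<^esub> g ` V" using x yV submodule_carr[OF sV] by simp
      qed
    qed
  qed
  then consider "K = {\<zero>}" | "g ` V = {\<zero>}" using indecD(3)[OF V(1)] by blast
  then show ?thesis
  proof cases
    case 1
    interpret f: lin_map R M V M f
      using f sV lmod_axioms by (intro lin_map.intro lin_map_axioms.intro)
    have "x = \<zero>" if "x \<in> V" "f x = \<zero>" for x
    proof -
      interpret fn: lin_map R M V M "f ^^ n"
        using lin_on_funpow[OF sV f] sV lmod_axioms by (intro lin_map.intro lin_map_axioms.intro)
      have "g x = \<zero>" using that(2) fn.map_zero by (simp add: g_def funpow_Suc_right del: funpow.simps)
      then show ?thesis using 1 that(1) by (auto simp: K_def)
    qed
    then show ?thesis using f.inj_onI_kernel by blast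
  next
    case 2
    then show ?thesis unfolding g_def by blast
  qed
qed

text \<open>The endomorphism ring of a finite indecomposable module is local: if \<open>f + g = 1\<close> and
  \<open>f\<close> is nilpotent, then \<open>g x = 0\<close> forces \<open>x = f x = f (f x) = \<dots> = 0\<close>.\<close>

lemma indec_endo_local:
  assumes V: "indec R M V" "finite V" and f: "lin_on R M V M f" "f ` V \<subseteq> V"
    and g: "lin_on R M V M g" "g ` V \<subseteq> V" and id: "\<And>x. x \<in> V \<Longrightarrow> x = f x \<oplus> g x"
  shows "inj_on f V \<or> inj_on g V"
proof (rule disjCI)
  assume "\<not> inj_on g V"
  note sV = indecD(1)[OF V(1)]
  from fitting[OF V g] \<open>\<not> inj_on g V\<close> obtain n where n: "(g ^^ n) ` V = {\<zero>}" by blast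
  interpret f: lin_map R M V M f
    using f sV lmod_axioms by (intro lin_map.intro lin_map_axioms.intro)
  have "x = \<zero>" if x: "x \<in> V" "f x = \<zero>" for x
  proof -
    have "g x \<in> carrier M" using g x sV submodule_carr by blast
    then have gx: "g x = x" using id[OF x(1)] x(2) by simp
    have "(g ^^ n) x = x" by (induction n) (simp_all add: gx)
    then show ?thesis using n x(1) by (metis imageI singletonD)
  qed
  then show "inj_on f V" using f.inj_onI_kernel by blast
qed

end

section \<open>The number of indecomposable summands\<close>

text \<open>Being a direct sum of \<open>n\<close> indecomposables, built up one summand at a time. Inductions on this
  predicate only ever split off a single summand, so they deal with binary sums instead of
  families.\<close>

inductive dec :: "('a, 'r) ring_scheme \<Rightarrow> ('a, 'm) module \<Rightarrow> 'm set \<Rightarrow> nat \<Rightarrow> bool"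
  for R M where
  dec_zero: "dec R M {\<zero>\<^bsub>M\<^esub>} 0"
| dec_Suc: "\<lbrakk>indec R M U; dec R M C n; direct R M U C B\<rbrakk> \<Longrightarrow> dec R M B (Suc n)"

inductive_cases dec_0E: "dec R M B 0"
inductive_cases dec_SucE: "dec R M B (Suc n)"

context lmod
begin

lemma direct_zero: "submodule U R M \<Longrightarrow> direct R M U {\<zero>} U"
  using submodule_zero submoduleD(1) by (auto simp: direct_def set_add_zero)

lemma direct_assoc:
  assumes "direct R M U V B" "direct R M B W X"
  shows "direct R M V W (V <+>\<^bsub>M\<^esub> W)" "direct R M U (V <+>\<^bsub>M\<^esub> W) X"
proof -
  note 1 = directD[OF assms(1)] and 2 = directD[OF assms(2)]
  show "direct R M V W (V <+>\<^bsub>M\<^esub> W)"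
    using 1 2 by (intro directI) auto
  show "direct R M U (V <+>\<^bsub>M\<^esub> W) X"
  proof (rule directI)
    show "U <+>\<^bsub>M\<^esub> (V <+>\<^bsub>M\<^esub> W) = X"
      using set_add_assoc[OF submodule_subset[OF 1(1)] submodule_subset[OF 1(2)] submodule_subset[OF 2(2)]]
      unfolding 1(3) 2(3) by simp
    fix x assume x: "x \<in> U" "x \<in> V <+>\<^bsub>M\<^esub> W"
    then obtain v w where vw: "v \<in> V" "w \<in> W" "x = v \<oplus> w" by (auto simp: set_add_iff)
    have "v \<oplus> w \<in> B" using x vw 1 by auto
    moreover have "v \<in> B" "w \<in> carrier M" using vw 1 submodule_carr[OF 2(2)] by auto
    ultimately have "w \<in> B" using submodule_add_left_iff[OF 1(5)] by blast
    then have "w = \<zero>" using vw 2 by auto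
    then have "x = v" using vw 1 submodule_carr by auto
    then show "x = \<zero>" using x vw 1 by auto
  qed (use 1 2 in auto)
qed

lemma dec_submodule: "dec R M B n \<Longrightarrow> submodule B R M"
  by (induction rule: dec.induct) (auto dest: directD)

lemma dec_0_iff [simp]: "dec R M B 0 \<longleftrightarrow> B = {\<zero>}"
  by (auto elim: dec_0E intro: dec_zero)

lemma dec_zero_iff [simp]: "dec R M {\<zero>} n \<longleftrightarrow> n = 0"
proof (cases n)
  case (Suc m)
  have "\<not> dec R M {\<zero>} (Suc m)"
  proof
    assume "dec R M {\<zero>} (Suc m)"
    then obtain U C where "indec R M U" "direct R M U C {\<zero>}" by (auto elim: dec_SucE)
    then show False using directD(6) submodule_zero indecD(1,2)
      by (metis empty_iff subset_singleton_iff)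
  qed
  then show ?thesis using Suc by simp
qed simp

lemma dec_indec: "indec R M U \<Longrightarrow> dec R M U 1"
  using dec_Suc[OF _ dec_zero direct_zero, of U] indecD(1) by fastforce

lemma dec_add:
  assumes "dec R M B n" "dec R M C m" "direct R M B C X" shows "dec R M X (n + m)"
  using assms
proof (induction arbitrary: X rule: dec.induct)
  case dec_zero
  then have "X = C" using directD set_add_zero(2) submoduleD(1) by metis
  then show ?case using dec_zero by simp
next
  case (dec_Suc U B' n B)
  note A = direct_assoc[OF dec_Suc.hyps(3) dec_Suc.prems(2)]
  show ?case
    using dec.dec_Suc[OF dec_Suc.hyps(1) dec_Suc.IH[OF dec_Suc.prems(1) A(1)] A(2)] by simp
qed

lemma ex_dec:
  assumes "submodule U R M" "finite U" shows "\<exists>n. dec R M U n"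
  using assms
proof (induction "card U" arbitrary: U rule: less_induct)
  case less
  show ?case
  proof (cases "U = {\<zero>} \<or> indec R M U")
    case True
    then show ?thesis using dec_zero dec_indec by auto
  next
    case False
    then obtain V W where d: "direct R M V W U" "V \<noteq> {\<zero>}" "W \<noteq> {\<zero>}"
      using less.prems(1) unfolding indec_def by blast
    note D = directD[OF d(1)]
    have "V \<noteq> U" "W \<noteq> U" using D d submodule_zero by blast+
    then have "V \<subset> U" "W \<subset> U" using D by auto
    then have "card V < card U" "card W < card U" "finite V" "finite W"
      using less.prems(2) psubset_card_mono finite_subset by blast+
    then obtain n m where "dec R M V n" "dec R M W m" using less.hyps D by metis
    then show ?thesis using dec_add d(1) by blast
  qed
qed

end

context lin_map
begin

lemma restrict_dom: "\<lbrakk>submodule U R M; U \<subseteq> B\<rbrakk> \<Longrightarrow> lin_map R M U N f"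
  using lin_on_subset[OF lin] M.lmod_axioms N.lmod_axioms by (intro lin_map.intro lin_map_axioms.intro)

lemma inverse_lin_map:
  assumes "inj_on f B" shows "lin_map R N (f ` B) M (inv_into B f)"
proof (intro lin_map.intro lin_map_axioms.intro M.lmod_axioms N.lmod_axioms)
  show "submodule (f ` B) R N" using image_submodule dom by simp
  note S = M.submoduleD[OF dom]
  have "inv_into B f (f x \<oplus>\<^bsub>N\<^esub> f y) = x \<oplus>\<^bsub>M\<^esub> y" if "x \<in> B" "y \<in> B" for x y
    using that S inv_into_f_f[OF assms, of "x \<oplus>\<^bsub>M\<^esub> y"] by (simp add: map_add)
  moreover have "inv_into B f (a \<odot>\<^bsub>N\<^esub> f x) = a \<odot>\<^bsub>M\<^esub> x" if "x \<in> B" "a \<in> carrier R" for x a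
    using that S inv_into_f_f[OF assms, of "a \<odot>\<^bsub>M\<^esub> x"] by (simp add: map_smult)
  ultimately show "lin_on R N (f ` B) M (inv_into B f)"
    using S assms by (auto simp: lin_on_def)
qed

lemma image_indec:
  assumes U: "indec R M U" "U \<subseteq> B" "inj_on f U" shows "indec R N (f ` U)"
proof -
  note sU = indecD(1)[OF U(1)]
  interpret U: lin_map R M U N f using restrict_dom sU U by blast
  interpret g: lin_map R N "f ` U" M "inv_into U f" by (rule U.inverse_lin_map[OF U(3)])
  have "V = {\<zero>\<^bsub>N\<^esub>} \<or> W = {\<zero>\<^bsub>N\<^esub>}" if d: "direct R N V W (f ` U)" for V W
  proof -
    have VW: "V \<subseteq> f ` U" "W \<subseteq> f ` U" using N.directD[OF d] by auto
    have image_back: "f ` inv_into U f ` X = X" if "X \<subseteq> f ` U" for X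
      by (rule image_inv_into_cancel[OF refl that])
    have "direct R M (inv_into U f ` V) (inv_into U f ` W) U"
      using g.image_direct[OF d order_refl] U(3) by (simp add: inj_on_inv_into)
    then consider "inv_into U f ` V = {\<zero>\<^bsub>M\<^esub>}" | "inv_into U f ` W = {\<zero>\<^bsub>M\<^esub>}"
      using indecD(3)[OF U(1)] by blast
    then show ?thesis
      by cases (use image_back[OF VW(1)] image_back[OF VW(2)] in auto)
  qed
  moreover have "f ` U \<noteq> {\<zero>\<^bsub>N\<^esub>}"
  proof
    assume "f ` U = {\<zero>\<^bsub>N\<^esub>}"
    then have "f x = \<zero>\<^bsub>N\<^esub>" if "x \<in> U" for x using that by blast
    then have "U \<subseteq> {\<zero>\<^bsub>M\<^esub>}" using U.inj_on_kernel[OF U(3)] by auto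
    then show False using indecD(2)[OF U(1)] M.submodule_zero[OF sU] by blast
  qed
  ultimately show ?thesis using U.image_submodule[OF sU] unfolding indec_def by blast
qed

lemma image_dec:
  assumes "dec R M C n" "C \<subseteq> B" "inj_on f C" shows "dec R N (f ` C) n"
  using assms
proof (induction rule: dec.induct)
  case dec_zero
  then show ?case by (simp add: dec.dec_zero)
next
  case (dec_Suc U C' n C)
  note D = M.directD[OF dec_Suc.hyps(3)]
  have "U \<subseteq> B" "C' \<subseteq> B" "inj_on f U" "inj_on f C'"
    using D dec_Suc.prems inj_on_subset by blast+
  then show ?case
    using dec.dec_Suc[OF image_indec[OF dec_Suc.hyps(1)] dec_Suc.IH
        image_direct[OF dec_Suc.hyps(3) dec_Suc.prems]] by blast
qed

end

context lmod
begin

text \<open>Two complements of the same submodule are isomorphic, by projecting one onto the other.\<close>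

lemma dec_complement:
  assumes W: "direct R M A W B" and C: "direct R M A C B" and dec: "dec R M C n"
  shows "dec R M W n"
proof -
  note DW = directD[OF W] and DC = directD[OF C]
  obtain p q where "lin_on R M B M p" and pq: "lin_on R M B M q" "p ` B \<subseteq> A" "q ` B \<subseteq> W"
    "\<And>x. x \<in> B \<Longrightarrow> x = p x \<oplus> q x"
    "\<And>v w. \<lbrakk>v \<in> A; w \<in> W\<rbrakk> \<Longrightarrow> p (v \<oplus> w) = v \<and> q (v \<oplus> w) = w"
    "\<And>v. v \<in> A \<Longrightarrow> p v = v \<and> q v = \<zero>" "\<And>w. w \<in> W \<Longrightarrow> p w = \<zero> \<and> q w = w"
    by (rule direct_projections[OF W]) (rule that)
  interpret q: lin_map R M B M q
    using pq DW lmod_axioms by (intro lin_map.intro lin_map_axioms.intro)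
  interpret qC: lin_map R M C M q by (rule q.restrict_dom) (use DC in auto)
  have "inj_on q C"
  proof (rule qC.inj_onI_kernel)
    fix x assume x: "x \<in> C" "q x = \<zero>"
    then have xB: "x \<in> B" using DC by blast
    then have pA: "p x \<in> A" using pq(2) by blast
    then have "x = p x" using pq(4)[OF xB] x(2) submodule_carr[OF DW(1)] by simp
    then have "x \<in> A" using pA by simp
    then show "x = \<zero>" using x DC by blast
  qed
  moreover have "q ` C = W"
  proof
    show "q ` C \<subseteq> W" using pq(3) DC by blast
    show "W \<subseteq> q ` C"
    proof
      fix w assume w: "w \<in> W"
      then have "w \<in> A <+>\<^bsub>M\<^esub> C" using DW DC by blast
      then obtain a c where ac: "a \<in> A" "c \<in> C" "w = a \<oplus> c" by (auto simp: set_add_iff)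
      have "q w = q a \<oplus> q c" unfolding ac(3) by (rule q.map_add) (use ac DC in auto)
      then have "w = q c" using pq(6)[OF ac(1)] pq(7)[OF w] ac(2) by simp
      then show "w \<in> q ` C" using ac(2) by blast
    qed
  qed
  ultimately show ?thesis using qC.image_dec[OF dec] by simp
qed

text \<open>The exchange step of the Krull-Schmidt theorem. Project \<open>V\<close> along the given decomposition
  \<open>B = U \<oplus> C\<close> and back to \<open>V\<close>; by locality one of the two composites \<open>V \<rightarrow> U \<rightarrow> V\<close> and
  \<open>V \<rightarrow> C \<rightarrow> V\<close> is bijective. In the first case \<open>U\<close> and \<open>V\<close> have the common complement \<open>W\<close>;
  in the second, \<open>V\<close> is replaced by its image in \<open>C\<close>, to which induction applies.\<close>

lemma dec_remove:
  assumes "dec R M B m" "finite B" "direct R M V W B" "indec R M V"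
  shows "\<exists>m'. m = Suc m' \<and> dec R M W m'"
  using assms
proof (induction arbitrary: V W rule: dec.induct)
  case dec_zero
  then have False using directD(6) submodule_zero indecD(1,2)
    by (metis empty_iff subset_singleton_iff)
  then show ?case ..
next
  case (dec_Suc U C m B)
  note dVW = dec_Suc.prems(2) and dUC = dec_Suc.hyps(3) and iV = dec_Suc.prems(3)
  note D = directD[OF dVW] and E = directD[OF dUC]
  obtain p where p: "lin_on R M B M p" "p ` B \<subseteq> V"
    "\<And>v. v \<in> V \<Longrightarrow> p v = v" "\<And>w. w \<in> W \<Longrightarrow> p w = \<zero>"
    and ker: "\<And>x. x \<in> B \<Longrightarrow> p x = \<zero> \<Longrightarrow> x \<in> W"
  proof (rule direct_projections[OF dVW])
    fix p q
    assume a: "lin_on R M B M p" "p ` B \<subseteq> V" "q ` B \<subseteq> W" "\<And>x. x \<in> B \<Longrightarrow> x = p x \<oplus> q x"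
      "\<And>v. v \<in> V \<Longrightarrow> p v = v \<and> q v = \<zero>" "\<And>w. w \<in> W \<Longrightarrow> p w = \<zero> \<and> q w = w"
    have "x \<in> W" if "x \<in> B" "p x = \<zero>" for x
    proof -
      have "q x \<in> W" using a(3) that(1) by blast
      then show ?thesis using a(4)[OF that(1)] that(2) submodule_carr[OF D(2)] by (metis M.l_zero)
    qed
    then show thesis using a that by metis
  qed
  obtain e e' where e: "lin_on R M B M e" "lin_on R M B M e'" "e ` B \<subseteq> U" "e' ` B \<subseteq> C"
    "\<And>x. x \<in> B \<Longrightarrow> x = e x \<oplus> e' x"
    by (rule direct_projections[OF dUC]) (rule that)
  interpret p: lin_map R M B M p
    using p D lmod_axioms by (intro lin_map.intro lin_map_axioms.intro)
  have fin: "finite V" using dec_Suc.prems(1) D finite_subset by blast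
  have complement: "direct R M (h ` V) W B"
    if h: "lin_on R M B M h" "h ` B \<subseteq> B" and inj: "inj_on (\<lambda>x. p (h x)) V" for h
  proof -
    interpret h: lin_map R M B M h
      using h D lmod_axioms by (intro lin_map.intro lin_map_axioms.intro)
    have "(\<lambda>x. p (h x)) ` V \<subseteq> V" using p(2) h(2) D(6) by blast
    then have phV: "(\<lambda>x. p (h x)) ` V = V" using inj fin endo_inj_surj by blast
    interpret ph: lin_map R M V M "\<lambda>x. p (h x)"
      using lin_on_subset[OF lin_on_compose[OF h(1) p(1) h(2)] D(6)] D lmod_axioms
      by (intro lin_map.intro lin_map_axioms.intro)
    have hVB: "h ` V \<subseteq> B" using h(2) D(6) by blast
    show ?thesis
    proof (rule directI)
      show sh: "submodule (h ` V) R M" by (rule h.image_submodule[OF D(1,6)])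
      show "x = \<zero>" if "x \<in> h ` V" "x \<in> W" for x
      proof -
        obtain v where v: "v \<in> V" "x = h v" using \<open>x \<in> h ` V\<close> by (rule imageE)
        then have "v = \<zero>" using ph.inj_on_kernel[OF inj] p(4)[OF that(2)] by blast
        then show ?thesis using v by simp
      qed
      show "h ` V <+>\<^bsub>M\<^esub> W = B"
      proof
        show "h ` V <+>\<^bsub>M\<^esub> W \<subseteq> B" using set_add_least[OF D(5) hVB D(7)] .
        show "B \<subseteq> h ` V <+>\<^bsub>M\<^esub> W"
        proof
          fix x assume x: "x \<in> B"
            have "p x \<in> p ` B" using x by blast
          then have "p x \<in> (\<lambda>x. p (h x)) ` V" unfolding phV using p(2) by blast
          then obtain v where v: "v \<in> V" "p x = p (h v)" by auto
          have hv: "h v \<in> B" using hVB v(1) by blast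
          have "p (x \<ominus> h v) = \<zero>" using p.map_eq_iff_minus[OF x hv] v by simp
          then have "x \<ominus> h v \<in> W" using ker submodule_minus[OF D(5) x hv] by blast
          then have "h v \<oplus> (x \<ominus> h v) \<in> h ` V <+>\<^bsub>M\<^esub> W" using v(1) set_addI by blast
          moreover have "h v \<oplus> (x \<ominus> h v) = x"
            using x hv submodule_carr[OF D(5)] by (metis M.a_comm M.minus_closed minus_add_cancel)
          ultimately show "x \<in> h ` V <+>\<^bsub>M\<^esub> W" by simp
        qed
      qed
    qed (use D in auto)
  qed
  have eB: "e ` B \<subseteq> B" and eB': "e' ` B \<subseteq> B" using e(3,4) E by blast+
  have "inj_on (\<lambda>x. p (e x)) V \<or> inj_on (\<lambda>x. p (e' x)) V"
  proof (rule indec_endo_local[OF iV fin])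
    show "lin_on R M V M (\<lambda>x. p (e x))" "lin_on R M V M (\<lambda>x. p (e' x))"
      using lin_on_subset[OF lin_on_compose[OF _ p(1)] D(6)] e eB eB' by blast+
    show "(\<lambda>x. p (e x)) ` V \<subseteq> V" "(\<lambda>x. p (e' x)) ` V \<subseteq> V"
      using p(2) eB eB' D(6) by blast+
    fix x assume x: "x \<in> V"
    then have xB: "x \<in> B" using D by blast
    then have "p x = p (e x) \<oplus> p (e' x)"
      using p.map_add[of "e x" "e' x"] e(5)[OF xB] eB eB' by (metis image_subset_iff)
    then show "x = p (e x) \<oplus> p (e' x)" using p(3)[OF x] by simp
  qed
  then consider "inj_on (\<lambda>x. p (e x)) V" | "inj_on (\<lambda>x. p (e' x)) V" by blast
  then show ?case
  proof cases
    case 1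
    note F = complement[OF e(1) eB 1]
    have eVU: "e ` V \<subseteq> U" using e(3) D by blast
    have dU: "direct R M (e ` V) (U \<inter> W) U" by (rule direct_Int[OF F E(1) eVU E(6)])
    have "e ` V \<noteq> {\<zero>}"
    proof
      assume "e ` V = {\<zero>}"
      then have "W = B" using directD(3)[OF F] set_add_zero(2) submoduleD(1) D by metis
      then have "V = {\<zero>}" using D by blast
      then show False using indecD(2)[OF iV] by blast
    qed
    then have "U \<inter> W = {\<zero>}" using indecD(3)[OF dec_Suc.hyps(1) dU] by blast
    then have "e ` V = U" using directD(3)[OF dU] directD(1)[OF F] set_add_zero(1) submoduleD(1) by metis
    then show ?thesis using dec_complement[OF _ dUC dec_Suc.hyps(2)] F by blast
  next
    case 2
    note F = complement[OF e(2) eB' 2]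
    define V' where "V' = e' ` V"
    have F: "direct R M V' W B" using F by (simp add: V'_def)
    interpret e': lin_map R M B M e'
      using e D lmod_axioms by (intro lin_map.intro lin_map_axioms.intro)
    have inj: "inj_on e' V" using 2 by (metis (no_types, lifting) inj_on_def)
    have iV': "indec R M V'" using e'.image_indec[OF iV D(6) inj] by (simp add: V'_def)
    have V'C: "V' \<subseteq> C" using e(4) D by (auto simp: V'_def)
    have dC: "direct R M V' (C \<inter> W) C" by (rule direct_Int[OF F E(2) V'C E(7)])
    have "finite C" using dec_Suc.prems(1) E finite_subset by blast
    then obtain m' where m': "m = Suc m'" "dec R M (C \<inter> W) m'"
      using dec_Suc.IH[OF _ dC iV'] by blast
    note H = direct_assoc[OF dC direct_sym[OF dUC]]
    have "dec R M ((C \<inter> W) <+>\<^bsub>M\<^esub> U) (m' + 1)"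
      using dec_add[OF m'(2) dec_indec[OF dec_Suc.hyps(1)] H(1)] .
    then have "dec R M W (m' + 1)" using dec_complement[OF F H(2)] by blast
    then show ?thesis using m' by simp
  qed
qed

text \<open>The Krull-Schmidt theorem, as far as the number of summands is concerned: the first summand of
  one decomposition can be removed from the other.\<close>

theorem dec_unique:
  assumes "dec R M B n" "dec R M B m" "finite B" shows "n = m"
  using assms
proof (induction arbitrary: m rule: dec.induct)
  case dec_zero
  then show ?case by simp
next
  case (dec_Suc U C n B)
  obtain m' where m': "m = Suc m'" "dec R M C m'"
    using dec_remove[OF dec_Suc.prems(1,2) dec_Suc.hyps(3,1)] by blast
  have "finite C" using dec_Suc.prems(2) directD(7)[OF dec_Suc.hyps(3)] finite_subset by blast
  then show ?case using dec_Suc.IH m' by blast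
qed

end

section \<open>Families of summands\<close>

context lmod
begin

fun partial_sum :: "(nat \<Rightarrow> 'm set) \<Rightarrow> nat \<Rightarrow> 'm set" where
  "partial_sum U 0 = {\<zero>}"
| "partial_sum U (Suc n) = U n <+>\<^bsub>M\<^esub> partial_sum U n"

lemma partial_sum_submodule:
  "(\<And>i. i < n \<Longrightarrow> submodule (U i) R M) \<Longrightarrow> submodule (partial_sum U n) R M"
  by (induction n) (auto intro!: submodule_set_add)

lemma finsum_upd:
  assumes "\<And>i. i < n \<Longrightarrow> submodule (U i) R M" "u \<in> (\<Pi>\<^sub>E i\<in>{..<n}. U i)" "v \<in> carrier M"
  shows "finsum M (u(n := v)) {..<Suc n} = v \<oplus> finsum M u {..<n}"
proof -
  have c: "u i \<in> carrier M" if "i < n" for i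
    using assms(1)[OF that] assms(2) that submodule_carr by (metis PiE_mem lessThan_iff)
  have "finsum M (u(n := v)) (insert n {..<n}) = (u(n := v)) n \<oplus> finsum M (u(n := v)) {..<n}"
    using c assms(3) by (intro M.finsum_insert) (auto simp: Pi_def)
  also have "finsum M (u(n := v)) {..<n} = finsum M u {..<n}"
    using c by (intro M.finsum_cong') (auto simp: Pi_def)
  finally show ?thesis by (simp only: lessThan_Suc fun_upd_same)
qed

lemma PiE_Suc:
  "(\<Pi>\<^sub>E i\<in>{..<Suc n}. U i) = (\<lambda>(v, u). u(n := v)) ` (U n \<times> (\<Pi>\<^sub>E i\<in>{..<n}. U i))"
  by (simp add: lessThan_Suc PiE_insert_eq)

lemma partial_sum_eq_image:
  assumes "\<And>i. i < n \<Longrightarrow> submodule (U i) R M"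
  shows "partial_sum U n = (\<lambda>u. finsum M u {..<n}) ` (\<Pi>\<^sub>E i\<in>{..<n}. U i)"
  using assms
proof (induction n)
  case (Suc n)
  have IH: "partial_sum U n = (\<lambda>u. finsum M u {..<n}) ` (\<Pi>\<^sub>E i\<in>{..<n}. U i)"
    using Suc by simp
  have "finsum M (u(n := v)) {..<Suc n} = v \<oplus> finsum M u {..<n}"
    if "v \<in> U n" "u \<in> (\<Pi>\<^sub>E i\<in>{..<n}. U i)" for u v
    using finsum_upd[of n U u v] that Suc.prems submodule_carr[of "U n"] by simp
  then have "(\<lambda>u. finsum M u {..<Suc n}) ` (\<Pi>\<^sub>E i\<in>{..<Suc n}. U i) =
      (\<Union>v\<in>U n. \<Union>u\<in>(\<Pi>\<^sub>E i\<in>{..<n}. U i). {v \<oplus> finsum M u {..<n}})"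
    unfolding PiE_Suc by (fastforce simp: image_iff)
  then show ?case by (simp add: IH set_add_def')
qed simp

text \<open>Uniqueness of the representation as a sum over a family, one index at a time. This is the bridge
  between families of summands and binary direct sums.\<close>

lemma finsum_inj_Suc_iff:
  assumes sub: "\<And>i. i < Suc n \<Longrightarrow> submodule (U i) R M"
  shows "inj_on (\<lambda>u. finsum M u {..<Suc n}) (\<Pi>\<^sub>E i\<in>{..<Suc n}. U i) \<longleftrightarrow>
    inj_on (\<lambda>u. finsum M u {..<n}) (\<Pi>\<^sub>E i\<in>{..<n}. U i) \<and>
    direct R M (U n) (partial_sum U n) (partial_sum U (Suc n))"
    (is "inj_on ?F' ?P' \<longleftrightarrow> inj_on ?F ?P \<and> ?D")
proof -
  have sn: "submodule (U n) R M" and sp: "submodule (partial_sum U n) R M"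
    using sub partial_sum_submodule[of n U] by auto
  have im: "partial_sum U n = ?F ` ?P" using partial_sum_eq_image[of n U] sub by simp
  have upd: "?F' (u(n := v)) = v \<oplus> ?F u" "u(n := v) \<in> ?P'" if "u \<in> ?P" "v \<in> U n" for u v
    using finsum_upd[of n U u v] that sub submodule_carr[OF sn] unfolding PiE_Suc by auto
  have fc: "?F u \<in> carrier M" if "u \<in> ?P" for u using that im submodule_carr[OF sp] by blast
  have upd_eqD: "u = u'" if "u \<in> ?P" "u' \<in> ?P" "u(n := v) = u'(n := v')" for u u' v v'
  proof (rule PiE_ext[OF that(1,2)])
    fix i assume "i \<in> {..<n}"
    then show "u i = u' i" using fun_cong[OF that(3), of i] by simp
  qed
  show ?thesis
  proof (intro iffI conjI)
    assume inj: "inj_on ?F' ?P'"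
    note z = submodule_zero[OF sn]
    show "inj_on ?F ?P"
    proof (rule inj_onI)
      fix u u' assume u: "u \<in> ?P" "u' \<in> ?P" "?F u = ?F u'"
      then have "?F' (u(n := \<zero>)) = ?F' (u'(n := \<zero>))" using upd z by simp
      then show "u = u'" using inj_onD[OF inj] upd z u upd_eqD by metis
    qed
    show ?D
    proof (rule directI[OF sn sp])
      fix x assume x: "x \<in> U n" "x \<in> partial_sum U n"
      then obtain u where u: "u \<in> ?P" "x = ?F u" using im by blast
      obtain u0 where u0: "u0 \<in> ?P" "?F u0 = \<zero>" using im submodule_zero[OF sp] by (metis imageE)
      have "?F' (u(n := \<zero>)) = ?F' (u0(n := x))"
        using upd z u u0 x submodule_carr[OF sn] fc by simp
      then have "u(n := \<zero>) = u0(n := x)" using inj_onD[OF inj] upd z u u0 x by blast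
      then show "x = \<zero>" by (metis fun_upd_same)
    qed simp
  next
    assume *: "inj_on ?F ?P \<and> ?D"
    show "inj_on ?F' ?P'"
    proof (rule inj_onI)
      fix w w' assume w: "w \<in> ?P'" "w' \<in> ?P'" and eq: "?F' w = ?F' w'"
      obtain u v u' v' where uv: "u \<in> ?P" "v \<in> U n" "w = u(n := v)"
        "u' \<in> ?P" "v' \<in> U n" "w' = u'(n := v')" using w unfolding PiE_Suc by auto
      have "v \<oplus> ?F u = v' \<oplus> ?F u'" using eq uv upd by simp
      moreover have "?F u \<in> partial_sum U n" "?F u' \<in> partial_sum U n" using uv im by auto
      ultimately have "v = v'" "?F u = ?F u'"
        using direct_unique[OF conjunct2[OF *], of v v' "?F u" "?F u'"] uv by auto
      then show "w = w'" using inj_onD[OF conjunct1[OF *]] uv by blast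
    qed
  qed
qed

lemma partial_sum_dec:
  assumes "\<And>i. i < n \<Longrightarrow> indec R M (U i)"
    and "inj_on (\<lambda>u. finsum M u {..<n}) (\<Pi>\<^sub>E i\<in>{..<n}. U i)"
  shows "dec R M (partial_sum U n) n"
  using assms
proof (induction n)
  case (Suc n)
  then have "\<And>i. i < Suc n \<Longrightarrow> submodule (U i) R M" using indecD(1) by blast
  then show ?case
    using Suc finsum_inj_Suc_iff[of n U] by (blast intro: dec_Suc less_SucI)
qed simp

lemma dec_partial_sum:
  assumes "dec R M B n"
  shows "\<exists>U. (\<forall>i<n. indec R M (U i)) \<and> partial_sum U n = B \<and>
    inj_on (\<lambda>u. finsum M u {..<n}) (\<Pi>\<^sub>E i\<in>{..<n}. U i)"
  using assms
proof (induction rule: dec.induct)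
  case dec_zero
  then show ?case by auto
next
  case (dec_Suc V C n B)
  obtain U where U: "\<And>i. i < n \<Longrightarrow> indec R M (U i)" "partial_sum U n = C"
    "inj_on (\<lambda>u. finsum M u {..<n}) (\<Pi>\<^sub>E i\<in>{..<n}. U i)" using dec_Suc.IH by blast
  define U' where "U' = U(n := V)"
  have ind: "indec R M (U' i)" if "i < Suc n" for i
    using U(1) dec_Suc.hyps(1) that by (auto simp: U'_def less_Suc_eq)
  have P: "(\<Pi>\<^sub>E i\<in>{..<n}. U' i) = (\<Pi>\<^sub>E i\<in>{..<n}. U i)" by (intro PiE_cong) (simp add: U'_def)
  have "partial_sum U' k = partial_sum U k" if "k \<le> n" for k
    using that by (induction k) (auto simp: U'_def)
  then have S: "partial_sum U' n = C" using U by simp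
  have "U' n = V" by (simp add: U'_def)
  then have S': "partial_sum U' (Suc n) = B" using S directD(3)[OF dec_Suc.hyps(3)] by simp
  have "inj_on (\<lambda>u. finsum M u {..<Suc n}) (\<Pi>\<^sub>E i\<in>{..<Suc n}. U' i)"
    using finsum_inj_Suc_iff[of n U'] ind indecD(1) U(3) dec_Suc.hyps(3)
    unfolding P S S' \<open>U' n = V\<close> by blast
  then show ?case using ind S' by blast
qed

lemma internal_direct_sum_iff:
  "internal_direct_sum R M n U \<longleftrightarrow> (\<forall>i<n. submodule (U i) R M) \<and>
     partial_sum U n = carrier M \<and> inj_on (\<lambda>u. finsum M u {..<n}) (\<Pi>\<^sub>E i\<in>{..<n}. U i)"
proof (cases "\<forall>i<n. submodule (U i) R M")
  case True
  then have im: "partial_sum U n = (\<lambda>u. finsum M u {..<n}) ` (\<Pi>\<^sub>E i\<in>{..<n}. U i)"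
    and sub: "partial_sum U n \<subseteq> carrier M"
    using partial_sum_eq_image partial_sum_submodule submoduleD(1) by blast+
  have "(\<forall>x\<in>carrier M. \<exists>!u. u \<in> (\<Pi>\<^sub>E i\<in>{..<n}. U i) \<and> x = finsum M u {..<n}) \<longleftrightarrow>
    partial_sum U n = carrier M \<and> inj_on (\<lambda>u. finsum M u {..<n}) (\<Pi>\<^sub>E i\<in>{..<n}. U i)"
    (is "?L \<longleftrightarrow> ?R")
  proof
    assume L: ?L
    have "carrier M \<subseteq> partial_sum U n" using L im by blast
    moreover have "inj_on (\<lambda>u. finsum M u {..<n}) (\<Pi>\<^sub>E i\<in>{..<n}. U i)"
    proof (rule inj_onI)
      fix u u' assume u: "u \<in> (\<Pi>\<^sub>E i\<in>{..<n}. U i)" "u' \<in> (\<Pi>\<^sub>E i\<in>{..<n}. U i)"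
        "finsum M u {..<n} = finsum M u' {..<n}"
      then have "finsum M u {..<n} \<in> carrier M" using im sub by blast
      then show "u = u'" using L u by blast
    qed
    ultimately show ?R using sub by blast
  next
    assume R: ?R
    then show ?L unfolding im inj_on_def by blast
  qed
  then show ?thesis using True by (simp add: internal_direct_sum_def)
qed (auto simp: internal_direct_sum_def)

lemma num_summands_eqI:
  assumes fin: "finite (carrier M)" and dec: "dec R M (carrier M) n"
  shows "num_summands R M = n"
  unfolding num_summands_def
proof (rule the_equality)
  obtain U where U: "\<forall>i<n. indec R M (U i)" "partial_sum U n = carrier M"
    "inj_on (\<lambda>u. finsum M u {..<n}) (\<Pi>\<^sub>E i\<in>{..<n}. U i)" using dec_partial_sum[OF dec] by blast
  then show "\<exists>U. internal_direct_sum R M n U \<and> (\<forall>i<n. indecomposable R (sub_module M (U i)))"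
    using indecD(1) indecomposable_iff_indec unfolding internal_direct_sum_iff by blast
next
  fix m assume "\<exists>U. internal_direct_sum R M m U \<and> (\<forall>i<m. indecomposable R (sub_module M (U i)))"
  then obtain U where U: "internal_direct_sum R M m U" "\<forall>i<m. indecomposable R (sub_module M (U i))"
    by blast
  then have "\<forall>i<m. indec R M (U i)" using indecomposable_iff_indec unfolding internal_direct_sum_iff by blast
  then have "dec R M (carrier M) m"
    using U(1) partial_sum_dec[of m U] unfolding internal_direct_sum_iff by simp
  then show "m = n" using dec_unique dec fin by blast
qed

lemma dec_num_summands: "finite (carrier M) \<Longrightarrow> dec R M (carrier M) (num_summands R M)"
  using ex_dec[OF submodule_whole] num_summands_eqI by blast

end

section \<open>Uniform and hollow modules\<close>

text \<open>The zero module counts as uniform and as hollow, which saves case distinctions for submodules and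
  images.\<close>

definition uniform :: "('a, 'r) ring_scheme \<Rightarrow> ('a, 'm) module \<Rightarrow> 'm set \<Rightarrow> bool" where
  "uniform R M B \<longleftrightarrow> (\<forall>V W. submodule V R M \<and> submodule W R M \<and> V \<subseteq> B \<and> W \<subseteq> B \<and>
     V \<inter> W = {\<zero>\<^bsub>M\<^esub>} \<longrightarrow> V = {\<zero>\<^bsub>M\<^esub>} \<or> W = {\<zero>\<^bsub>M\<^esub>})"

definition hollow :: "('a, 'r) ring_scheme \<Rightarrow> ('a, 'm) module \<Rightarrow> 'm set \<Rightarrow> bool" where
  "hollow R M B \<longleftrightarrow> (\<forall>V W. submodule V R M \<and> submodule W R M \<and> V <+>\<^bsub>M\<^esub> W = B \<longrightarrow> V = B \<or> W = B)"

lemma uniformD: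
  "\<lbrakk>uniform R M B; submodule V R M; submodule W R M; V \<subseteq> B; W \<subseteq> B; V \<inter> W = {\<zero>\<^bsub>M\<^esub>}\<rbrakk>
    \<Longrightarrow> V = {\<zero>\<^bsub>M\<^esub>} \<or> W = {\<zero>\<^bsub>M\<^esub>}"
  unfolding uniform_def by blast

lemma hollowD:
  "\<lbrakk>hollow R M B; submodule V R M; submodule W R M; V <+>\<^bsub>M\<^esub> W = B\<rbrakk> \<Longrightarrow> V = B \<or> W = B"
  unfolding hollow_def by blast

context lmod
begin

lemma simple_sub_module_iff:
  assumes "submodule S R M"
  shows "simple_module R (sub_module M S) \<longleftrightarrow>
    S \<noteq> {\<zero>} \<and> (\<forall>U. submodule U R M \<and> U \<subseteq> S \<longrightarrow> U = {\<zero>} \<or> U = S)"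
  using sub_module_left_module[OF assms]
  by (simp add: simple_module_def submodule_sub_module_iff[OF assms])

lemma ex_simple_submodule:
  assumes "submodule U R M" "finite U" "U \<noteq> {\<zero>}"
  shows "\<exists>S\<subseteq>U. submodule S R M \<and> simple_module R (sub_module M S)"
proof -
  obtain S where S: "submodule S R M \<and> S \<subseteq> U \<and> S \<noteq> {\<zero>}"
    and min: "\<And>T. submodule T R M \<and> T \<subseteq> U \<and> T \<noteq> {\<zero>} \<Longrightarrow> card S \<le> card T"
    using ex_has_least_nat[of "\<lambda>S. submodule S R M \<and> S \<subseteq> U \<and> S \<noteq> {\<zero>}" U card] assms by auto
  have "finite S" using S assms(2) finite_subset by blast
  then have "T = {\<zero>} \<or> T = S" if "submodule T R M" "T \<subseteq> S" for T
    using min[of T] that S card_seteq[of S T] by blast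
  then have "simple_module R (sub_module M S)"
    using S simple_sub_module_iff[OF conjunct1[OF S]] by simp
  then show ?thesis using S by blast
qed

lemma ex_maximal_submodule:
  assumes "submodule U R M" "finite (carrier M)" "U \<noteq> carrier M"
  shows "\<exists>W. U \<subseteq> W \<and> maximal_submodule R M W"
proof -
  define P where "P = (\<lambda>W. submodule W R M \<and> U \<subseteq> W \<and> W \<noteq> carrier M)"
  have le: "card W \<le> card (carrier M)" if "P W" for W
    using that assms(2) card_mono submoduleD(1) unfolding P_def by blast
  obtain W where W: "P W" and max: "\<And>T. P T \<Longrightarrow> card T \<le> card W"
    using Lattices_Big.ex_has_greatest_nat[of P U card "Suc (card (carrier M))"] le assms
    by (auto simp: P_def less_Suc_eq_le)
  have "T = W \<or> T = carrier M" if "submodule T R M" "W \<subseteq> T" for T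
  proof (cases "T = carrier M")
    case False
    then have "P T" using that W by (auto simp: P_def)
    moreover have "finite T" using that assms(2) submoduleD(1) finite_subset by blast
    ultimately have "W = T" using max that(2) card_seteq by blast
    then show ?thesis by simp
  qed simp
  then show ?thesis using W unfolding maximal_submodule_def P_def by blast
qed

text \<open>Every nonzero submodule of a finite module contains a simple one. So if the socle is simple, all
  nonzero submodules contain it; and if nonzero submodules always meet, there is only one simple
  submodule.\<close>

lemma simple_socle_iff:
  assumes fin: "finite (carrier M)"
  shows "simple_socle R M \<longleftrightarrow> carrier M \<noteq> {\<zero>} \<and> uniform R M (carrier M)"
proof
  assume L: "simple_socle R M"
  have soc: "S \<subseteq> socle R M" if "submodule S R M" "simple_module R (sub_module M S)" for S
    using that unfolding socle_def by blast
  have socc: "socle R M \<subseteq> carrier M"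
    unfolding socle_def using submodule_whole submoduleD(1) by (intro Inter_lower) auto
  have "submodule (socle R M) R M"
  proof (rule submoduleI[OF socc])
  qed (auto simp: socle_def intro: submoduleD)
  then have min: "socle R M \<noteq> {\<zero>}"
    "\<And>U. \<lbrakk>submodule U R M; U \<subseteq> socle R M\<rbrakk> \<Longrightarrow> U = {\<zero>} \<or> U = socle R M"
    using L simple_sub_module_iff unfolding simple_socle_def by blast+
  have big: "socle R M \<subseteq> V" if V: "submodule V R M" "V \<noteq> {\<zero>}" for V
  proof -
    have "finite V" using fin V(1) submoduleD(1) finite_subset by blast
    then obtain S where S: "S \<subseteq> V" "submodule S R M" "simple_module R (sub_module M S)"
      using ex_simple_submodule V by blast
    then show ?thesis using min(2)[OF S(2) soc[OF S(2,3)]] simple_sub_module_iff[OF S(2)] by blast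
  qed
  have "uniform R M (carrier M)"
    unfolding uniform_def using big min(1) \<open>submodule (socle R M) R M\<close> submodule_zero
    by (metis le_inf_iff subset_singleton_iff empty_iff)
  moreover have "carrier M \<noteq> {\<zero>}" using socc min(1) \<open>submodule (socle R M) R M\<close> submodule_zero
    by (metis subset_singleton_iff empty_iff)
  ultimately show "carrier M \<noteq> {\<zero>} \<and> uniform R M (carrier M)" by blast
next
  assume R: "carrier M \<noteq> {\<zero>} \<and> uniform R M (carrier M)"
  then obtain S where S: "submodule S R M" "simple_module R (sub_module M S)"
    using ex_simple_submodule[OF submodule_whole fin] by blast
  have "T = S" if T: "submodule T R M" "simple_module R (sub_module M T)" for T
  proof -
    have nz: "S \<noteq> {\<zero>}" "T \<noteq> {\<zero>}" using S T simple_sub_module_iff by blast+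
    have "S \<inter> T \<noteq> {\<zero>}"
      using uniformD[OF conjunct2[OF R] S(1) T(1)] nz submoduleD(1) S T by blast
    moreover have "submodule (S \<inter> T) R M" using S T submodule_Int by blast
    ultimately have "S \<inter> T = S" "S \<inter> T = T"
      using S(2) T(2) unfolding simple_sub_module_iff[OF S(1)] simple_sub_module_iff[OF T(1)] by blast+
    then show ?thesis by blast
  qed
  then have "socle R M = S" unfolding socle_def using S by blast
  then show "simple_socle R M" using S by (simp add: simple_socle_def)
qed

end

section \<open>Quotient modules\<close>

text \<open>All module axioms are equations, up to the existence of inverses, and therefore pass to images.
  Quotients and renamings of the elements are instances.\<close>

lemma left_module_surj_image:
  fixes M :: "('a, 'm) module" and N :: "('a, 'n) module"
  assumes "left_module R M" and car: "carrier N = h ` carrier M" and z: "\<zero>\<^bsub>N\<^esub> = h \<zero>\<^bsub>M\<^esub>"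
    and add: "\<And>x y. \<lbrakk>x \<in> carrier M; y \<in> carrier M\<rbrakk> \<Longrightarrow> h x \<oplus>\<^bsub>N\<^esub> h y = h (x \<oplus>\<^bsub>M\<^esub> y)"
    and smult: "\<And>a x. \<lbrakk>a \<in> carrier R; x \<in> carrier M\<rbrakk> \<Longrightarrow> a \<odot>\<^bsub>N\<^esub> h x = h (a \<odot>\<^bsub>M\<^esub> x)"
  shows "left_module R N"
proof -
  interpret M: lmod R M by (intro lmod.intro assms(1))
  have "abelian_group N"
  proof (rule abelian_groupI)
    show "\<And>x. x \<in> carrier N \<Longrightarrow> \<exists>y\<in>carrier N. y \<oplus>\<^bsub>N\<^esub> x = \<zero>\<^bsub>N\<^esub>"
    proof -
      fix x assume "x \<in> carrier N"
      then obtain u where u: "u \<in> carrier M" "x = h u" using car by blast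
      then have "h (\<ominus>\<^bsub>M\<^esub> u) \<oplus>\<^bsub>N\<^esub> x = \<zero>\<^bsub>N\<^esub>" by (simp add: add z M.M.l_neg)
      then show "\<exists>y\<in>carrier N. y \<oplus>\<^bsub>N\<^esub> x = \<zero>\<^bsub>N\<^esub>" using u car by blast
    qed
  qed (auto simp: car z add M.M.a_assoc, simp add: M.M.a_comm)
  then show ?thesis
    unfolding left_module_def left_module_axioms_def
    using M.R.ring_axioms
    by (auto simp: car add smult M.smult_l_distr M.smult_r_distr M.smult_assoc1 M.smult_one)
qed

context lmod
begin

lemma abelian_subgroup:
  assumes "submodule U R M" shows "abelian_subgroup U M"
  using assms M.abelian_group_axioms submodule.axioms(1)
  by (intro abelian_subgroupI3 additive_subgroupI) auto

lemma quot_module_facts: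
  assumes U: "submodule U R M"
  shows quot_carrier: "carrier (quot_module M U) = (\<lambda>x. U +> x) ` carrier M"
    and quot_left_module: "left_module R (quot_module M U)"
    and quot_proj_lin: "lin_on R M (carrier M) (quot_module M U) (\<lambda>x. U +> x)"
    and quot_proj_kernel: "x \<in> carrier M \<Longrightarrow> U +> x = \<zero>\<^bsub>quot_module M U\<^esub> \<longleftrightarrow> x \<in> U"
proof -
  interpret U: abelian_subgroup U M by (rule abelian_subgroup[OF U])
  let ?Q = "quot_module M U" and ?h = "\<lambda>x. U +> x"
  show car: "carrier ?Q = ?h ` carrier M"
    by (auto simp: quot_module_def A_RCOSETS_def')
  have z: "\<zero>\<^bsub>?Q\<^esub> = ?h \<zero>"
    using submoduleD(1)[OF U] by (simp add: quot_module_def)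
  have add: "?h x \<oplus>\<^bsub>?Q\<^esub> ?h y = ?h (x \<oplus> y)" if "x \<in> carrier M" "y \<in> carrier M" for x y
    using that by (simp add: quot_module_def U.a_rcos_sum)
  have sub: "subgroup U (add_monoid M)" using U submodule.axioms(1) by blast
  have smult: "a \<odot>\<^bsub>?Q\<^esub> ?h x = ?h (a \<odot> x)" if "a \<in> carrier R" "x \<in> carrier M" for a x
  proof -
    have eq: "U +> (a \<odot> y) = U +> (a \<odot> x)" if y: "y \<in> U +> x" for y
    proof -
      obtain u where u: "u \<in> U" "y = u \<oplus> x" using y by (auto simp: a_r_coset_def')
      then have "a \<odot> y = a \<odot> u \<oplus> a \<odot> x"
        using \<open>a \<in> carrier R\<close> \<open>x \<in> carrier M\<close> submodule_carr[OF U] by (simp add: smult_r_distr)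
      then have "a \<odot> y \<in> U +> (a \<odot> x)"
        using submodule_smult[OF U \<open>a \<in> carrier R\<close> u(1)] by (auto simp: a_r_coset_def')
      then show ?thesis
        using M.a_repr_independence[OF _ _ sub] \<open>a \<in> carrier R\<close> \<open>x \<in> carrier M\<close> by blast
    qed
    have "x \<in> U +> x" using U.a_rcos_self \<open>x \<in> carrier M\<close> by blast
    then have "(\<Union>y\<in>U +> x. U +> (a \<odot> y)) = U +> (a \<odot> x)"
      using eq \<open>x \<in> U +> x\<close> by (intro SUP_eq_const) blast+
    then show ?thesis by (simp add: quot_module_def)
  qed
  show "left_module R ?Q"
    by (rule left_module_surj_image[OF left_module_axioms car z add smult])
  show "lin_on R M (carrier M) ?Q ?h"
    using car add smult by (auto simp: lin_on_def)
  show "U +> x = \<zero>\<^bsub>?Q\<^esub> \<longleftrightarrow> x \<in> U" if "x \<in> carrier M"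
    using M.a_coset_join1[OF _ that sub] M.a_coset_join2[OF that sub] by (auto simp: quot_module_def)
qed

lemma maximal_submodule_hollow_unique:
  assumes "hollow R M (carrier M)" "maximal_submodule R M U" "maximal_submodule R M W"
  shows "U = W"
proof -
  have s: "submodule U R M" "submodule W R M" "U \<noteq> carrier M" "W \<noteq> carrier M"
    using assms(2,3) unfolding maximal_submodule_def by blast+
  then have "U <+>\<^bsub>M\<^esub> W \<noteq> carrier M" using hollowD[OF assms(1)] by blast
  moreover have "submodule (U <+>\<^bsub>M\<^esub> W) R M" "U \<subseteq> U <+>\<^bsub>M\<^esub> W" "W \<subseteq> U <+>\<^bsub>M\<^esub> W"
    using s set_add_upper by auto
  ultimately have "U <+>\<^bsub>M\<^esub> W = U" "U <+>\<^bsub>M\<^esub> W = W"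
    using assms(2,3) unfolding maximal_submodule_def by blast+
  then show ?thesis by blast
qed

lemma radical_submodule: "submodule (radical R M) R M"
  by (rule submoduleI) (auto simp: radical_def maximal_submodule_def intro: submoduleD)

text \<open>Every proper submodule of a finite module lies in a maximal one. So if the top is simple, the
  radical is the only maximal submodule and contains all proper submodules; and in a hollow module
  two distinct maximal submodules would generate everything.\<close>

lemma simple_top_iff:
  assumes fin: "finite (carrier M)"
  shows "simple_top R M \<longleftrightarrow> carrier M \<noteq> {\<zero>} \<and> hollow R M (carrier M)"
proof -
  define T where "T = radical R M"
  have sT: "submodule T R M" unfolding T_def by (rule radical_submodule)
  define h where "h = (\<lambda>x. T +> x)"
  let ?Q = "quot_module M T"
  interpret h: lin_map R M "carrier M" ?Q h
    unfolding h_def using quot_left_module[OF sT] quot_proj_lin[OF sT] left_module_axioms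
    by (intro lin_map.intro lin_map_axioms.intro lmod.intro) auto
  have car: "carrier ?Q = h ` carrier M" and ker: "\<And>x. x \<in> carrier M \<Longrightarrow> h x = \<zero>\<^bsub>?Q\<^esub> \<longleftrightarrow> x \<in> T"
    unfolding h_def using quot_carrier[OF sT] quot_proj_kernel[OF sT] by blast+
  show ?thesis
  proof
    assume "simple_top R M"
    then have Q: "carrier ?Q \<noteq> {\<zero>\<^bsub>?Q\<^esub>}"
      "\<And>U. submodule U R ?Q \<Longrightarrow> U = {\<zero>\<^bsub>?Q\<^esub>} \<or> U = carrier ?Q"
      unfolding simple_top_def simple_module_def T_def by blast+
    have "T \<noteq> carrier M"
    proof
      assume "T = carrier M"
      then have "h x = \<zero>\<^bsub>?Q\<^esub>" if "x \<in> carrier M" for x using ker that by simp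
      then have "h ` carrier M = {\<zero>\<^bsub>?Q\<^esub>}" using M.zero_closed by force
      then show False using Q(1) car by simp
    qed
    have small: "V \<subseteq> T" if V: "submodule V R M" "V \<noteq> carrier M" for V
    proof -
      obtain U where U: "V \<subseteq> U" "maximal_submodule R M U" using ex_maximal_submodule[OF V(1) fin V(2)] by blast
      then have sU: "submodule U R M" "U \<noteq> carrier M" by (auto simp: maximal_submodule_def)
      have TU: "T \<subseteq> U" using U(2) by (auto simp: T_def radical_def)
      have "h ` U \<noteq> carrier ?Q"
      proof
        assume eq: "h ` U = carrier ?Q"
        have "x \<in> U" if x: "x \<in> carrier M" for x
        proof -
          have "h x \<in> h ` U" using eq car x by blast
          then obtain u where u: "u \<in> U" "h x = h u" by blast
          then have uc: "u \<in> carrier M" using submodule_carr[OF sU(1)] by blast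
          then have "x \<ominus> u \<in> T" using h.map_eq_iff_minus[OF x uc] u ker x by simp
          then have "x \<ominus> u \<oplus> u \<in> U" using TU u submodule_add[OF sU(1)] by blast
          then show ?thesis using x uc by simp
        qed
        then show False using sU submoduleD(1)[OF sU(1)] by blast
      qed
      moreover have "submodule (h ` U) R ?Q" using h.image_submodule sU submoduleD(1) by blast
      ultimately have "h ` U = {\<zero>\<^bsub>?Q\<^esub>}" using Q(2) by blast
      then have "h x = \<zero>\<^bsub>?Q\<^esub>" if "x \<in> U" for x using that by blast
      then have "U \<subseteq> T" using ker submodule_carr[OF sU(1)] by auto
      then show ?thesis using U by blast
    qed
    have "hollow R M (carrier M)"
      unfolding hollow_def
    proof (intro allI impI)
      fix V W assume VW: "submodule V R M \<and> submodule W R M \<and> V <+>\<^bsub>M\<^esub> W = carrier M"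
      show "V = carrier M \<or> W = carrier M"
      proof (rule ccontr)
        assume "\<not> (V = carrier M \<or> W = carrier M)"
        then have "V <+>\<^bsub>M\<^esub> W \<subseteq> T" using VW small by (intro set_add_least[OF sT]) auto
        then show False using VW \<open>T \<noteq> carrier M\<close> submodule_subset[OF sT] by blast
      qed
    qed
    moreover have "carrier M \<noteq> {\<zero>}"
    proof
      assume "carrier M = {\<zero>}"
      then have "T = carrier M"
        using submodule_subset[OF sT] submodule_zero[OF sT] by (intro subset_antisym) auto
      then show False using \<open>T \<noteq> carrier M\<close> by blast
    qed
    ultimately show "carrier M \<noteq> {\<zero>} \<and> hollow R M (carrier M)" by blast
  next
    assume R: "carrier M \<noteq> {\<zero>} \<and> hollow R M (carrier M)"
    then obtain W where W: "maximal_submodule R M W"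
      using ex_maximal_submodule[OF submodule_triv fin] by metis
    then have "U = W" if "maximal_submodule R M U" for U
      using maximal_submodule_hollow_unique R that by blast
    then have "{U. maximal_submodule R M U} = {W}" using W by blast
    moreover have "W \<subseteq> carrier M" using W submodule_subset unfolding maximal_submodule_def by blast
    ultimately have "radical R M = W" unfolding radical_def by auto
    then have max: "maximal_submodule R M T" using W by (simp add: T_def)
    have "U = {\<zero>\<^bsub>?Q\<^esub>} \<or> U = carrier ?Q" if U: "submodule U R ?Q" for U
    proof -
      let ?P = "{x \<in> carrier M. h x \<in> U}"
      have sP: "submodule ?P R M" by (rule h.preimage_submodule[OF U])
      have "T \<subseteq> ?P"
      proof
        fix x assume x: "x \<in> T"
        then have xc: "x \<in> carrier M" by (rule submodule_carr[OF sT])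
        then have "h x = \<zero>\<^bsub>?Q\<^esub>" using ker x by blast
        then show "x \<in> ?P" using xc h.N.submodule_zero[OF U] by simp
      qed
      then have "?P = T \<or> ?P = carrier M" using max sP unfolding maximal_submodule_def by blast
      moreover have hP: "h ` ?P = U"
      proof
        show "U \<subseteq> h ` ?P"
        proof
          fix y assume y: "y \<in> U"
          then have "y \<in> h ` carrier M" using car h.N.submodule_carr[OF U] by simp
          then show "y \<in> h ` ?P" using y by blast
        qed
      qed auto
      moreover have "h ` T = {\<zero>\<^bsub>?Q\<^esub>}"
      proof -
        have "h x = \<zero>\<^bsub>?Q\<^esub>" if "x \<in> T" for x using ker[OF submodule_carr[OF sT that]] that by blast
        then show ?thesis using submodule_zero[OF sT] by force
      qed
      ultimately show ?thesis using car by (elim disjE) simp_all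
    qed
    moreover have "carrier ?Q \<noteq> {\<zero>\<^bsub>?Q\<^esub>}"
    proof
      assume "carrier ?Q = {\<zero>\<^bsub>?Q\<^esub>}"
      then have "h x = \<zero>\<^bsub>?Q\<^esub>" if "x \<in> carrier M" for x using car that by blast
      then have "carrier M \<subseteq> T" using ker by blast
      then show False using max submoduleD(1)[OF sT] unfolding maximal_submodule_def by blast
    qed
    ultimately show "simple_top R M"
      using quot_left_module[OF sT] unfolding simple_top_def simple_module_def T_def by blast
  qed
qed

end

section \<open>Monotonicity of the number of summands\<close>

context lmod
begin

text \<open>A uniform submodule \<open>U\<close>, taken modulo \<open>W\<close>, meets a direct sum of \<open>m\<close> indecomposables
  in so small a piece that all but one of the summands can be kept away from it.\<close>

lemma uniform_drop_summand:
  assumes U: "uniform R M U" and dUW: "direct R M U W B"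
    and "dec R M N m" "m \<noteq> 0" "N \<inter> W = {\<zero>}"
  shows "\<exists>N'\<subseteq>N. dec R M N' (m - 1) \<and> N' \<inter> B = {\<zero>}"
  using assms(3-)
proof (induction rule: dec.induct)
  case dec_zero
  then show ?case by simp
next
  case (dec_Suc V N0 m N)
  note D = directD[OF dec_Suc.hyps(3)] and E = directD[OF dUW]
  show ?case
  proof (cases "N0 \<inter> B = {\<zero>}")
    case True
    then show ?thesis using dec_Suc.hyps(2) D by auto
  next
    case False
    then have "N0 \<noteq> {\<zero>}" using E submodule_zero by blast
    then have m: "m \<noteq> 0" using dec_Suc.hyps(2) by (metis dec_0_iff)
    have N0W: "N0 \<inter> W = {\<zero>}" using D E dec_Suc.prems submodule_zero by blast
    obtain N' where N': "N' \<subseteq> N0" "dec R M N' (m - 1)" "N' \<inter> B = {\<zero>}"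
      using dec_Suc.IH[OF m N0W] by blast
    have sN': "submodule N' R M" by (rule dec_submodule[OF N'(2)])
    define N'' where "N'' = V <+>\<^bsub>M\<^esub> N'"
    have d'': "direct R M V N' N''"
      unfolding N''_def using D N' sN' by (intro directI) blast+
    note F = directD[OF d'']
    have N''N: "N'' \<subseteq> N" using set_add_least[OF D(5,6)] N' D unfolding N''_def by blast
    obtain p q where pq: "lin_on R M B M p" "lin_on R M B M q" "p ` B \<subseteq> U" "q ` B \<subseteq> W"
      "\<And>x. x \<in> B \<Longrightarrow> x = p x \<oplus> q x"
      "\<And>v w. \<lbrakk>v \<in> U; w \<in> W\<rbrakk> \<Longrightarrow> p (v \<oplus> w) = v \<and> q (v \<oplus> w) = w"
      "\<And>v. v \<in> U \<Longrightarrow> p v = v \<and> q v = \<zero>" "\<And>w. w \<in> W \<Longrightarrow> p w = \<zero> \<and> q w = w"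
      by (rule direct_projections[OF dUW]) (rule that)
    interpret p: lin_map R M B M p
      using pq E lmod_axioms by (intro lin_map.intro lin_map_axioms.intro)
    have kerp: "x \<in> W" if "x \<in> B" "p x = \<zero>" for x
    proof -
      have "q x \<in> W" using pq(4) that(1) by blast
      then show ?thesis using pq(5)[OF that(1)] that(2) submodule_carr[OF E(2)] by (metis M.l_zero)
    qed
    have img: "submodule (p ` (S \<inter> B)) R M" "p ` (S \<inter> B) \<subseteq> U" if "submodule S R M" for S
      using p.image_submodule[of "S \<inter> B"] submodule_Int[OF that E(5)] pq(3) by blast+
    have nz: "p ` (S \<inter> B) \<noteq> {\<zero>}"
      if "submodule S R M" "S \<subseteq> N" "S \<inter> B \<noteq> {\<zero>}" for S
    proof
      assume eq: "p ` (S \<inter> B) = {\<zero>}"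
      have "S \<inter> B \<subseteq> W"
      proof
        fix x assume x: "x \<in> S \<inter> B"
        then have "p x \<in> {\<zero>}" using eq by blast
        then show "x \<in> W" using kerp x by blast
      qed
      then have "S \<inter> B \<subseteq> {\<zero>}" using that(2) dec_Suc.prems(2) by blast
      then show False using that(3) submodule_zero[OF that(1)] submodule_zero[OF E(5)] by blast
    qed
    have "N'' \<inter> B = {\<zero>}"
    proof (rule ccontr)
      assume ne: "N'' \<inter> B \<noteq> {\<zero>}"
      have "p ` (N'' \<inter> B) \<inter> p ` (N0 \<inter> B) \<noteq> {\<zero>}"
        using uniformD[OF U img(1)[OF F(5)] img(1)[OF D(2)] img(2)[OF F(5)] img(2)[OF D(2)]]
          nz[OF F(5) N''N ne] nz[OF D(2) D(7) False] by blast
      then obtain y where y: "y \<in> p ` (N'' \<inter> B)" "y \<in> p ` (N0 \<inter> B)" "y \<noteq> \<zero>"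
        using submodule_zero[OF img(1)[OF F(5)]] submodule_zero[OF img(1)[OF D(2)]] by blast
      then obtain a b where ab: "a \<in> N''" "a \<in> B" "b \<in> N0" "b \<in> B" "y = p a" "y = p b" by blast
      have "a \<ominus> b \<in> W"
        using kerp[OF submodule_minus[OF E(5) ab(2,4)]] p.map_eq_iff_minus[OF ab(2,4)] ab by simp
      moreover have "a \<ominus> b \<in> N" using submodule_minus[OF D(5), of a b] ab N''N D(7) by blast
      ultimately have "a \<ominus> b = \<zero>" using dec_Suc.prems(2) by blast
      then have "a = b" using ab submodule_carr[OF E(5)] by simp
      obtain v n where vn: "v \<in> V" "n \<in> N'" "a = v \<oplus> n" using ab(1) unfolding N''_def set_add_iff by blast
      then have "v \<in> N0"
        using submodule_add_right_iff[OF D(2), of n v] ab(3) \<open>a = b\<close> N'(1) submodule_carr[OF D(1)] by blast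
      then have "v = \<zero>" using vn(1) D(4) by blast
      then have "a \<in> N'" using vn submodule_carr[OF sN'] by simp
      then have "a = \<zero>" using N'(3) ab(2) by blast
      then show False using y(3) ab(5) by simp
    qed
    moreover have "dec R M N'' (Suc m - 1)"
      using dec.dec_Suc[OF dec_Suc.hyps(1) N'(2) d''] m by simp
    ultimately show ?thesis using N''N by blast
  qed
qed

text \<open>Goldie's uniform dimension: removing one uniform summand from \<open>C\<close> costs at most one
  summand of \<open>N\<close>. The summands already removed are collected in \<open>W\<close>.\<close>

lemma dec_le_uniform:
  assumes "dec R M C n" and unif: "\<And>U. indec R M U \<Longrightarrow> uniform R M U"
    and "direct R M C W B" "dec R M N m" "N \<subseteq> B" "N \<inter> W = {\<zero>}"
  shows "m \<le> n"
  using assms(1,3-)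
proof (induction arbitrary: W N m rule: dec.induct)
  case dec_zero
  then have "B = W" using directD set_add_zero(2) submoduleD(1) by metis
  then have "N = {\<zero>}" using dec_zero by blast
  then show ?case using dec_zero by simp
next
  case (dec_Suc U C' n C)
  note A = direct_assoc[OF direct_sym[OF dec_Suc.hyps(3)] dec_Suc.prems(1)]
  show ?case
  proof (cases "m = 0")
    case False
    obtain N' where N': "N' \<subseteq> N" "dec R M N' (m - 1)" "N' \<inter> (U <+>\<^bsub>M\<^esub> W) = {\<zero>}"
      using uniform_drop_summand[OF unif[OF dec_Suc.hyps(1)] A(1) dec_Suc.prems(2) False dec_Suc.prems(4)]
      by blast
    have "m - 1 \<le> n"
      using dec_Suc.IH[OF A(2) N'(2) _ N'(3)] N'(1) dec_Suc.prems(3) by blast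
    then show ?thesis by simp
  qed simp
qed

text \<open>Dually, a hollow generator can be exchanged for a summand. As \<open>Y\<close> and \<open>Z\<close> generate the module,
  its quotient by \<open>Z\<close> is an image of \<open>Y\<close> and thus hollow. So of two submodules above \<open>Z\<close> that
  together generate the module, one is the whole module.\<close>

lemma hollow_add_summand:
  assumes Y: "hollow R M Y" "submodule Y R M"
    and "dec R M N m" "m \<noteq> 0" "direct R M N W (carrier M)" "submodule Z R M" "W \<subseteq> Z"
      "Y <+>\<^bsub>M\<^esub> Z = carrier M"
  shows "\<exists>V N'. indec R M V \<and> direct R M V N' N \<and> dec R M N' (m - 1) \<and> Z <+>\<^bsub>M\<^esub> V = carrier M"
  using assms(3-)
proof (induction arbitrary: W Z rule: dec.induct)
  case dec_zero
  then show ?case by simp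
next
  case (dec_Suc V0 N0 m N)
  note D = directD[OF dec_Suc.hyps(3)] and E = directD[OF dec_Suc.prems(2)]
  note sZ = dec_Suc.prems(3) and WZ = dec_Suc.prems(4) and YZ = dec_Suc.prems(5)
  show ?case
  proof (cases "Z <+>\<^bsub>M\<^esub> V0 = carrier M")
    case True
    then show ?thesis using dec_Suc.hyps by auto
  next
    case ne: False
    define Z' where "Z' = Z <+>\<^bsub>M\<^esub> V0"
    have sZ': "submodule Z' R M" "Z \<subseteq> Z'" "V0 \<subseteq> Z'"
      unfolding Z'_def using sZ D set_add_upper by auto
    note A = direct_assoc[OF direct_sym[OF dec_Suc.hyps(3)] dec_Suc.prems(2)]
    have W'Z: "V0 <+>\<^bsub>M\<^esub> W \<subseteq> Z'" by (rule set_add_least[OF sZ'(1)]) (use sZ' WZ in auto)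
    have "N0 \<noteq> {\<zero>}"
    proof
      assume "N0 = {\<zero>}"
      then have "V0 <+>\<^bsub>M\<^esub> W = carrier M"
        using directD[OF A(2)] set_add_zero(2) submoduleD(1) by metis
      then show False using W'Z ne submoduleD(1)[OF sZ'(1)] unfolding Z'_def by blast
    qed
    then have m: "m \<noteq> 0" using dec_Suc.hyps(2) by (metis dec_0_iff)
    have "Y <+>\<^bsub>M\<^esub> Z' = carrier M"
      using set_add_mono[of Y Y Z Z'] sZ'(2) YZ submoduleD(1)[OF submodule_set_add[OF Y(2) sZ'(1)]] by blast
    then obtain V N' where V: "indec R M V" "direct R M V N' N0" "dec R M N' (m - 1)"
      "Z' <+>\<^bsub>M\<^esub> V = carrier M"
      using dec_Suc.IH[OF m A(2) sZ'(1) W'Z] by blast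
    note F = directD[OF V(2)]
    have ZV: "Z <+>\<^bsub>M\<^esub> V = carrier M"
    proof (rule ccontr)
      assume ne': "Z <+>\<^bsub>M\<^esub> V \<noteq> carrier M"
      define P where "P = Z <+>\<^bsub>M\<^esub> V"
      have P: "submodule P R M" "Z \<subseteq> P" "V \<subseteq> P" unfolding P_def using sZ F set_add_upper by auto
      have PZ': "P <+>\<^bsub>M\<^esub> Z' = carrier M"
        using set_add_least[OF submodule_set_add[OF P(1) sZ'(1)], of Z' V] V(4) P(3)
          set_add_upper1[OF P(1) sZ'(1)] set_add_upper2[OF P(1) sZ'(1)]
          submoduleD(1)[OF submodule_set_add[OF P(1) sZ'(1)]] by blast
      have proper: "Y \<inter> Q \<noteq> Y" if "submodule Q R M" "Z \<subseteq> Q" "Q \<noteq> carrier M" for Q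
      proof
        assume "Y \<inter> Q = Y"
        then have "carrier M \<subseteq> Q" using set_add_least[OF that(1), of Y Z] that(2) YZ by blast
        then show False using that submoduleD(1) by blast
      qed
      have "(Y \<inter> P) <+>\<^bsub>M\<^esub> (Y \<inter> Z') = Y"
      proof
        show "(Y \<inter> P) <+>\<^bsub>M\<^esub> (Y \<inter> Z') \<subseteq> Y" by (rule set_add_least[OF Y(2)]) auto
        show "Y \<subseteq> (Y \<inter> P) <+>\<^bsub>M\<^esub> (Y \<inter> Z')"
        proof
          fix y assume y: "y \<in> Y"
          then have yc: "y \<in> carrier M" using submodule_carr[OF Y(2)] by blast
          then have "y \<in> P <+>\<^bsub>M\<^esub> Z'" using PZ' by simp
          then obtain a b where ab: "a \<in> P" "b \<in> Z'" "y = a \<oplus> b" unfolding set_add_iff by blast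
          have ac: "a \<in> carrier M" and bc: "b \<in> carrier M"
            using ab submodule_carr[OF P(1)] submodule_carr[OF sZ'(1)] by auto
          then have "a \<in> Y <+>\<^bsub>M\<^esub> Z" using YZ by simp
          then obtain y1 z where yz: "y1 \<in> Y" "z \<in> Z" "a = y1 \<oplus> z" unfolding set_add_iff by blast
          have y1c: "y1 \<in> carrier M" and zc: "z \<in> carrier M"
            using yz submodule_carr[OF Y(2)] submodule_carr[OF sZ] by auto
          have y1P: "y1 \<in> P" using submodule_add_right_iff[OF P(1), of z y1] yz ab(1) P(2) y1c by blast
          have eq: "y = y1 \<oplus> (z \<oplus> b)" using ab(3) yz(3) y1c zc bc by (simp add: M.a_assoc)
          moreover have "z \<oplus> b \<in> Z'" using submodule_add[OF sZ'(1)] yz(2) sZ'(2) ab(2) by blast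
          moreover have "z \<oplus> b \<in> Y"
            using submodule_add_left_iff[OF Y(2) yz(1), of "z \<oplus> b"] y eq zc bc by simp
          ultimately show "y \<in> (Y \<inter> P) <+>\<^bsub>M\<^esub> (Y \<inter> Z')" using yz(1) y1P set_addI by blast
        qed
      qed
      then have "Y \<inter> P = Y \<or> Y \<inter> Z' = Y"
        using hollowD[OF Y(1) submodule_Int[OF Y(2) P(1)] submodule_Int[OF Y(2) sZ'(1)]] by blast
      then show False
        using proper[OF P(1,2)] proper[OF sZ'(1,2)] ne ne' unfolding P_def Z'_def by blast
    qed
    note G = direct_assoc[OF V(2) direct_sym[OF dec_Suc.hyps(3)]]
    have "dec R M (N' <+>\<^bsub>M\<^esub> V0) (m - 1 + 1)"
      using dec_add[OF V(3) dec_indec[OF dec_Suc.hyps(1)] G(1)] .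
    then have "dec R M (N' <+>\<^bsub>M\<^esub> V0) (Suc m - 1)" using m by simp
    then show ?thesis using V(1) G(2) ZV by blast
  qed
qed

end

context lin_map
begin

lemma image_hollow:
  assumes U: "submodule U R M" "U \<subseteq> B" "hollow R M U" shows "hollow R N (f ` U)"
  unfolding hollow_def
proof (intro allI impI)
  fix P Q assume PQ: "submodule P R N \<and> submodule Q R N \<and> P <+>\<^bsub>N\<^esub> Q = f ` U"
  interpret U: lin_map R M U N f by (rule restrict_dom[OF U(1,2)])
  have PU: "P \<subseteq> f ` U" "Q \<subseteq> f ` U" using PQ N.set_add_upper1[of P Q] N.set_add_upper2[of P Q] by simp_all
  let ?P = "{x \<in> U. f x \<in> P}" and ?Q = "{x \<in> U. f x \<in> Q}"
  have s: "submodule ?P R M" "submodule ?Q R M" using U.preimage_submodule PQ by blast+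
  have "?P <+>\<^bsub>M\<^esub> ?Q = U"
  proof
    show "?P <+>\<^bsub>M\<^esub> ?Q \<subseteq> U" by (rule M.set_add_least[OF U(1)]) auto
    show "U \<subseteq> ?P <+>\<^bsub>M\<^esub> ?Q"
    proof
      fix u assume u: "u \<in> U"
      then have "f u \<in> P <+>\<^bsub>N\<^esub> Q" using PQ by blast
      then obtain y z where yz: "y \<in> P" "z \<in> Q" "f u = y \<oplus>\<^bsub>N\<^esub> z" unfolding N.set_add_iff by blast
      then obtain x where x: "x \<in> U" "y = f x" using PU by blast
      have c: "f x \<in> carrier N" "z \<in> carrier N" using yz x N.submodule_carr PQ by blast+
      have "f (u \<ominus>\<^bsub>M\<^esub> x) = z"
        using U.map_minus[OF u x(1)] yz(3) x(2) c
        by (metis N.M.a_comm N.M.add.inv_solve_right N.M.a_closed a_minus_def)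
      then have "u \<ominus>\<^bsub>M\<^esub> x \<in> ?Q" using yz(2) M.submodule_minus[OF U(1) u x(1)] by simp
      then have "(u \<ominus>\<^bsub>M\<^esub> x) \<oplus>\<^bsub>M\<^esub> x \<in> ?Q <+>\<^bsub>M\<^esub> ?P"
        by (rule M.set_addI) (use x yz(1) in simp)
      moreover have "(u \<ominus>\<^bsub>M\<^esub> x) \<oplus>\<^bsub>M\<^esub> x = u" using u x M.submodule_carr[OF U(1)] by simp
      ultimately show "u \<in> ?P <+>\<^bsub>M\<^esub> ?Q"
        using M.set_add_comm[OF M.submodule_subset[OF s(1)] M.submodule_subset[OF s(2)]] by simp
    qed
  qed
  then have "?P = U \<or> ?Q = U" using hollowD[OF U(3) s] by blast
  then show "P = f ` U \<or> Q = f ` U" using PU by blast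
qed

lemma dec_le_hollow:
  assumes "dec R M C n" and hol: "\<And>U. indec R M U \<Longrightarrow> hollow R M U"
    and "C \<subseteq> B" "dec R N L m" "direct R N L W (carrier N)" "f ` C <+>\<^bsub>N\<^esub> W = carrier N"
  shows "m \<le> n"
  using assms(1,3-)
proof (induction arbitrary: L W m rule: dec.induct)
  case dec_zero
  note E = N.directD[OF dec_zero.prems(3)]
  have "W = carrier N" using dec_zero.prems(4) N.set_add_zero(2)[OF N.submodule_subset[OF E(2)]] by simp
  then have "L = {\<zero>\<^bsub>N\<^esub>}" using E by blast
  then show ?case using dec_zero by simp
next
  case (dec_Suc U C' n C)
  note E = N.directD[OF dec_Suc.prems(3)] and F = M.directD[OF dec_Suc.hyps(3)]
  show ?case
  proof (cases "m = 0")
    case False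
    have UB: "U \<subseteq> B" "C' \<subseteq> B" using F dec_Suc.prems(1) by auto
    have s: "submodule (f ` U) R N" "submodule (f ` C') R N" using image_submodule F UB by blast+
    define Z where "Z = f ` C' <+>\<^bsub>N\<^esub> W"
    have Z: "submodule Z R N" "W \<subseteq> Z" unfolding Z_def using s E N.set_add_upper by auto
    have "f ` U <+>\<^bsub>N\<^esub> Z = carrier N"
      unfolding Z_def
      using N.set_add_assoc[OF N.submodule_subset[OF s(1)] N.submodule_subset[OF s(2)] N.submodule_subset[OF E(2)]]
        image_set_add[OF UB] F(3) dec_Suc.prems(4) by simp
    then obtain V L' where V: "indec R N V" "direct R N V L' L" "dec R N L' (m - 1)"
      "Z <+>\<^bsub>N\<^esub> V = carrier N"
      using N.hollow_add_summand[OF image_hollow[OF F(1) UB(1) hol[OF dec_Suc.hyps(1)]] s(1)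
        dec_Suc.prems(2) False dec_Suc.prems(3) Z] by blast
    note G = N.direct_assoc[OF N.direct_sym[OF V(2)] dec_Suc.prems(3)]
    have "f ` C' <+>\<^bsub>N\<^esub> (V <+>\<^bsub>N\<^esub> W) = carrier N"
    proof -
      note c = N.submodule_subset[OF s(2)] N.submodule_subset[OF indecD(1)[OF V(1)]] N.submodule_subset[OF E(2)]
      show ?thesis
        using V(4) unfolding Z_def N.set_add_comm[OF c(2,3)] N.set_add_assoc[OF c(1,3,2)] .
    qed
    then have "m - 1 \<le> n" using dec_Suc.IH[OF UB(2) V(3) G(2)] by blast
    then show ?thesis by simp
  qed simp
qed

end

section \<open>Isomorphisms and transport of structure\<close>

lemma (in lmod) lin_map_sub_module:
  assumes "submodule B R M"
  shows "lin_map R M B (sub_module M B) (\<lambda>x. x)" "lin_map R (sub_module M B) B M (\<lambda>x. x)"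
proof -
  interpret B: lmod R "sub_module M B" by (intro lmod.intro sub_module_left_module[OF assms])
  show "lin_map R M B (sub_module M B) (\<lambda>x. x)"
    using assms lmod_axioms B.lmod_axioms
    by (intro lin_map.intro lin_map_axioms.intro) (auto simp: lin_on_def)
  show "lin_map R (sub_module M B) B M (\<lambda>x. x)"
    using lmod_axioms B.lmod_axioms B.submodule_whole submodule_carr[OF assms]
    by (intro lin_map.intro lin_map_axioms.intro) (auto simp: lin_on_def)
qed

lemma (in lmod) dec_sub_module_iff:
  assumes "submodule B R M" "U \<subseteq> B"
  shows "dec R (sub_module M B) U n \<longleftrightarrow> dec R M U n"
  using lin_map.image_dec[OF lin_map_sub_module(1)[OF assms(1)], of U n]
    lin_map.image_dec[OF lin_map_sub_module(2)[OF assms(1)], of U n] assms(2)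
  by (auto simp: inj_on_def)

lemma (in lmod) num_summands_sub_module_eqI:
  assumes "dec R M B n" "finite B"
  shows "num_summands R (sub_module M B) = n"
proof -
  have s: "submodule B R M" by (rule dec_submodule[OF assms(1)])
  interpret B: lmod R "sub_module M B" by (intro lmod.intro sub_module_left_module[OF s])
  show ?thesis
    using B.num_summands_eqI dec_sub_module_iff[OF s order_refl] assms by simp
qed

lemma (in lmod) dec_num_summands_sub_module:
  assumes "submodule B R M" "finite B"
  shows "dec R M B (num_summands R (sub_module M B))"
  using num_summands_sub_module_eqI ex_dec[OF assms] assms by metis

lemma module_iso_lin_map:
  assumes "left_module R M" "left_module R N" "f \<in> module_iso R M N"
  shows "lin_map R M (carrier M) N f" "inj_on f (carrier M)" "f ` carrier M = carrier N"
proof -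
  interpret M: lmod R M by (intro lmod.intro assms(1))
  interpret N: lmod R N by (intro lmod.intro assms(2))
  show "lin_map R M (carrier M) N f"
    using assms(3) M.lmod_axioms N.lmod_axioms
    by (intro lin_map.intro lin_map_axioms.intro) (auto simp: module_iso_def module_hom_iff_lin_on)
  show "inj_on f (carrier M)" "f ` carrier M = carrier N"
    using assms(3) by (auto simp: module_iso_def bij_betw_def)
qed

lemma num_summands_isomorphic:
  assumes "left_module R M" "left_module R N" "isomorphic R M N" "finite (carrier M)"
  shows "num_summands R M = num_summands R N"
proof -
  obtain f where f: "f \<in> module_iso R M N" using assms(3) unfolding isomorphic_def by blast
  note F = module_iso_lin_map[OF assms(1,2) f]
  interpret f: lin_map R M "carrier M" N f by (rule F(1))
  have "dec R N (carrier N) (num_summands R M)"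
    using f.image_dec[OF f.M.dec_num_summands[OF assms(4)] order_refl F(2)] F(3) by simp
  then show ?thesis using f.N.num_summands_eqI F(3) assms(4) by (metis finite_imageI)
qed

lemma isomorphic_refl: "isomorphic R M M"
  unfolding isomorphic_def module_iso_def module_hom_def
  by (auto intro!: exI[of _ "\<lambda>x. x"] simp: bij_betw_def)

lemma isomorphic_sym:
  assumes "left_module R M" "left_module R N" "isomorphic R M N"
  shows "isomorphic R N M"
proof -
  obtain f where f: "f \<in> module_iso R M N" using assms(3) unfolding isomorphic_def by blast
  note F = module_iso_lin_map[OF assms(1,2) f]
  interpret f: lin_map R M "carrier M" N f by (rule F(1))
  interpret g: lin_map R N "f ` carrier M" M "inv_into (carrier M) f" by (rule f.inverse_lin_map[OF F(2)])
  have "inv_into (carrier M) f \<in> module_iso R N M"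
    using g.lin F bij_betw_inv_into[of f "carrier M" "carrier N"]
    by (simp add: module_iso_def module_hom_iff_lin_on bij_betw_def)
  then show ?thesis unfolding isomorphic_def by blast
qed

lemma isomorphic_trans:
  assumes "isomorphic R L M" "isomorphic R M N"
  shows "isomorphic R L N"
proof -
  obtain f g where f: "f \<in> module_iso R L M" and g: "g \<in> module_iso R M N"
    using assms unfolding isomorphic_def by blast
  then have "lin_on R L (carrier L) M f" "lin_on R M (carrier M) N g" "f ` carrier L \<subseteq> carrier M"
    by (simp_all add: module_iso_def module_hom_iff_lin_on bij_betw_def)
  then have "(\<lambda>x. g (f x)) \<in> module_hom R L N"
    unfolding module_hom_iff_lin_on by (rule lin_on_compose)
  moreover have "bij_betw (\<lambda>x. g (f x)) (carrier L) (carrier N)"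
    using f g bij_betw_trans[of f _ _ g] by (auto simp: module_iso_def comp_def)
  ultimately show ?thesis unfolding isomorphic_def module_iso_def by blast
qed

text \<open>The structure moved along an injection. It brings quotients and products, whose elements are sets
  and pairs, back to modules on natural numbers.\<close>

definition transport :: "('m \<Rightarrow> 'n) \<Rightarrow> ('a, 'm) module \<Rightarrow> ('a, 'n) module" where
  "transport h M = (let k = inv_into (carrier M) h in
     \<lparr>carrier = h ` carrier M, mult = undefined, one = undefined, zero = h \<zero>\<^bsub>M\<^esub>,
      add = (\<lambda>x y. h (k x \<oplus>\<^bsub>M\<^esub> k y)), smult = (\<lambda>a x. h (a \<odot>\<^bsub>M\<^esub> k x))\<rparr>)"

lemma transport_simps:
  "carrier (transport h M) = h ` carrier M"
  "\<zero>\<^bsub>transport h M\<^esub> = h \<zero>\<^bsub>M\<^esub>"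
  "\<lbrakk>inj_on h (carrier M); x \<in> carrier M; y \<in> carrier M\<rbrakk> \<Longrightarrow> h x \<oplus>\<^bsub>transport h M\<^esub> h y = h (x \<oplus>\<^bsub>M\<^esub> y)"
  "\<lbrakk>inj_on h (carrier M); x \<in> carrier M\<rbrakk> \<Longrightarrow> a \<odot>\<^bsub>transport h M\<^esub> h x = h (a \<odot>\<^bsub>M\<^esub> x)"
  by (auto simp: transport_def Let_def)

context lmod
begin

lemma transport_left_module:
  assumes "inj_on h (carrier M)" shows "left_module R (transport h M)"
  using assms by (intro left_module_surj_image[OF left_module_axioms, of _ h]) (auto simp: transport_simps)

lemma transport_lin_map:
  assumes "inj_on h (carrier M)" shows "lin_map R M (carrier M) (transport h M) h"
  using assms lmod_axioms transport_left_module[OF assms]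
  by (intro lin_map.intro lin_map_axioms.intro lmod.intro left_module_axioms)
    (auto simp: lin_on_def transport_simps)

lemma transport_iso:
  assumes "inj_on h (carrier M)" shows "h \<in> module_iso R M (transport h M)"
  using lin_map.lin[OF transport_lin_map[OF assms]] assms
  by (auto simp: module_iso_def module_hom_iff_lin_on bij_betw_def transport_simps)

end

section \<open>Epimorphisms\<close>

definition epi :: "('a, 'r) ring_scheme \<Rightarrow> ('a, 'x) module \<Rightarrow> ('a, 'm) module \<Rightarrow> ('x \<Rightarrow> 'm) \<Rightarrow> bool" where
  "epi R X M g \<longleftrightarrow> lin_map R X (carrier X) M g \<and> g ` carrier X = carrier M"

definition ker_of :: "('a, 'x) module \<Rightarrow> ('a, 'm) module \<Rightarrow> ('x \<Rightarrow> 'm) \<Rightarrow> 'x set" where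
  "ker_of X M g = {x \<in> carrier X. g x = \<zero>\<^bsub>M\<^esub>}"

lemma ker_of_submodule:
  assumes "epi R X M g" shows "submodule (ker_of X M g) R X"
proof -
  interpret g: lin_map R X "carrier X" M g using assms by (simp add: epi_def)
  show ?thesis using g.preimage_submodule[of "{\<zero>\<^bsub>M\<^esub>}"] by (simp add: ker_of_def)
qed

lemma epi_transport:
  assumes "epi R X M g" "inj_on h (carrier X)" "inj_on k (carrier M)"
  defines "g' \<equiv> (\<lambda>x. k (g (inv_into (carrier X) h x)))"
  shows "epi R (transport h X) (transport k M) g'"
    and "ker_of (transport h X) (transport k M) g' = h ` ker_of X M g"
proof -
  interpret g: lin_map R X "carrier X" M g using assms by (simp add: epi_def)
  have gX: "g ` carrier X = carrier M" using assms by (simp add: epi_def)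
  have g': "g' (h x) = k (g x)" if "x \<in> carrier X" for x using that assms(2) by (simp add: g'_def)
  have "lin_map R (transport h X) (h ` carrier X) (transport k M) g'"
    using g.M.transport_left_module[OF assms(2)] g.N.transport_left_module[OF assms(3)]
  proof (intro lin_map.intro lin_map_axioms.intro lmod.intro)
    show "submodule (h ` carrier X) R (transport h X)"
      using lmod.submodule_whole[OF lmod.intro[OF g.M.transport_left_module[OF assms(2)]]]
      by (simp add: transport_simps)
    show "lin_on R (transport h X) (h ` carrier X) (transport k M) g'"
      using assms(2,3) by (auto simp: lin_on_def transport_simps g' g.map_add g.map_smult)
  qed
  moreover have "g' ` h ` carrier X = k ` carrier M"
    using g' gX by (metis (no_types, lifting) image_cong image_image)
  ultimately show "epi R (transport h X) (transport k M) g'"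
    by (simp add: epi_def transport_simps)
  have "k y = k \<zero>\<^bsub>M\<^esub> \<longleftrightarrow> y = \<zero>\<^bsub>M\<^esub>" if "y \<in> carrier M" for y
    using that assms(3) by (simp add: inj_on_eq_iff)
  then show "ker_of (transport h X) (transport k M) g' = h ` ker_of X M g"
    using g' by (auto simp: ker_of_def transport_simps)
qed

lemma (in lmod) quot_epi:
  assumes "submodule U R M"
  shows "epi R M (quot_module M U) (\<lambda>x. U +> x)" "ker_of M (quot_module M U) (\<lambda>x. U +> x) = U"
  using assms quot_module_facts[OF assms] lmod_axioms submodule_carr[OF assms]
  by (auto simp: epi_def ker_of_def intro!: lin_map.intro lin_map_axioms.intro lmod.intro)

lemma (in lmod) ex_epi_with_kernel:
  assumes fin: "finite (carrier M)" and U: "submodule U R M"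
  obtains N :: "('a, nat) module" and g where "finite (carrier N)" "epi R M N g" "ker_of M N g = U"
proof -
  let ?Q = "quot_module M U"
  have "finite (carrier ?Q)" using fin quot_carrier[OF U] by simp
  then obtain k :: "'m set \<Rightarrow> nat" where k: "inj_on k (carrier ?Q)" "finite (k ` carrier ?Q)"
    using finite_imp_inj_to_nat_seg[of "carrier ?Q"] by (metis finite_imageI)
  interpret Q: lmod R ?Q by (intro lmod.intro quot_left_module[OF U])
  define g where "g = (\<lambda>x. k (U +> x))"
  interpret h: lin_map R M "carrier M" ?Q "\<lambda>x. U +> x"
    using quot_epi(1)[OF U] by (simp add: epi_def)
  interpret k: lin_map R ?Q "carrier ?Q" "transport k ?Q" k by (rule Q.transport_lin_map[OF k(1)])
  have "lin_on R M (carrier M) (transport k ?Q) g"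
    unfolding g_def by (rule lin_on_compose[OF h.lin k.lin]) auto
  then have "epi R M (transport k ?Q) g"
    using lmod_axioms k.N.lmod_axioms quot_carrier[OF U]
    by (auto simp: epi_def g_def transport_simps intro!: lin_map.intro lin_map_axioms.intro)
  moreover have "ker_of M (transport k ?Q) g = U"
  proof -
    have "g x = k \<zero>\<^bsub>?Q\<^esub> \<longleftrightarrow> x \<in> U" if "x \<in> carrier M" for x
      using that inj_on_eq_iff[OF k(1), of "U +> x" "\<zero>\<^bsub>?Q\<^esub>"] quot_proj_kernel[OF U that] by (simp add: g_def)
    then have "ker_of M (transport k ?Q) g = {x \<in> carrier M. x \<in> U}"
      unfolding ker_of_def transport_simps by (intro Collect_cong conj_cong) auto
    then show ?thesis using submodule_subset[OF U] by auto
  qed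
  ultimately show ?thesis using that[of "transport k ?Q" g] k(2) by (simp add: transport_simps)
qed

text \<open>The isomorphism \<open>M \<cong> X / Ker g\<close> sends a point of \<open>M\<close> to its fibre.\<close>

lemma epi_quot_isomorphic:
  assumes "epi R X M g"
  shows "isomorphic R M (quot_module X (ker_of X M g))"
proof -
  interpret g: lin_map R X "carrier X" M g using assms by (simp add: epi_def)
  have gX: "g ` carrier X = carrier M" using assms by (simp add: epi_def)
  define U where "U = ker_of X M g"
  have sU: "submodule U R X" unfolding U_def by (rule ker_of_submodule[OF assms])
  let ?Q = "quot_module X U"
  define h where "h = (\<lambda>x. U +>\<^bsub>X\<^esub> x)"
  interpret h: lin_map R X "carrier X" ?Q h
    using g.M.quot_epi(1)[OF sU] by (simp add: epi_def h_def)
  have kerh: "h x = \<zero>\<^bsub>?Q\<^esub> \<longleftrightarrow> g x = \<zero>\<^bsub>M\<^esub>" if "x \<in> carrier X" for x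
    using g.M.quot_proj_kernel[OF sU that] that by (simp add: h_def U_def ker_of_def)
  have eq: "h x = h y \<longleftrightarrow> g x = g y" if "x \<in> carrier X" "y \<in> carrier X" for x y
    using that kerh[of "x \<ominus>\<^bsub>X\<^esub> y"] g.map_eq_iff_minus h.map_eq_iff_minus by simp
  define s where "s = inv_into (carrier X) g"
  have s: "s m \<in> carrier X" "g (s m) = m" if "m \<in> carrier M" for m
    using that gX f_inv_into_f[of m g "carrier X"] inv_into_into[of m g "carrier X"] by (auto simp: s_def)
  have hs: "h (s (g x)) = h x" if "x \<in> carrier X" for x using that s eq by simp
  have "(\<lambda>m. h (s m)) \<in> module_hom R M ?Q"
    unfolding module_hom_def
  proof (intro CollectI conjI ballI)
    show "(\<lambda>m. h (s m)) \<in> carrier M \<rightarrow> carrier ?Q" using s by simp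
    fix m m' assume m: "m \<in> carrier M" "m' \<in> carrier M"
    have "g (s m \<oplus>\<^bsub>X\<^esub> s m') = m \<oplus>\<^bsub>M\<^esub> m'" using m s by (simp add: g.map_add)
    then show "h (s (m \<oplus>\<^bsub>M\<^esub> m')) = h (s m) \<oplus>\<^bsub>?Q\<^esub> h (s m')"
      using hs[of "s m \<oplus>\<^bsub>X\<^esub> s m'"] m s by (simp add: h.map_add)
  next
    fix a m assume am: "a \<in> carrier R" "m \<in> carrier M"
    have "g (a \<odot>\<^bsub>X\<^esub> s m) = a \<odot>\<^bsub>M\<^esub> m" using am s by (simp add: g.map_smult)
    then show "h (s (a \<odot>\<^bsub>M\<^esub> m)) = a \<odot>\<^bsub>?Q\<^esub> h (s m)"
      using hs[of "a \<odot>\<^bsub>X\<^esub> s m"] am s by (simp add: h.map_smult)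
  qed
  moreover have "bij_betw (\<lambda>m. h (s m)) (carrier M) (carrier ?Q)"
    unfolding bij_betw_def
  proof
    show "inj_on (\<lambda>m. h (s m)) (carrier M)" using s eq by (intro inj_onI) metis
    have "carrier ?Q = h ` carrier X" using g.M.quot_carrier[OF sU] by (simp add: h_def)
    also have "\<dots> = (\<lambda>m. h (s m)) ` g ` carrier X" using hs by (simp add: image_image)
    finally show "(\<lambda>m. h (s m)) ` carrier M = carrier ?Q" by (simp add: gX)
  qed
  ultimately show ?thesis unfolding isomorphic_def module_iso_def U_def by blast
qed

section \<open>Direct products\<close>

definition prod_module :: "('a, 'm) module \<Rightarrow> ('a, 'n) module \<Rightarrow> ('a, 'm \<times> 'n) module" where
  "prod_module M N = \<lparr>carrier = carrier M \<times> carrier N, mult = undefined, one = undefined,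
     zero = (\<zero>\<^bsub>M\<^esub>, \<zero>\<^bsub>N\<^esub>), add = (\<lambda>(x, y) (x', y'). (x \<oplus>\<^bsub>M\<^esub> x', y \<oplus>\<^bsub>N\<^esub> y')),
     smult = (\<lambda>a (x, y). (a \<odot>\<^bsub>M\<^esub> x, a \<odot>\<^bsub>N\<^esub> y))\<rparr>"

lemma prod_module_simps [simp]:
  "carrier (prod_module M N) = carrier M \<times> carrier N"
  "\<zero>\<^bsub>prod_module M N\<^esub> = (\<zero>\<^bsub>M\<^esub>, \<zero>\<^bsub>N\<^esub>)"
  "(x, y) \<oplus>\<^bsub>prod_module M N\<^esub> (x', y') = (x \<oplus>\<^bsub>M\<^esub> x', y \<oplus>\<^bsub>N\<^esub> y')"
  "a \<odot>\<^bsub>prod_module M N\<^esub> (x, y) = (a \<odot>\<^bsub>M\<^esub> x, a \<odot>\<^bsub>N\<^esub> y)"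
  by (auto simp: prod_module_def)

lemma prod_left_module:
  assumes "left_module R M" "left_module R N" shows "left_module R (prod_module M N)"
proof -
  interpret M: lmod R M by (intro lmod.intro assms)
  interpret N: lmod R N by (intro lmod.intro assms)
  have "abelian_group (prod_module M N)"
  proof (rule abelian_groupI)
    fix z assume "z \<in> carrier (prod_module M N)"
    then obtain x y where "z = (x, y)" "x \<in> carrier M" "y \<in> carrier N" by auto
    then show "\<exists>w\<in>carrier (prod_module M N). w \<oplus>\<^bsub>prod_module M N\<^esub> z = \<zero>\<^bsub>prod_module M N\<^esub>"
      by (intro bexI[of _ "(\<ominus>\<^bsub>M\<^esub> x, \<ominus>\<^bsub>N\<^esub> y)"]) (auto simp: M.M.l_neg N.M.l_neg)
  qed (auto simp: M.M.a_assoc N.M.a_assoc intro: M.M.a_comm N.M.a_comm)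
  then show ?thesis
    unfolding left_module_def left_module_axioms_def
    using M.R.ring_axioms
    by (auto simp: M.smult_l_distr M.smult_r_distr M.smult_assoc1 M.smult_one
        N.smult_l_distr N.smult_r_distr N.smult_assoc1 N.smult_one)
qed

lemma prod_dec:
  assumes "left_module R M" "left_module R N" "dec R M U n" "dec R N V m"
  shows "dec R (prod_module M N) (U \<times> V) (n + m)"
proof -
  interpret M: lmod R M by (intro lmod.intro assms)
  interpret N: lmod R N by (intro lmod.intro assms)
  interpret P: lmod R "prod_module M N" by (intro lmod.intro prod_left_module assms)
  note sU = M.dec_submodule[OF assms(3)] and sV = N.dec_submodule[OF assms(4)]
  interpret i: lin_map R M "carrier M" "prod_module M N" "\<lambda>x. (x, \<zero>\<^bsub>N\<^esub>)"
    using M.lmod_axioms P.lmod_axioms by (intro lin_map.intro lin_map_axioms.intro) (auto simp: lin_on_def)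
  interpret j: lin_map R N "carrier N" "prod_module M N" "\<lambda>y. (\<zero>\<^bsub>M\<^esub>, y)"
    using N.lmod_axioms P.lmod_axioms by (intro lin_map.intro lin_map_axioms.intro) (auto simp: lin_on_def)
  have 1: "dec R (prod_module M N) ((\<lambda>x. (x, \<zero>\<^bsub>N\<^esub>)) ` U) n"
    by (rule i.image_dec[OF assms(3) M.submodule_subset[OF sU]]) (auto simp: inj_on_def)
  have 2: "dec R (prod_module M N) ((\<lambda>y. (\<zero>\<^bsub>M\<^esub>, y)) ` V) m"
    by (rule j.image_dec[OF assms(4) N.submodule_subset[OF sV]]) (auto simp: inj_on_def)
  have "direct R (prod_module M N) ((\<lambda>x. (x, \<zero>\<^bsub>N\<^esub>)) ` U) ((\<lambda>y. (\<zero>\<^bsub>M\<^esub>, y)) ` V) (U \<times> V)"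
  proof (rule P.directI[OF P.dec_submodule[OF 1] P.dec_submodule[OF 2]])
    have "(x, \<zero>\<^bsub>N\<^esub>) \<oplus>\<^bsub>prod_module M N\<^esub> (\<zero>\<^bsub>M\<^esub>, y) = (x, y)" if "x \<in> U" "y \<in> V" for x y
      using that M.submodule_carr[OF sU] N.submodule_carr[OF sV] by simp
    then show "(\<lambda>x. (x, \<zero>\<^bsub>N\<^esub>)) ` U <+>\<^bsub>prod_module M N\<^esub> (\<lambda>y. (\<zero>\<^bsub>M\<^esub>, y)) ` V = U \<times> V"
      unfolding set_add_def' by auto
    fix z assume "z \<in> (\<lambda>x. (x, \<zero>\<^bsub>N\<^esub>)) ` U" "z \<in> (\<lambda>y. (\<zero>\<^bsub>M\<^esub>, y)) ` V"
    then show "z = \<zero>\<^bsub>prod_module M N\<^esub>" by (elim imageE) simp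
  qed
  then show ?thesis using P.dec_add[OF 1 2] by blast
qed

lemma prod_epi:
  assumes "epi R X M g" "epi R X' M' g'"
  defines "G \<equiv> (\<lambda>(x, x'). (g x, g' x'))"
  shows "epi R (prod_module X X') (prod_module M M') G"
    and "ker_of (prod_module X X') (prod_module M M') G = ker_of X M g \<times> ker_of X' M' g'"
proof -
  interpret g: lin_map R X "carrier X" M g using assms by (simp add: epi_def)
  interpret g': lin_map R X' "carrier X'" M' g' using assms by (simp add: epi_def)
  interpret P: lmod R "prod_module X X'"
    by (intro lmod.intro prod_left_module g.M.left_module_axioms g'.M.left_module_axioms)
  interpret Q: lmod R "prod_module M M'"
    by (intro lmod.intro prod_left_module g.N.left_module_axioms g'.N.left_module_axioms)
  have "lin_map R (prod_module X X') (carrier (prod_module X X')) (prod_module M M') G"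
    using P.lmod_axioms Q.lmod_axioms P.submodule_whole
    by (intro lin_map.intro lin_map_axioms.intro)
      (auto simp: lin_on_def G_def g.map_add g'.map_add g.map_smult g'.map_smult)
  moreover have "G ` (carrier X \<times> carrier X') = g ` carrier X \<times> g' ` carrier X'"
    by (auto simp: G_def image_iff)
  ultimately show "epi R (prod_module X X') (prod_module M M') G"
    using assms(1,2) by (simp add: epi_def)
  show "ker_of (prod_module X X') (prod_module M M') G = ker_of X M g \<times> ker_of X' M' g'"
    by (auto simp: ker_of_def G_def)
qed

section \<open>Extensions and the number of summands\<close>

text \<open>The module theoretic content of \<open>D\<^sub>r\<close> being closed under multiplication: \<open>a\<close>, \<open>b\<close> and \<open>n\<close> are
  the numbers of summands of the submodule, the quotient and the extension.\<close>

definition ext_closed :: "('a, 'r) ring_scheme \<Rightarrow> nat \<Rightarrow> bool" where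
  "ext_closed R r \<longleftrightarrow> (\<forall>(X :: ('a, nat) module) (M :: ('a, nat) module) g a b n.
     finite (carrier X) \<and> epi R X M g \<and> dec R X (ker_of X M g) a \<and> dec R M (carrier M) b \<and>
     dec R X (carrier X) n \<and> r < a \<and> r < b \<longrightarrow> r < n)"

abbreviation finite_modules :: "('a, 'r) ring_scheme \<Rightarrow> ('a, nat) module set" where
  "finite_modules R \<equiv> {M. left_module R M \<and> finite (carrier M)}"

lemma (in lmod) uniform_sub_module:
  "submodule B R M \<Longrightarrow> uniform R (sub_module M B) B \<longleftrightarrow> uniform R M B"
  by (auto simp: uniform_def submodule_sub_module_iff)

lemma (in lmod) hollow_sub_module:
  assumes "submodule B R M" shows "hollow R (sub_module M B) B \<longleftrightarrow> hollow R M B"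
proof -
  have "submodule V R M \<and> submodule W R M \<and> V <+>\<^bsub>M\<^esub> W = B \<longleftrightarrow>
    (submodule V R M \<and> V \<subseteq> B) \<and> (submodule W R M \<and> W \<subseteq> B) \<and> V <+>\<^bsub>M\<^esub> W = B" for V W
    using set_add_upper1[of V W] set_add_upper2[of V W] by blast
  then show ?thesis by (simp add: hollow_def submodule_sub_module_iff[OF assms])
qed

context
  fixes R :: "('a, 'r) ring_scheme" and M :: "('a, nat) module" and U :: "nat set"
  assumes M: "M \<in> finite_modules R" and U: "indec R M U"
begin

interpretation lmod R M using M by (intro lmod.intro) auto

lemma indec_sub_module: "sub_module M U \<in> finite_modules R" "indecomposable R (sub_module M U)"
proof -
  have "finite U" using M submodule_subset[OF indecD(1)[OF U]] finite_subset by blast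
  then show "sub_module M U \<in> finite_modules R"
    using sub_module_left_module[OF indecD(1)[OF U]] by simp
  show "indecomposable R (sub_module M U)"
    using indecomposable_iff_indec[OF indecD(1)[OF U]] U by simp
qed

lemma indec_simple_socle_iff: "simple_socle R (sub_module M U) \<longleftrightarrow> uniform R M U"
proof -
  interpret S: lmod R "sub_module M U" using indec_sub_module by (intro lmod.intro) simp
  show ?thesis
    using S.simple_socle_iff uniform_sub_module[OF indecD(1)[OF U]] indecD(2)[OF U] indec_sub_module by simp
qed

lemma indec_simple_top_iff: "simple_top R (sub_module M U) \<longleftrightarrow> hollow R M U"
proof -
  interpret S: lmod R "sub_module M U" using indec_sub_module by (intro lmod.intro) simp
  show ?thesis
    using S.simple_top_iff hollow_sub_module[OF indecD(1)[OF U]] indecD(2)[OF U] indec_sub_module by simp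
qed

end

text \<open>The uniform dimension of a submodule is at most that of the whole module.\<close>

lemma ext_closed_if_simple_socle:
  assumes "\<forall>M\<in>finite_modules R. indecomposable R M \<longrightarrow> simple_socle R M"
  shows "ext_closed R r"
  unfolding ext_closed_def
proof (intro allI impI, elim conjE)
  fix X M :: "('a, nat) module" and g a b n
  assume fin: "finite (carrier X)" and "epi R X M g" and a: "dec R X (ker_of X M g) a" and
    n: "dec R X (carrier X) n" and "r < a" "r < b"
  interpret g: lin_map R X "carrier X" M g using \<open>epi R X M g\<close> by (simp add: epi_def)
  have X: "X \<in> finite_modules R" using fin g.M.left_module_axioms by simp
  have unif: "uniform R X U" if "indec R X U" for U
    using indec_simple_socle_iff[OF X that] indec_sub_module[OF X that] assms by blast
  have d: "direct R X (carrier X) {\<zero>\<^bsub>X\<^esub>} (carrier X)"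
    by (rule g.M.direct_zero) simp
  have "a \<le> n"
    using g.M.dec_le_uniform[OF n unif d a] g.M.submoduleD(1,3)[OF ker_of_submodule[OF \<open>epi R X M g\<close>]] by blast
  then show "r < n" using \<open>r < a\<close> by simp
qed

text \<open>Dually, the number of hollow summands of a quotient is at most that of the whole module.\<close>

lemma ext_closed_if_simple_top:
  assumes "\<forall>M\<in>finite_modules R. indecomposable R M \<longrightarrow> simple_top R M"
  shows "ext_closed R r"
  unfolding ext_closed_def
proof (intro allI impI, elim conjE)
  fix X M :: "('a, nat) module" and g a b n
  assume fin: "finite (carrier X)" and g: "epi R X M g" and b: "dec R M (carrier M) b" and
    n: "dec R X (carrier X) n" and "r < a" "r < b"
  interpret g: lin_map R X "carrier X" M g using g by (simp add: epi_def)
  have X: "X \<in> finite_modules R" using fin g.M.left_module_axioms by simp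
  have hol: "hollow R X U" if "indec R X U" for U
    using indec_simple_top_iff[OF X that] indec_sub_module[OF X that] assms by blast
  have d: "direct R M (carrier M) {\<zero>\<^bsub>M\<^esub>} (carrier M)"
    by (rule g.N.direct_zero) simp
  have "b \<le> n"
    using g.dec_le_hollow[OF n hol order_refl b d] g g.N.set_add_zero(1)[OF order_refl] by (simp add: epi_def)
  then show "r < n" using \<open>r < b\<close> by simp
qed

lemma (in lmod) dec_nonzero: "\<lbrakk>dec R M B n; B \<noteq> {\<zero>}\<rbrakk> \<Longrightarrow> 0 < n"
  using dec_0_iff by (cases n) auto

lemma (in lmod) dec_ge_2_split:
  assumes "dec R M B n" "1 < n"
  obtains V W where "direct R M V W B" "V \<noteq> {\<zero>}" "W \<noteq> {\<zero>}"
proof -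
  obtain k where "n = Suc k" "k \<noteq> 0" using assms(2) by (cases n) auto
  then obtain U C where "indec R M U" "dec R M C k" "direct R M U C B"
    using assms(1) by (auto elim: dec_SucE)
  then show ?thesis using that[of U C] indecD(2) \<open>k \<noteq> 0\<close> by fastforce
qed

lemma (in lmod) direct_dec_ge_2:
  assumes "direct R M V W B" "V \<noteq> {\<zero>}" "W \<noteq> {\<zero>}" "finite B"
  shows "\<exists>n\<ge>2. dec R M B n"
proof -
  note D = directD[OF assms(1)]
  obtain n m where nm: "dec R M V n" "dec R M W m"
    using ex_dec[OF D(1)] ex_dec[OF D(2)] assms(4) D(6,7) finite_subset by blast
  have "0 < n" "0 < m" using dec_nonzero nm assms(2,3) by blast+
  then show ?thesis using dec_add[OF nm assms(1)] by (intro exI[of _ "n + m"]) auto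
qed

text \<open>A uniform module has no submodule, and a hollow one no quotient, that splits into two nonzero
  parts.\<close>

lemma ext_closed_1_if_simple_top_or_socle:
  assumes "\<forall>M\<in>finite_modules R. indecomposable R M \<longrightarrow> simple_top R M \<or> simple_socle R M"
  shows "ext_closed R 1"
  unfolding ext_closed_def
proof (intro allI impI, elim conjE)
  fix X M :: "('a, nat) module" and g a b n
  assume fin: "finite (carrier X)" and g: "epi R X M g" and a: "dec R X (ker_of X M g) a" and
    b: "dec R M (carrier M) b" and n: "dec R X (carrier X) n" and "1 < a" "1 < b"
  interpret g: lin_map R X "carrier X" M g using g by (simp add: epi_def)
  have X: "X \<in> finite_modules R" using fin g.M.left_module_axioms by simp
  note kX = g.M.submodule_subset[OF ker_of_submodule[OF g]]
  obtain V W where VW: "direct R X V W (ker_of X M g)" "V \<noteq> {\<zero>\<^bsub>X\<^esub>}" "W \<noteq> {\<zero>\<^bsub>X\<^esub>}"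
    using g.M.dec_ge_2_split[OF a \<open>1 < a\<close>] by blast
  note D = g.M.directD[OF VW(1)]
  obtain V' W' where VW': "direct R M V' W' (carrier M)" "V' \<noteq> {\<zero>\<^bsub>M\<^esub>}" "W' \<noteq> {\<zero>\<^bsub>M\<^esub>}"
    using g.N.dec_ge_2_split[OF b \<open>1 < b\<close>] by blast
  note D' = g.N.directD[OF VW'(1)]
  show "1 < n"
  proof (rule ccontr)
    assume "\<not> 1 < n"
    then consider "n = 0" | "n = 1" by linarith
    then show False
    proof cases
      case 1
      then have "carrier X = {\<zero>\<^bsub>X\<^esub>}" using n by simp
      then show False using VW D kX g.M.submodule_zero[OF D(1)] by blast
    next
      case 2
      then obtain U where U: "indec R X U" "direct R X U {\<zero>\<^bsub>X\<^esub>} (carrier X)"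
        using n by (auto elim: dec_SucE)
      then have "U = carrier X"
        using g.M.directD(3)[OF U(2)] g.M.set_add_zero(1)[OF g.M.submodule_subset[OF indecD(1)[OF U(1)]]] by simp
      then have ind: "indec R X (carrier X)" using U by simp
      then have "hollow R X (carrier X) \<or> uniform R X (carrier X)"
        using assms indec_sub_module[OF X ind] indec_simple_top_iff[OF X ind] indec_simple_socle_iff[OF X ind]
        by blast
      then show False
      proof
        assume "uniform R X (carrier X)"
        then show False using uniformD[OF _ D(1,2) _ _ D(4)] D(6,7) VW kX by blast
      next
        assume "hollow R X (carrier X)"
        then have "hollow R M (carrier M)"
          using g.image_hollow[OF g.dom order_refl] g by (simp add: epi_def)
        then have "V' = carrier M \<or> W' = carrier M" using hollowD[OF _ D'(1,2,3)] by blast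
        then show False using D' VW' by blast
      qed
    qed
  qed
qed

text \<open>The numbers of summands that a short exact sequence can exhibit. Only lower bounds are kept for
  its two ends; then all three numbers add up under direct sums.\<close>

definition reach :: "('a, 'r) ring_scheme \<Rightarrow> nat \<Rightarrow> nat \<Rightarrow> nat \<Rightarrow> bool" where
  "reach R n a b \<longleftrightarrow> (\<exists>(X :: ('a, nat) module) (M :: ('a, nat) module) g a' b'.
     finite (carrier X) \<and> epi R X M g \<and> dec R X (carrier X) n \<and>
     dec R X (ker_of X M g) a' \<and> a \<le> a' \<and> dec R M (carrier M) b' \<and> b \<le> b')"

lemma not_ext_closed_if_reach:
  "\<lbrakk>reach R r a b; r < a; r < b\<rbrakk> \<Longrightarrow> \<not> ext_closed R r"
  unfolding reach_def ext_closed_def by (meson less_irrefl less_le_trans)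

lemma reach_add:
  assumes "reach R n1 a1 b1" "reach R n2 a2 b2"
  shows "reach R (n1 + n2) (a1 + a2) (b1 + b2)"
proof -
  obtain X1 M1 :: "('a, nat) module" and g1 a1' b1' where 1: "finite (carrier X1)" "epi R X1 M1 g1"
    "dec R X1 (carrier X1) n1" "dec R X1 (ker_of X1 M1 g1) a1'" "a1 \<le> a1'"
    "dec R M1 (carrier M1) b1'" "b1 \<le> b1'"
    using assms(1) unfolding reach_def by blast
  obtain X2 M2 :: "('a, nat) module" and g2 a2' b2' where 2: "finite (carrier X2)" "epi R X2 M2 g2"
    "dec R X2 (carrier X2) n2" "dec R X2 (ker_of X2 M2 g2) a2'" "a2 \<le> a2'"
    "dec R M2 (carrier M2) b2'" "b2 \<le> b2'"
    using assms(2) unfolding reach_def by blast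
  interpret g1: lin_map R X1 "carrier X1" M1 g1 using 1 by (simp add: epi_def)
  interpret g2: lin_map R X2 "carrier X2" M2 g2 using 2 by (simp add: epi_def)
  note l = g1.M.left_module_axioms g2.M.left_module_axioms and l' = g1.N.left_module_axioms g2.N.left_module_axioms
  let ?X = "prod_module X1 X2" and ?M = "prod_module M1 M2"
  obtain G where G: "epi R ?X ?M G" "ker_of ?X ?M G = ker_of X1 M1 g1 \<times> ker_of X2 M2 g2"
    using prod_epi[OF 1(2) 2(2)] by blast
  have inj: "inj_on prod_encode S" for S by (rule inj_prod_encode)
  obtain G' where G': "epi R (transport prod_encode ?X) (transport prod_encode ?M) G'"
    "ker_of (transport prod_encode ?X) (transport prod_encode ?M) G' = prod_encode ` ker_of ?X ?M G"
    using epi_transport[OF G(1) inj inj] by blast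
  interpret X: lmod R ?X by (intro lmod.intro prod_left_module l)
  interpret M: lmod R ?M by (intro lmod.intro prod_left_module l')
  interpret tX: lin_map R ?X "carrier ?X" "transport prod_encode ?X" prod_encode
    by (rule X.transport_lin_map[OF inj])
  interpret tM: lin_map R ?M "carrier ?M" "transport prod_encode ?M" prod_encode
    by (rule M.transport_lin_map[OF inj])
  have sub: "ker_of ?X ?M G \<subseteq> carrier ?X" by (auto simp: ker_of_def)
  have "dec R (transport prod_encode ?X) (carrier (transport prod_encode ?X)) (n1 + n2)"
    using tX.image_dec[OF _ order_refl inj] prod_dec[OF l 1(3) 2(3)] by (simp add: transport_simps)
  moreover have "dec R (transport prod_encode ?X) (prod_encode ` ker_of ?X ?M G) (a1' + a2')"
    using tX.image_dec[OF _ sub inj] prod_dec[OF l 1(4) 2(4)] G(2) by simp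
  moreover have "dec R (transport prod_encode ?M) (carrier (transport prod_encode ?M)) (b1' + b2')"
    using tM.image_dec[OF _ order_refl inj] prod_dec[OF l' 1(6) 2(6)] by (simp add: transport_simps)
  moreover have "finite (carrier (transport prod_encode ?X))"
    using 1(1) 2(1) by (simp add: transport_simps)
  ultimately show ?thesis
    unfolding reach_def using G' 1(5,7) 2(5,7)
    by (intro exI[of _ "transport prod_encode ?X"] exI[of _ "transport prod_encode ?M"] exI[of _ G']
        exI[of _ "a1' + a2'"] exI[of _ "b1' + b2'"]) simp
qed

lemma epi_finite: "\<lbrakk>epi R X M g; finite (carrier X)\<rbrakk> \<Longrightarrow> finite (carrier M)"
  unfolding epi_def by (metis finite_imageI)

text \<open>Write \<open>P = V + W\<close> with proper submodules. If \<open>V \<inter> W\<close> were zero, \<open>P\<close> would decompose; and modulo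
  \<open>V \<inter> W\<close> the sum of \<open>V\<close> and \<open>W\<close> becomes direct.\<close>

lemma reach_not_hollow:
  assumes P: "P \<in> finite_modules R" "indecomposable R P" "\<not> simple_top R P"
  shows "reach R 1 1 2"
proof -
  interpret lmod R P using P by (intro lmod.intro) auto
  have fin: "finite (carrier P)" using P by simp
  have ind: "indec R P (carrier P)" using P indecomposable_iff_indec_carrier by simp
  then have "\<not> hollow R P (carrier P)" using P simple_top_iff[OF fin] indecD(2) by blast
  then obtain V W where VW: "submodule V R P" "submodule W R P" "V <+>\<^bsub>P\<^esub> W = carrier P"
    "V \<noteq> carrier P" "W \<noteq> carrier P" unfolding hollow_def by blast
  have sU: "submodule (V \<inter> W) R P" using VW submodule_Int by blast
  obtain M :: "('a, nat) module" and g where g: "finite (carrier M)" "epi R P M g" "ker_of P M g = V \<inter> W"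
    using ex_epi_with_kernel[OF fin sU] by blast
  interpret g: lin_map R P "carrier P" M g using g by (simp add: epi_def)
  have ker: "g x = \<zero>\<^bsub>M\<^esub> \<longleftrightarrow> x \<in> V \<inter> W" if "x \<in> carrier P" for x using g(3) that by (auto simp: ker_of_def)
  note Vc = submodule_carr[OF VW(1)] and Wc = submodule_carr[OF VW(2)]
  have Vs: "V \<subseteq> carrier P" and Ws: "W \<subseteq> carrier P" using VW submodule_subset by blast+
  have "V \<inter> W \<noteq> {\<zero>\<^bsub>P\<^esub>}"
  proof
    assume "V \<inter> W = {\<zero>\<^bsub>P\<^esub>}"
    then have "V = {\<zero>\<^bsub>P\<^esub>} \<or> W = {\<zero>\<^bsub>P\<^esub>}" using indecD(3)[OF ind, of V W] VW by (simp add: direct_def)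
    then show False using VW set_add_zero Vs Ws by auto
  qed
  then obtain a where a: "dec R P (V \<inter> W) a" "1 \<le> a"
    using ex_dec[OF sU] finite_subset[OF _ fin] Vs dec_nonzero by (metis Int_lower1 One_nat_def Suc_leI order_trans)
  have d: "direct R M (g ` V) (g ` W) (carrier M)"
  proof (rule g.N.directI)
    show "submodule (g ` V) R M" "submodule (g ` W) R M" using g.image_submodule VW Vs Ws by blast+
    show "g ` V <+>\<^bsub>M\<^esub> g ` W = carrier M"
      using g.image_set_add[OF Vs Ws] VW(3) g(2) by (simp add: epi_def)
    fix y assume "y \<in> g ` V" "y \<in> g ` W"
    then obtain v w where vw: "v \<in> V" "w \<in> W" "y = g v" "y = g w" by blast
    then have "v \<ominus>\<^bsub>P\<^esub> w \<in> V \<inter> W"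
      using g.map_eq_iff_minus[of v w] ker[of "v \<ominus>\<^bsub>P\<^esub> w"] Vc Wc by simp
    then have "v \<ominus>\<^bsub>P\<^esub> w \<oplus>\<^bsub>P\<^esub> w \<in> W" using vw submodule_add[OF VW(2)] by blast
    then have "v \<in> V \<inter> W" using vw Vc Wc by simp
    then show "y = \<zero>\<^bsub>M\<^esub>" using ker[OF Vc[OF vw(1)]] vw by simp
  qed
  have nz: "g ` S \<noteq> {\<zero>\<^bsub>M\<^esub>}" if "S \<subseteq> carrier P" "\<not> S \<subseteq> V \<inter> W" for S
    using that ker by (metis image_eqI singletonD subset_iff)
  have "\<not> V \<subseteq> V \<inter> W" "\<not> W \<subseteq> V \<inter> W"
    using VW set_add_least[OF VW(1), of V W] set_add_least[OF VW(2), of V W] Vs Ws by blast+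
  then obtain b where b: "dec R M (carrier M) b" "2 \<le> b"
    using g.N.direct_dec_ge_2[OF d nz[OF Vs] nz[OF Ws] g(1)] by blast
  have "dec R P (carrier P) 1" by (rule dec_indec[OF ind])
  then show ?thesis unfolding reach_def using fin g a b by metis
qed

text \<open>Two nonzero submodules with intersection zero have a direct sum, which is not all of the
  indecomposable \<open>P\<close>.\<close>

lemma reach_not_uniform:
  assumes P: "P \<in> finite_modules R" "indecomposable R P" "\<not> simple_socle R P"
  shows "reach R 1 2 1"
proof -
  interpret lmod R P using P by (intro lmod.intro) auto
  have fin: "finite (carrier P)" using P by simp
  have ind: "indec R P (carrier P)" using P indecomposable_iff_indec_carrier by simp
  then have "\<not> uniform R P (carrier P)" using P simple_socle_iff[OF fin] indecD(2) by blast
  then obtain V W where VW: "submodule V R P" "submodule W R P" "V \<inter> W = {\<zero>\<^bsub>P\<^esub>}"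
    "V \<noteq> {\<zero>\<^bsub>P\<^esub>}" "W \<noteq> {\<zero>\<^bsub>P\<^esub>}" unfolding uniform_def by blast
  define U where "U = V <+>\<^bsub>P\<^esub> W"
  have d: "direct R P V W U" using VW by (simp add: direct_def U_def)
  note D = directD[OF d]
  have Us: "U \<subseteq> carrier P" by (rule submodule_subset[OF D(5)])
  obtain a where a: "dec R P U a" "2 \<le> a"
    using direct_dec_ge_2[OF d VW(4,5) finite_subset[OF Us fin]] by blast
  have "U \<noteq> carrier P" using d indecD(3)[OF ind, of V W] VW by blast
  obtain M :: "('a, nat) module" and g where g: "finite (carrier M)" "epi R P M g" "ker_of P M g = U"
    using ex_epi_with_kernel[OF fin D(5)] by blast
  interpret g: lin_map R P "carrier P" M g using g by (simp add: epi_def)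
  have "carrier M \<noteq> {\<zero>\<^bsub>M\<^esub>}"
  proof
    assume "carrier M = {\<zero>\<^bsub>M\<^esub>}"
    then have "ker_of P M g = carrier P" using g.map_in unfolding ker_of_def by blast
    then show False using g(3) \<open>U \<noteq> carrier P\<close> by simp
  qed
  moreover obtain b where b: "dec R M (carrier M) b" using g.N.ex_dec[OF g.N.submodule_whole g(1)] by blast
  ultimately have "1 \<le> b" using g.N.dec_nonzero by fastforce
  moreover have "dec R P (carrier P) 1" by (rule dec_indec[OF ind])
  ultimately show ?thesis unfolding reach_def using fin g a b by metis
qed

text \<open>With \<open>P\<close> indecomposable without simple top and \<open>Q\<close> indecomposable without simple socle, the
  module \<open>P\<^sup>r\<^sup>-\<^sup>1 \<oplus> Q\<close> has \<open>r\<close> summands, and is an extension of a module with at least \<open>2 r - 1\<close> by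
  one with at least \<open>r + 1\<close> summands.\<close>

lemma simple_top_or_socle_if_ext_closed:
  assumes "ext_closed R r" "2 \<le> r"
  shows "(\<forall>M\<in>finite_modules R. indecomposable R M \<longrightarrow> simple_socle R M) \<or>
    (\<forall>M\<in>finite_modules R. indecomposable R M \<longrightarrow> simple_top R M)"
proof (rule ccontr)
  assume "\<not> ?thesis"
  then have PQ: "reach R 1 1 2" "reach R 1 2 1" using reach_not_hollow reach_not_uniform by blast+
  have "reach R (k + 1) (k + 2) (2 * k + 1)" for k
  proof (induction k)
    case (Suc k)
    show ?case using reach_add[OF PQ(1) Suc] by (simp add: numeral_eq_Suc)
  qed (use PQ(2) in \<open>simp add: numeral_eq_Suc\<close>)
  from this[of "r - 1"] have "reach R r (r + 1) (2 * (r - 1) + 1)" using assms(2) by simp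
  moreover have "r < r + 1" "r < 2 * (r - 1) + 1" using assms(2) by linarith+
  ultimately show False using not_ext_closed_if_reach assms(1) by blast
qed

section \<open>Derivations\<close>

text \<open>Derivations from \<open>R\<close> to the additive maps \<open>M \<rightarrow> N\<close>, on which \<open>R\<close> acts from the left through
  \<open>N\<close> and from the right through \<open>M\<close>.\<close>

definition is_der :: "('a, 'r) ring_scheme \<Rightarrow> ('a, 'm) module \<Rightarrow> ('a, 'n) module \<Rightarrow> ('a \<Rightarrow> 'm \<Rightarrow> 'n) \<Rightarrow> bool" where
  "is_der R M N d \<longleftrightarrow> (\<forall>a\<in>carrier R. \<forall>x\<in>carrier M. d a x \<in> carrier N) \<and>
     (\<forall>a\<in>carrier R. \<forall>x\<in>carrier M. \<forall>y\<in>carrier M. d a (x \<oplus>\<^bsub>M\<^esub> y) = d a x \<oplus>\<^bsub>N\<^esub> d a y) \<and>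
     (\<forall>a\<in>carrier R. \<forall>b\<in>carrier R. \<forall>x\<in>carrier M. d (a \<oplus>\<^bsub>R\<^esub> b) x = d a x \<oplus>\<^bsub>N\<^esub> d b x) \<and>
     (\<forall>a\<in>carrier R. \<forall>b\<in>carrier R. \<forall>x\<in>carrier M.
        d (a \<otimes>\<^bsub>R\<^esub> b) x = a \<odot>\<^bsub>N\<^esub> d b x \<oplus>\<^bsub>N\<^esub> d a (b \<odot>\<^bsub>M\<^esub> x))"

lemma is_derD:
  assumes "is_der R M N d"
  shows "\<lbrakk>a \<in> carrier R; x \<in> carrier M\<rbrakk> \<Longrightarrow> d a x \<in> carrier N"
    and "\<lbrakk>a \<in> carrier R; x \<in> carrier M; y \<in> carrier M\<rbrakk> \<Longrightarrow> d a (x \<oplus>\<^bsub>M\<^esub> y) = d a x \<oplus>\<^bsub>N\<^esub> d a y"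
    and "\<lbrakk>a \<in> carrier R; b \<in> carrier R; x \<in> carrier M\<rbrakk> \<Longrightarrow> d (a \<oplus>\<^bsub>R\<^esub> b) x = d a x \<oplus>\<^bsub>N\<^esub> d b x"
    and "\<lbrakk>a \<in> carrier R; b \<in> carrier R; x \<in> carrier M\<rbrakk> \<Longrightarrow>
       d (a \<otimes>\<^bsub>R\<^esub> b) x = a \<odot>\<^bsub>N\<^esub> d b x \<oplus>\<^bsub>N\<^esub> d a (b \<odot>\<^bsub>M\<^esub> x)"
  using assms unfolding is_der_def by blast+

text \<open>Values outside the carriers are fixed, so that derivations that agree on the carriers are equal as
  functions and finiteness is meaningful.\<close>

definition ders :: "('a, 'r) ring_scheme \<Rightarrow> ('a, 'm) module \<Rightarrow> ('a, 'n) module \<Rightarrow> ('a \<times> 'm \<Rightarrow> 'n) set" where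
  "ders R M N = {d \<in> (carrier R \<times> carrier M) \<rightarrow>\<^sub>E carrier N. is_der R M N (\<lambda>a x. d (a, x))}"

lemma is_der_cong:
  assumes "left_module R M" "\<And>a x. \<lbrakk>a \<in> carrier R; x \<in> carrier M\<rbrakk> \<Longrightarrow> d a x = e a x"
  shows "is_der R M N d \<longleftrightarrow> is_der R M N e"
proof -
  interpret M: lmod R M by (intro lmod.intro assms(1))
  show ?thesis by (simp add: is_der_def assms(2))
qed

lemma restrict_der:
  assumes "left_module R M" "is_der R M N d"
  shows "(\<lambda>(a, x)\<in>carrier R \<times> carrier M. d a x) \<in> ders R M N"
  using assms(2) is_der_cong[OF assms(1), of d "\<lambda>a x. (\<lambda>(a, x)\<in>carrier R \<times> carrier M. d a x) (a, x)" N]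
  by (auto simp: ders_def is_derD(1))

lemma is_der_compose:
  assumes "lin_map R N (carrier N) L g" "is_der R M N d" "left_module R M"
  shows "is_der R M L (\<lambda>a x. g (d a x))"
proof -
  interpret g: lin_map R N "carrier N" L g by fact
  interpret M: lmod R M by (intro lmod.intro assms)
  show ?thesis
    using is_derD[OF assms(2)] by (simp add: is_der_def g.map_add g.map_smult)
qed

lemma is_der_minus:
  assumes "left_module R M" "left_module R N" "is_der R M N d" "is_der R M N e"
  shows "is_der R M N (\<lambda>a x. d a x \<ominus>\<^bsub>N\<^esub> e a x)"
proof -
  interpret M: lmod R M by (intro lmod.intro assms)
  interpret N: lmod R N by (intro lmod.intro assms)
  have sm: "a \<odot>\<^bsub>N\<^esub> (x \<ominus>\<^bsub>N\<^esub> y) = a \<odot>\<^bsub>N\<^esub> x \<ominus>\<^bsub>N\<^esub> a \<odot>\<^bsub>N\<^esub> y"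
    if "a \<in> carrier R" "x \<in> carrier N" "y \<in> carrier N" for a x y
  proof -
    have "a \<odot>\<^bsub>N\<^esub> (x \<ominus>\<^bsub>N\<^esub> y) \<oplus>\<^bsub>N\<^esub> a \<odot>\<^bsub>N\<^esub> y = a \<odot>\<^bsub>N\<^esub> x"
      using that N.smult_r_distr[of a "x \<ominus>\<^bsub>N\<^esub> y" y] by simp
    then show ?thesis using that
      by (metis N.M.add.inv_solve_right N.M.minus_closed N.smult_in a_minus_def)
  qed
  show ?thesis
    using is_derD[OF assms(3)] is_derD[OF assms(4)] unfolding is_der_def
    by (simp add: N.minus_swap_middle sm)
qed

lemma der_zero:
  assumes "left_module R M" "left_module R N" "is_der R M N d" "a \<in> carrier R"
  shows "d a \<zero>\<^bsub>M\<^esub> = \<zero>\<^bsub>N\<^esub>"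
proof -
  interpret M: lmod R M by (intro lmod.intro assms)
  interpret N: lmod R N by (intro lmod.intro assms)
  have "d a \<zero>\<^bsub>M\<^esub> = d a \<zero>\<^bsub>M\<^esub> \<oplus>\<^bsub>N\<^esub> d a \<zero>\<^bsub>M\<^esub>"
    using is_derD(2)[OF assms(3,4) M.M.zero_closed M.M.zero_closed] by simp
  then show ?thesis using is_derD(1)[OF assms(3,4) M.M.zero_closed] by (metis N.M.add.r_cancel_one)
qed

lemma finite_if_finite_fibres:
  assumes "finite (h ` S)" "\<And>x. x \<in> S \<Longrightarrow> finite {y \<in> S. h y = h x}"
  shows "finite S"
proof -
  have "S = (\<Union>z\<in>h ` S. {y \<in> S. h y = z})" by auto
  moreover have "finite (\<Union>z\<in>h ` S. {y \<in> S. h y = z})" using assms by (intro finite_UN_I) auto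
  ultimately show ?thesis by simp
qed

lemma finite_if_finite_differences:
  assumes N: "left_module R N" and e: "e \<in> ders R M N" and S: "S \<subseteq> ders R M N" and C: "finite C"
    and diff: "\<And>d. d \<in> S \<Longrightarrow>
      \<exists>c\<in>C. \<forall>a\<in>carrier R. \<forall>x\<in>carrier M. d (a, x) \<ominus>\<^bsub>N\<^esub> e (a, x) = c (a, x)"
  shows "finite S"
proof -
  interpret N: lmod R N by (intro lmod.intro N)
  let ?D = "carrier R \<times> carrier M"
  obtain k where k: "\<And>d. d \<in> S \<Longrightarrow> k d \<in> C"
    "\<And>d a x. \<lbrakk>d \<in> S; (a, x) \<in> ?D\<rbrakk> \<Longrightarrow> d (a, x) \<ominus>\<^bsub>N\<^esub> e (a, x) = k d (a, x)"
    using diff by (metis mem_Sigma_iff)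
  have val: "d (a, x) \<in> carrier N" if "d \<in> ders R M N" "(a, x) \<in> ?D" for d a x
    using that by (auto simp: ders_def)
  show ?thesis
  proof (rule inj_on_finite[OF _ _ C])
    show "k ` S \<subseteq> C" using k(1) by blast
    show "inj_on k S"
    proof (rule inj_onI)
      fix d d' assume d: "d \<in> S" "d' \<in> S" "k d = k d'"
      have "d (a, x) = d' (a, x)" if ax: "(a, x) \<in> ?D" for a x
      proof -
        have v: "d (a, x) \<in> carrier N" "d' (a, x) \<in> carrier N" "e (a, x) \<in> carrier N"
          using val[OF _ ax] d S e by blast+
        have "d (a, x) \<ominus>\<^bsub>N\<^esub> e (a, x) = d' (a, x) \<ominus>\<^bsub>N\<^esub> e (a, x)"
          using k(2)[OF d(1) ax] k(2)[OF d(2) ax] d(3) by simp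
        then show ?thesis using v by (metis N.minus_add_cancel)
      qed
      moreover have "d \<in> ?D \<rightarrow>\<^sub>E carrier N" "d' \<in> ?D \<rightarrow>\<^sub>E carrier N" using d S by (auto simp: ders_def)
      ultimately show "d = d'" by (auto intro: PiE_ext)
    qed
  qed
qed

text \<open>Derivations are left exact in the target: a derivation into \<open>N\<close> is determined, up to a
  derivation into the submodule, by the induced derivation into the quotient.\<close>

lemma finite_ders_target:
  assumes M: "left_module R M" and g: "epi R N L g"
    and fin: "finite (ders R M (sub_module N (ker_of N L g)))" "finite (ders R M L)"
  shows "finite (ders R M N)"
proof -
  interpret g: lin_map R N "carrier N" L g using g by (simp add: epi_def)
  note N = g.M.left_module_axioms
  let ?D = "carrier R \<times> carrier M"
  define h where "h = (\<lambda>d. \<lambda>(a, x)\<in>?D. g (d (a, x)))"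
  show ?thesis
  proof (rule finite_if_finite_fibres[of h])
    have "h ` ders R M N \<subseteq> ders R M L"
    proof (rule image_subsetI)
      fix d assume "d \<in> ders R M N"
      then have "is_der R M N (\<lambda>a x. d (a, x))" by (simp add: ders_def)
      then show "h d \<in> ders R M L"
        unfolding h_def by (intro restrict_der[OF M] is_der_compose[OF g.lin_map_axioms _ M])
    qed
    then show "finite (h ` ders R M N)" using fin(2) finite_subset by blast
    fix e assume e: "e \<in> ders R M N"
    show "finite {d \<in> ders R M N. h d = h e}"
    proof (rule finite_if_finite_differences[OF N e _ fin(1)])
      fix d assume d: "d \<in> {d \<in> ders R M N. h d = h e}"
      let ?c = "\<lambda>a x. d (a, x) \<ominus>\<^bsub>N\<^esub> e (a, x)"
      have der: "is_der R M N ?c" using d e by (intro is_der_minus[OF M N]) (auto simp: ders_def)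
      have "?c a x \<in> ker_of N L g" if ax: "(a, x) \<in> ?D" for a x
      proof -
        have "d (a, x) \<in> carrier N" "e (a, x) \<in> carrier N" using d e ax by (auto simp: ders_def)
        moreover have "h d (a, x) = h e (a, x)" using d by simp
        then have "g (d (a, x)) = g (e (a, x))" using ax by (simp add: h_def)
        ultimately show ?thesis using g.map_eq_iff_minus by (simp add: ker_of_def)
      qed
      then have "is_der R M (sub_module N (ker_of N L g)) ?c" using der by (simp add: is_der_def)
      then show "\<exists>c\<in>ders R M (sub_module N (ker_of N L g)).
          \<forall>a\<in>carrier R. \<forall>x\<in>carrier M. d (a, x) \<ominus>\<^bsub>N\<^esub> e (a, x) = c (a, x)"
        by (intro bexI[OF _ restrict_der[OF M]]) auto
    qed blast
  qed
qed

text \<open>Dually in the source: a derivation that vanishes on a submodule descends to the quotient.\<close>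

lemma der_descend:
  assumes N: "left_module R N" and g: "epi R M L g" and der: "is_der R M N c"
    and zero: "\<And>a u. \<lbrakk>a \<in> carrier R; u \<in> ker_of M L g\<rbrakk> \<Longrightarrow> c a u = \<zero>\<^bsub>N\<^esub>"
  obtains b where "b \<in> ders R L N" "\<And>a x. \<lbrakk>a \<in> carrier R; x \<in> carrier M\<rbrakk> \<Longrightarrow> c a x = b (a, g x)"
proof -
  interpret g: lin_map R M "carrier M" L g using g by (simp add: epi_def)
  interpret N: lmod R N by (intro lmod.intro N)
  have gM: "g ` carrier M = carrier L" using g by (simp add: epi_def)
  have desc: "c a x = c a y" if "a \<in> carrier R" "x \<in> carrier M" "y \<in> carrier M" "g x = g y" for a x y
  proof -
    have "x \<ominus>\<^bsub>M\<^esub> y \<in> ker_of M L g" using that g.map_eq_iff_minus[of x y] by (simp add: ker_of_def)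
    then have "c a (x \<ominus>\<^bsub>M\<^esub> y \<oplus>\<^bsub>M\<^esub> y) = c a y"
      using is_derD(2)[OF der that(1), of "x \<ominus>\<^bsub>M\<^esub> y" y] is_derD(1)[OF der] zero that by simp
    then show ?thesis using that by simp
  qed
  define s where "s = inv_into (carrier M) g"
  have s: "s y \<in> carrier M" "g (s y) = y" if "y \<in> carrier L" for y
    using that gM f_inv_into_f[of y g "carrier M"] inv_into_into[of y g "carrier M"] by (auto simp: s_def)
  have "is_der R L N (\<lambda>a y. c a (s y))"
    unfolding is_der_def
  proof (intro conjI ballI)
    fix a x assume "a \<in> carrier R" "x \<in> carrier L"
    then show "c a (s x) \<in> carrier N" using is_derD(1)[OF der] s by blast
  next
    fix a x y assume axy: "a \<in> carrier R" "x \<in> carrier L" "y \<in> carrier L"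
    have "c a (s (x \<oplus>\<^bsub>L\<^esub> y)) = c a (s x \<oplus>\<^bsub>M\<^esub> s y)"
      using axy s by (intro desc) (simp_all add: g.map_add)
    then show "c a (s (x \<oplus>\<^bsub>L\<^esub> y)) = c a (s x) \<oplus>\<^bsub>N\<^esub> c a (s y)"
      using is_derD(2)[OF der axy(1), of "s x" "s y"] axy s by simp
  next
    fix a b x assume "a \<in> carrier R" "b \<in> carrier R" "x \<in> carrier L"
    then show "c (a \<oplus>\<^bsub>R\<^esub> b) (s x) = c a (s x) \<oplus>\<^bsub>N\<^esub> c b (s x)" using is_derD(3)[OF der] s by blast
  next
    fix a b x assume abx: "a \<in> carrier R" "b \<in> carrier R" "x \<in> carrier L"
    have "c a (s (b \<odot>\<^bsub>L\<^esub> x)) = c a (b \<odot>\<^bsub>M\<^esub> s x)"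
      using abx s by (intro desc) (simp_all add: g.map_smult)
    then show "c (a \<otimes>\<^bsub>R\<^esub> b) (s x) = a \<odot>\<^bsub>N\<^esub> c b (s x) \<oplus>\<^bsub>N\<^esub> c a (s (b \<odot>\<^bsub>L\<^esub> x))"
      using is_derD(4)[OF der abx(1,2), of "s x"] abx s by simp
  qed
  from restrict_der[OF g.N.left_module_axioms this] show ?thesis
  proof (rule that)
    show "c a x = (\<lambda>(a, y)\<in>carrier R \<times> carrier L. c a (s y)) (a, g x)"
      if "a \<in> carrier R" "x \<in> carrier M" for a x
      using that s[of "g x"] desc[of a x "s (g x)"] by simp
  qed
qed

lemma finite_ders_source:
  assumes N: "left_module R N" and g: "epi R M L g"
    and fin: "finite (ders R (sub_module M (ker_of M L g)) N)" "finite (ders R L N)"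
  shows "finite (ders R M N)"
proof -
  interpret g: lin_map R M "carrier M" L g using g by (simp add: epi_def)
  interpret N: lmod R N by (intro lmod.intro N)
  note M = g.M.left_module_axioms
  define U where "U = ker_of M L g"
  have sU: "submodule U R M" unfolding U_def by (rule ker_of_submodule[OF g])
  note Uc = g.M.submodule_carr[OF sU]
  define h where "h = (\<lambda>d. \<lambda>(a, x)\<in>carrier R \<times> U. (d (a, x) :: 'c))"
  show ?thesis
  proof (rule finite_if_finite_fibres[of h])
    have "h ` ders R M N \<subseteq> ders R (sub_module M U) N"
    proof (rule image_subsetI)
      fix d assume "d \<in> ders R M N"
      then have "is_der R (sub_module M U) N (\<lambda>a x. d (a, x))"
        using Uc by (simp add: is_der_def ders_def)
      then show "h d \<in> ders R (sub_module M U) N"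
        using restrict_der[OF g.M.sub_module_left_module[OF sU]] unfolding h_def by fastforce
    qed
    then show "finite (h ` ders R M N)" using fin(1) finite_subset unfolding U_def by blast
    fix e assume e: "e \<in> ders R M N"
    define C where "C = (\<lambda>b (a, x). b (a, g x)) ` ders R L N"
    have finC: "finite C" using fin(2) by (simp add: C_def)
    show "finite {d \<in> ders R M N. h d = h e}"
    proof (rule finite_if_finite_differences[OF N e _ finC])
      fix d assume d: "d \<in> {d \<in> ders R M N. h d = h e}"
      have der: "is_der R M N (\<lambda>a x. d (a, x) \<ominus>\<^bsub>N\<^esub> e (a, x))"
        using d e by (intro is_der_minus[OF M N]) (auto simp: ders_def)
      have zero: "d (a, u) \<ominus>\<^bsub>N\<^esub> e (a, u) = \<zero>\<^bsub>N\<^esub>" if au: "a \<in> carrier R" "u \<in> U" for a u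
      proof -
        have "h d (a, u) = h e (a, u)" using d by simp
        then have "d (a, u) = e (a, u)" using au by (simp add: h_def)
        moreover have "e (a, u) \<in> carrier N" using e au Uc by (auto simp: ders_def)
        ultimately show ?thesis by simp
      qed
      obtain b where "b \<in> ders R L N"
        "\<And>a x. \<lbrakk>a \<in> carrier R; x \<in> carrier M\<rbrakk> \<Longrightarrow> d (a, x) \<ominus>\<^bsub>N\<^esub> e (a, x) = b (a, g x)"
        using der_descend[OF N g der zero[unfolded U_def]] by blast
      then show "\<exists>c\<in>C. \<forall>a\<in>carrier R. \<forall>x\<in>carrier M. d (a, x) \<ominus>\<^bsub>N\<^esub> e (a, x) = c (a, x)"
        unfolding C_def by fastforce
    qed blast
  qed
qed

lemma epi_card_less:
  assumes "epi R X M g" "finite (carrier X)" "ker_of X M g \<noteq> {\<zero>\<^bsub>X\<^esub>}"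
  shows "card (carrier M) < card (carrier X)"
proof (rule ccontr)
  interpret g: lin_map R X "carrier X" M g using assms by (simp add: epi_def)
  assume "\<not> ?thesis"
  then have "card (g ` carrier X) = card (carrier X)"
    using card_image_le[OF assms(2), of g] assms(1) by (simp add: epi_def)
  then have "inj_on g (carrier X)" using assms(2) eq_card_imp_inj_on by blast
  then have "ker_of X M g \<subseteq> {\<zero>\<^bsub>X\<^esub>}" using g.inj_on_kernel by (auto simp: ker_of_def)
  then show False using assms(3) g.M.submodule_zero[OF ker_of_submodule[OF assms(1)]] by blast
qed

text \<open>Devissage: as long as \<open>M\<close> or \<open>N\<close> is neither zero nor simple, a proper submodule reduces the claim
  to two smaller ones.\<close>

lemma finite_ders:
  fixes M N :: "('a, nat) module"
  assumes simple: "\<And>S T. \<lbrakk>S \<in> finite_modules R; T \<in> finite_modules R; simple_module R S; simple_module R T\<rbrakk>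
      \<Longrightarrow> finite (ders R S T)"
    and "M \<in> finite_modules R" "N \<in> finite_modules R"
  shows "finite (ders R M N)"
  using assms(2-)
proof (induction "card (carrier M) + card (carrier N)" arbitrary: M N rule: less_induct)
  case less
  interpret M: lmod R M using less.prems by (intro lmod.intro) simp
  interpret N: lmod R N using less.prems by (intro lmod.intro) simp
  have finM: "finite (carrier M)" and finN: "finite (carrier N)" using less.prems by auto
  show ?case
  proof (cases "carrier M = {\<zero>\<^bsub>M\<^esub>} \<or> carrier N = {\<zero>\<^bsub>N\<^esub>}")
    case True
    have "d (a, x) = \<zero>\<^bsub>N\<^esub>" if "d \<in> ders R M N" "a \<in> carrier R" "x \<in> carrier M" for d a x
      using True
    proof
      assume "carrier M = {\<zero>\<^bsub>M\<^esub>}"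
      then show ?thesis
        using der_zero[OF M.left_module_axioms N.left_module_axioms, of "\<lambda>a x. d (a, x)" a] that
        by (simp add: ders_def)
    qed (use that in \<open>auto simp: ders_def\<close>)
    then have "ders R M N \<subseteq> {\<lambda>z\<in>carrier R \<times> carrier M. \<zero>\<^bsub>N\<^esub>}"
      by (auto simp: ders_def PiE_def extensional_def fun_eq_iff)
    then show ?thesis using finite_subset by blast
  next
    case nz: False
    show ?thesis
    proof (cases "simple_module R M \<and> simple_module R N")
      case True
      then show ?thesis using simple less.prems by blast
    next
      case False
      then consider U where "submodule U R M" "U \<noteq> {\<zero>\<^bsub>M\<^esub>}" "U \<noteq> carrier M"
        | V where "submodule V R N" "V \<noteq> {\<zero>\<^bsub>N\<^esub>}" "V \<noteq> carrier N"
        using nz M.left_module_axioms N.left_module_axioms unfolding simple_module_def by blast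
      then show ?thesis
      proof cases
        case 1
        obtain L :: "('a, nat) module" and g where g: "finite (carrier L)" "epi R M L g" "ker_of M L g = U"
          using M.ex_epi_with_kernel[OF finM 1(1)] by blast
        interpret g: lin_map R M "carrier M" L g using g by (simp add: epi_def)
        have "card (carrier L) < card (carrier M)" using epi_card_less[OF g(2) finM] g(3) 1(2) by simp
        then have "finite (ders R L N)"
          using less.hyps[of L N] g(1) g.N.left_module_axioms less.prems by simp
        moreover have "U \<subset> carrier M" using 1 M.submodule_subset by blast
        then have "card U < card (carrier M)" "finite U" using finM psubset_card_mono finite_subset by blast+
        then have "finite (ders R (sub_module M U) N)"
          using less.hyps[of "sub_module M U" N] M.sub_module_left_module[OF 1(1)] less.prems by simp
        ultimately show ?thesis using finite_ders_source[OF N.left_module_axioms g(2)] g(3) by simp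
      next
        case 2
        obtain L :: "('a, nat) module" and g where g: "finite (carrier L)" "epi R N L g" "ker_of N L g = V"
          using N.ex_epi_with_kernel[OF finN 2(1)] by blast
        interpret g: lin_map R N "carrier N" L g using g by (simp add: epi_def)
        have "card (carrier L) < card (carrier N)" using epi_card_less[OF g(2) finN] g(3) 2(2) by simp
        then have "finite (ders R M L)"
          using less.hyps[of M L] g(1) g.N.left_module_axioms less.prems by simp
        moreover have "V \<subset> carrier N" using 2 N.submodule_subset by blast
        then have "card V < card (carrier N)" "finite V" using finN psubset_card_mono finite_subset by blast+
        then have "finite (ders R M (sub_module N V))"
          using less.hyps[of M "sub_module N V"] N.sub_module_left_module[OF 2(1)] less.prems by simp
        ultimately show ?thesis using finite_ders_target[OF M.left_module_axioms g(2)] g(3) by simp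
      qed
    qed
  qed
qed

section \<open>Extensions with prescribed sub and quotient\<close>

text \<open>The split extension with its action twisted by a derivation.\<close>

definition twisted :: "('a, 'm) module \<Rightarrow> ('a, 'n) module \<Rightarrow> ('a \<Rightarrow> 'm \<Rightarrow> 'n) \<Rightarrow> ('a, 'n \<times> 'm) module" where
  "twisted M N d = (prod_module N M)\<lparr>smult := (\<lambda>a (n, m). (a \<odot>\<^bsub>N\<^esub> n \<oplus>\<^bsub>N\<^esub> d a m, a \<odot>\<^bsub>M\<^esub> m))\<rparr>"

lemma twisted_simps [simp]:
  "carrier (twisted M N d) = carrier N \<times> carrier M"
  "\<zero>\<^bsub>twisted M N d\<^esub> = (\<zero>\<^bsub>N\<^esub>, \<zero>\<^bsub>M\<^esub>)"
  "(x, y) \<oplus>\<^bsub>twisted M N d\<^esub> (x', y') = (x \<oplus>\<^bsub>N\<^esub> x', y \<oplus>\<^bsub>M\<^esub> y')"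
  "a \<odot>\<^bsub>twisted M N d\<^esub> (n, m) = (a \<odot>\<^bsub>N\<^esub> n \<oplus>\<^bsub>N\<^esub> d a m, a \<odot>\<^bsub>M\<^esub> m)"
  by (auto simp: twisted_def prod_module_def)

lemma twisted_left_module:
  assumes "left_module R M" "left_module R N" "is_der R M N d"
  shows "left_module R (twisted M N d)"
proof -
  interpret M: lmod R M by (intro lmod.intro assms)
  interpret N: lmod R N by (intro lmod.intro assms)
  note d = is_derD[OF assms(3)]
  have d1: "d \<one>\<^bsub>R\<^esub> x = \<zero>\<^bsub>N\<^esub>" if "x \<in> carrier M" for x
  proof -
    have "d \<one>\<^bsub>R\<^esub> x = d \<one>\<^bsub>R\<^esub> x \<oplus>\<^bsub>N\<^esub> d \<one>\<^bsub>R\<^esub> x"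
      using d(4)[of "\<one>\<^bsub>R\<^esub>" "\<one>\<^bsub>R\<^esub>" x] that d(1) by (simp add: M.smult_one N.smult_one)
    then show ?thesis using d(1)[OF M.R.one_closed that] by (metis N.M.add.r_cancel_one)
  qed
  have "abelian_group (twisted M N d)"
  proof (rule abelian_groupI)
    fix z assume "z \<in> carrier (twisted M N d)"
    then obtain x y where "z = (x, y)" "x \<in> carrier N" "y \<in> carrier M" by auto
    then show "\<exists>w\<in>carrier (twisted M N d). w \<oplus>\<^bsub>twisted M N d\<^esub> z = \<zero>\<^bsub>twisted M N d\<^esub>"
      by (intro bexI[of _ "(\<ominus>\<^bsub>N\<^esub> x, \<ominus>\<^bsub>M\<^esub> y)"]) (auto simp: M.M.l_neg N.M.l_neg)
  qed (auto simp: M.M.a_assoc N.M.a_assoc intro: M.M.a_comm N.M.a_comm)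
  moreover have "a \<odot>\<^bsub>N\<^esub> n \<oplus>\<^bsub>N\<^esub> b \<odot>\<^bsub>N\<^esub> n \<oplus>\<^bsub>N\<^esub> (d a m \<oplus>\<^bsub>N\<^esub> d b m) = a \<odot>\<^bsub>N\<^esub> n \<oplus>\<^bsub>N\<^esub> d a m \<oplus>\<^bsub>N\<^esub> (b \<odot>\<^bsub>N\<^esub> n \<oplus>\<^bsub>N\<^esub> d b m)"
    if "a \<in> carrier R" "b \<in> carrier R" "n \<in> carrier N" "m \<in> carrier M" for a b n m
    using that d(1) by (intro N.add_swap_middle) auto
  moreover have "a \<odot>\<^bsub>N\<^esub> n \<oplus>\<^bsub>N\<^esub> a \<odot>\<^bsub>N\<^esub> n' \<oplus>\<^bsub>N\<^esub> (d a m \<oplus>\<^bsub>N\<^esub> d a m') = a \<odot>\<^bsub>N\<^esub> n \<oplus>\<^bsub>N\<^esub> d a m \<oplus>\<^bsub>N\<^esub> (a \<odot>\<^bsub>N\<^esub> n' \<oplus>\<^bsub>N\<^esub> d a m')"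
    if "a \<in> carrier R" "n \<in> carrier N" "m \<in> carrier M" "n' \<in> carrier N" "m' \<in> carrier M" for a n m n' m'
    using that d(1) by (intro N.add_swap_middle) auto
  ultimately show ?thesis
    unfolding left_module_def left_module_axioms_def
    using M.R.ring_axioms d d1
    by (auto simp: M.smult_l_distr M.smult_r_distr M.smult_assoc1 M.smult_one
        N.smult_l_distr N.smult_r_distr N.smult_assoc1 N.smult_one N.M.a_assoc)
qed

text \<open>Two derivations with equivalent extensions differ by an inner derivation
  \<open>(a, m) \<mapsto> \<phi> (a m) - a \<phi> m\<close>, and there are finitely many maps \<open>\<phi>\<close> from \<open>M\<close> to \<open>N\<close>.\<close>

lemma finite_ders_if_finite_Ext1:
  fixes K :: "'k ring" and A :: "('k, 'a) module" and M N :: "('a, nat) module"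
  assumes fd: "fd_modules K A = finite_modules A" and MN: "M \<in> finite_modules A" "N \<in> finite_modules A"
    and fin: "finite (Ext1 K A M N)"
  shows "finite (ders A M N)"
proof -
  interpret M: lmod A M using MN by (intro lmod.intro) simp
  interpret N: lmod A N using MN by (intro lmod.intro) simp
  define T where "T = (\<lambda>d :: 'a \<times> nat \<Rightarrow> nat. twisted M N (\<lambda>a x. d (a, x)))"
  define E where "E = (\<lambda>d :: 'a \<times> nat \<Rightarrow> nat. transport prod_encode (T d))"
  define f where "f = (\<lambda>n. prod_encode (n, \<zero>\<^bsub>M\<^esub>))"
  define g where "g = (\<lambda>e. snd (prod_decode e))"
  have inj: "inj_on prod_encode S" for S by (rule inj_prod_encode)
  have car: "carrier (E d) = prod_encode ` (carrier N \<times> carrier M)" for d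
    by (simp add: E_def T_def transport_simps)
  have add: "prod_encode (n, m) \<oplus>\<^bsub>E d\<^esub> prod_encode (n', m') = prod_encode (n \<oplus>\<^bsub>N\<^esub> n', m \<oplus>\<^bsub>M\<^esub> m')"
    if "n \<in> carrier N" "m \<in> carrier M" "n' \<in> carrier N" "m' \<in> carrier M" for d n m n' m'
    using that transport_simps(3)[OF inj, of "(n, m)" "T d" "(n', m')"] by (simp add: E_def T_def)
  have smult: "a \<odot>\<^bsub>E d\<^esub> prod_encode (n, m) = prod_encode (a \<odot>\<^bsub>N\<^esub> n \<oplus>\<^bsub>N\<^esub> d (a, m), a \<odot>\<^bsub>M\<^esub> m)"
    if "n \<in> carrier N" "m \<in> carrier M" for d a n m
    using that transport_simps(4)[OF inj, of "(n, m)" "T d" a] by (simp add: E_def T_def)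
  have E: "left_module A (E d)" "finite (carrier (E d))" if "d \<in> ders A M N" for d
  proof -
    interpret T: lmod A "T d"
      unfolding T_def using that by (intro lmod.intro twisted_left_module M.left_module_axioms N.left_module_axioms) (simp add: ders_def)
    show "left_module A (E d)" unfolding E_def by (rule T.transport_left_module[OF inj])
    show "finite (carrier (E d))" using MN by (simp add: car)
  qed
  have d0: "d (a, \<zero>\<^bsub>M\<^esub>) = \<zero>\<^bsub>N\<^esub>" if "d \<in> ders A M N" "a \<in> carrier A" for d a
    using der_zero[OF M.left_module_axioms N.left_module_axioms, of "\<lambda>a x. d (a, x)"] that by (simp add: ders_def)
  have ext: "(E d, f, g) \<in> extensions K A M N" if d: "d \<in> ders A M N" for d
    unfolding extensions_def mem_Collect_eq prod.case
  proof (intro conjI)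
    show "E d \<in> fd_modules K A" using E[OF d] fd by simp
    show "f \<in> module_hom A N (E d)"
      by (auto simp: module_hom_def f_def car add smult d0[OF d])
    show "inj_on f (carrier N)" by (auto simp: inj_on_def f_def)
    have dv: "d (a, m) \<in> carrier N" if "a \<in> carrier A" "m \<in> carrier M" for a m
      using d that by (auto simp: ders_def)
    show "g \<in> module_hom A (E d) M"
      by (auto simp: module_hom_def g_def car add smult dv)
    show "g ` carrier (E d) = carrier M"
      by (auto simp: g_def car image_iff) (use N.M.zero_closed in blast)
    show "f ` carrier N = {x \<in> carrier (E d). g x = \<zero>\<^bsub>M\<^esub>}"
      by (auto simp: f_def g_def car)
  qed
  define cls where "cls = (\<lambda>d. ext_equiv K A M N `` {(E d, f, g)})"
  have refl: "((E d, f, g), (E d, f, g)) \<in> ext_equiv K A M N" if "d \<in> ders A M N" for d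
  proof -
    have "(\<lambda>x. x) \<in> module_iso A (E d) (E d)"
      by (simp add: module_iso_def module_hom_def bij_betw_def)
    then have "\<exists>h\<in>module_iso A (E d) (E d). (\<forall>x\<in>carrier N. h (f x) = f x) \<and> (\<forall>x\<in>carrier (E d). g (h x) = g x)"
      by (intro bexI[of _ "\<lambda>x. x"]) auto
    then show ?thesis using ext[OF that] by (simp add: ext_equiv_def)
  qed
  show ?thesis
  proof (rule finite_if_finite_fibres[of cls])
    have "cls ` ders A M N \<subseteq> Ext1 K A M N"
      using ext by (auto simp: cls_def Ext1_def intro: quotientI)
    then show "finite (cls ` ders A M N)" using fin finite_subset by blast
    fix e assume e: "e \<in> ders A M N"
    have "\<exists>\<phi>\<in>carrier M \<rightarrow>\<^sub>E carrier N. \<forall>a\<in>carrier A. \<forall>m\<in>carrier M.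
        a \<odot>\<^bsub>N\<^esub> \<phi> m \<oplus>\<^bsub>N\<^esub> d (a, m) = e (a, m) \<oplus>\<^bsub>N\<^esub> \<phi> (a \<odot>\<^bsub>M\<^esub> m)"
      if d: "d \<in> ders A M N" "cls d = cls e" for d
    proof -
      have "(E d, f, g) \<in> cls e" using refl[OF d(1)] d(2) by (auto simp: cls_def)
      then obtain h where h: "h \<in> module_iso A (E e) (E d)" "\<And>x. x \<in> carrier N \<Longrightarrow> h (f x) = f x"
        "\<And>x. x \<in> carrier (E e) \<Longrightarrow> g (h x) = g x"
        by (auto simp: cls_def ext_equiv_def)
      have hadd: "h (x \<oplus>\<^bsub>E e\<^esub> y) = h x \<oplus>\<^bsub>E d\<^esub> h y" if "x \<in> carrier (E e)" "y \<in> carrier (E e)" for x y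
        using h(1) that by (simp add: module_iso_def module_hom_def)
      have hsmult: "h (a \<odot>\<^bsub>E e\<^esub> x) = a \<odot>\<^bsub>E d\<^esub> h x" if "a \<in> carrier A" "x \<in> carrier (E e)" for a x
        using h(1) that by (simp add: module_iso_def module_hom_def)
      \<comment> \<open>An equivalence is the identity on \<open>N\<close> and on \<open>M\<close>, so it is determined by the \<open>N\<close>-component
        \<open>\<psi> m\<close> of the image of \<open>(0, m)\<close>.\<close>
      have "\<exists>n\<in>carrier N. h (prod_encode (\<zero>\<^bsub>N\<^esub>, m)) = prod_encode (n, m)" if "m \<in> carrier M" for m
      proof -
        have c: "prod_encode (\<zero>\<^bsub>N\<^esub>, m) \<in> carrier (E e)" using that by (simp add: car)
        then have "h (prod_encode (\<zero>\<^bsub>N\<^esub>, m)) \<in> carrier (E d)"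
          using h(1) by (auto simp: module_iso_def module_hom_def)
        then obtain n m' where nm: "n \<in> carrier N" "h (prod_encode (\<zero>\<^bsub>N\<^esub>, m)) = prod_encode (n, m')"
          by (auto simp: car)
        then have "m' = m" using h(3)[OF c] by (simp add: g_def)
        then show ?thesis using nm by blast
      qed
      then obtain \<psi> where \<psi>: "\<And>m. m \<in> carrier M \<Longrightarrow> \<psi> m \<in> carrier N"
        "\<And>m. m \<in> carrier M \<Longrightarrow> h (prod_encode (\<zero>\<^bsub>N\<^esub>, m)) = prod_encode (\<psi> m, m)" by metis
      have "a \<odot>\<^bsub>N\<^esub> \<psi> m \<oplus>\<^bsub>N\<^esub> d (a, m) = e (a, m) \<oplus>\<^bsub>N\<^esub> \<psi> (a \<odot>\<^bsub>M\<^esub> m)"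
        if am: "a \<in> carrier A" "m \<in> carrier M" for a m
      proof -
        have ev: "e (a, m) \<in> carrier N" using e am by (auto simp: ders_def)
        have c: "prod_encode (\<zero>\<^bsub>N\<^esub>, m) \<in> carrier (E e)" "f (e (a, m)) \<in> carrier (E e)"
          "prod_encode (\<zero>\<^bsub>N\<^esub>, a \<odot>\<^bsub>M\<^esub> m) \<in> carrier (E e)" using am ev by (auto simp: car f_def)
        have "a \<odot>\<^bsub>E e\<^esub> prod_encode (\<zero>\<^bsub>N\<^esub>, m) = f (e (a, m)) \<oplus>\<^bsub>E e\<^esub> prod_encode (\<zero>\<^bsub>N\<^esub>, a \<odot>\<^bsub>M\<^esub> m)"
          using am ev by (simp add: smult add f_def)
        then have "a \<odot>\<^bsub>E d\<^esub> h (prod_encode (\<zero>\<^bsub>N\<^esub>, m)) = f (e (a, m)) \<oplus>\<^bsub>E d\<^esub> h (prod_encode (\<zero>\<^bsub>N\<^esub>, a \<odot>\<^bsub>M\<^esub> m))"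
          using hadd[OF c(2,3)] hsmult[OF am(1) c(1)] h(2)[OF ev] by simp
        then show ?thesis
          using \<psi> am ev by (simp add: smult add f_def)
      qed
      then show ?thesis
        using \<psi>(1) by (intro bexI[of _ "restrict \<psi> (carrier M)"]) auto
    qed
    then obtain \<Phi> where \<Phi>: "\<And>d. \<lbrakk>d \<in> ders A M N; cls d = cls e\<rbrakk> \<Longrightarrow> \<Phi> d \<in> carrier M \<rightarrow>\<^sub>E carrier N"
      "\<And>d a m. \<lbrakk>d \<in> ders A M N; cls d = cls e; a \<in> carrier A; m \<in> carrier M\<rbrakk> \<Longrightarrow>
        a \<odot>\<^bsub>N\<^esub> \<Phi> d m \<oplus>\<^bsub>N\<^esub> d (a, m) = e (a, m) \<oplus>\<^bsub>N\<^esub> \<Phi> d (a \<odot>\<^bsub>M\<^esub> m)" by metis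
    show "finite {d \<in> ders A M N. cls d = cls e}"
    proof (rule inj_on_finite)
      show "\<Phi> ` {d \<in> ders A M N. cls d = cls e} \<subseteq> carrier M \<rightarrow>\<^sub>E carrier N" using \<Phi>(1) by blast
      show "finite (carrier M \<rightarrow>\<^sub>E carrier N)" using MN by (intro finite_PiE) auto
      show "inj_on \<Phi> {d \<in> ders A M N. cls d = cls e}"
      proof (rule inj_onI)
        fix d d' assume d: "d \<in> {d \<in> ders A M N. cls d = cls e}" "d' \<in> {d \<in> ders A M N. cls d = cls e}"
          and eq: "\<Phi> d = \<Phi> d'"
        have "d (a, m) = d' (a, m)" if am: "a \<in> carrier A" "m \<in> carrier M" for a m
        proof -
          have "a \<odot>\<^bsub>N\<^esub> \<Phi> d m \<oplus>\<^bsub>N\<^esub> d (a, m) = a \<odot>\<^bsub>N\<^esub> \<Phi> d m \<oplus>\<^bsub>N\<^esub> d' (a, m)"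
            using \<Phi>(2)[of d a m] \<Phi>(2)[of d' a m] d am eq by simp
          moreover have "a \<odot>\<^bsub>N\<^esub> \<Phi> d m \<in> carrier N" "d (a, m) \<in> carrier N" "d' (a, m) \<in> carrier N"
            using \<Phi>(1)[of d] d am by (auto simp: ders_def)
          ultimately show ?thesis by simp
        qed
        then show "d = d'"
          using d by (intro PiE_ext[of d "carrier A \<times> carrier M" "\<lambda>_. carrier N"]) (auto simp: ders_def)
      qed
    qed
  qed
qed

text \<open>The difference of the two actions of \<open>a\<close> at \<open>x\<close> lies in the submodule and depends only on the
  class of \<open>x\<close> in the quotient. Associativity of the two actions turns into the Leibniz rule.\<close>

lemma derivation_difference:
  fixes X Y :: "('a, 'x) module"
  assumes f: "lin_map R N (carrier N) X f" "lin_map R N (carrier N) Y f" "inj_on f (carrier N)"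
    and g: "lin_map R X (carrier X) M g" "lin_map R Y (carrier Y) M g" "g ` carrier X = carrier M"
    and exact: "f ` carrier N = ker_of X M g"
    and car: "carrier Y = carrier X"
    and add: "\<And>x y. \<lbrakk>x \<in> carrier X; y \<in> carrier X\<rbrakk> \<Longrightarrow> x \<oplus>\<^bsub>Y\<^esub> y = x \<oplus>\<^bsub>X\<^esub> y"
  shows "\<exists>d\<in>ders R M N. \<forall>a\<in>carrier R. \<forall>x\<in>carrier X.
    a \<odot>\<^bsub>X\<^esub> x = f (d (a, g x)) \<oplus>\<^bsub>X\<^esub> a \<odot>\<^bsub>Y\<^esub> x"
proof -
  interpret f: lin_map R N "carrier N" X f by fact
  interpret fY: lin_map R N "carrier N" Y f by fact
  interpret g: lin_map R X "carrier X" M g by fact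
  interpret gY: lin_map R Y "carrier Y" M g by fact
  have Yc: "a \<odot>\<^bsub>Y\<^esub> x \<in> carrier X" if "a \<in> carrier R" "x \<in> carrier X" for a x
    using fY.N.smult_in[of a x] that car by simp
  have coset: "\<exists>n\<in>carrier N. x = f n \<oplus>\<^bsub>X\<^esub> y" if "x \<in> carrier X" "y \<in> carrier X" "g x = g y" for x y
  proof -
    have "x \<ominus>\<^bsub>X\<^esub> y \<in> f ` carrier N" using that g.map_eq_iff_minus by (simp add: exact ker_of_def)
    then obtain n where "n \<in> carrier N" "x \<ominus>\<^bsub>X\<^esub> y = f n" by blast
    then show ?thesis using that f.N.minus_add_cancel[of x y] by metis
  qed
  have cancel: "n = n'" if "n \<in> carrier N" "n' \<in> carrier N" "y \<in> carrier X" "f n \<oplus>\<^bsub>X\<^esub> y = f n' \<oplus>\<^bsub>X\<^esub> y" for n n' y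
    using that inj_onD[OF f(3)] by simp
  define s where "s = inv_into (carrier X) g"
  have s: "s m \<in> carrier X" "g (s m) = m" if "m \<in> carrier M" for m
    using that g(3) f_inv_into_f[of m g "carrier X"] inv_into_into[of m g "carrier X"] by (auto simp: s_def)
  \<comment> \<open>Both actions agree on the quotient, so their difference at \<open>s m\<close> lies in the submodule; they
    agree on the submodule, so it depends on \<open>m\<close> only.\<close>
  have "\<exists>n\<in>carrier N. a \<odot>\<^bsub>X\<^esub> s m = f n \<oplus>\<^bsub>X\<^esub> a \<odot>\<^bsub>Y\<^esub> s m" if "a \<in> carrier R" "m \<in> carrier M" for a m
    using that s Yc g.map_smult[of a "s m"] gY.map_smult[of a "s m"] car by (intro coset) auto
  then obtain \<delta> where \<delta>: "\<And>a m. \<lbrakk>a \<in> carrier R; m \<in> carrier M\<rbrakk> \<Longrightarrow> \<delta> a m \<in> carrier N"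
    "\<And>a m. \<lbrakk>a \<in> carrier R; m \<in> carrier M\<rbrakk> \<Longrightarrow> a \<odot>\<^bsub>X\<^esub> s m = f (\<delta> a m) \<oplus>\<^bsub>X\<^esub> a \<odot>\<^bsub>Y\<^esub> s m" by metis
  have key: "a \<odot>\<^bsub>X\<^esub> x = f (\<delta> a (g x)) \<oplus>\<^bsub>X\<^esub> a \<odot>\<^bsub>Y\<^esub> x" if ax: "a \<in> carrier R" "x \<in> carrier X" for a x
  proof -
    let ?m = "g x"
    have m: "?m \<in> carrier M" using ax by simp
    obtain n where n: "n \<in> carrier N" "x = f n \<oplus>\<^bsub>X\<^esub> s ?m" using coset[of x "s ?m"] ax m s by auto
    have "a \<odot>\<^bsub>X\<^esub> x = a \<odot>\<^bsub>X\<^esub> f n \<oplus>\<^bsub>X\<^esub> a \<odot>\<^bsub>X\<^esub> s ?m"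
      unfolding n(2)[symmetric] using ax n m s f.N.smult_r_distr[of a "f n" "s ?m"] by simp
    also have "\<dots> = f (a \<odot>\<^bsub>N\<^esub> n) \<oplus>\<^bsub>X\<^esub> (f (\<delta> a ?m) \<oplus>\<^bsub>X\<^esub> a \<odot>\<^bsub>Y\<^esub> s ?m)"
      using \<delta>(2)[OF ax(1) m] f.map_smult[OF ax(1) n(1)] by simp
    also have "\<dots> = f (\<delta> a ?m) \<oplus>\<^bsub>X\<^esub> (f (a \<odot>\<^bsub>N\<^esub> n) \<oplus>\<^bsub>X\<^esub> a \<odot>\<^bsub>Y\<^esub> s ?m)"
      using ax n m s Yc \<delta>(1) by (intro f.N.M.a_lcomm) auto
    also have "f (a \<odot>\<^bsub>N\<^esub> n) \<oplus>\<^bsub>X\<^esub> a \<odot>\<^bsub>Y\<^esub> s ?m = a \<odot>\<^bsub>Y\<^esub> x"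
    proof -
      have "f (a \<odot>\<^bsub>N\<^esub> n) \<oplus>\<^bsub>X\<^esub> a \<odot>\<^bsub>Y\<^esub> s ?m = a \<odot>\<^bsub>Y\<^esub> f n \<oplus>\<^bsub>Y\<^esub> a \<odot>\<^bsub>Y\<^esub> s ?m"
        using add Yc ax n m s fY.map_smult[OF ax(1) n(1)] f.map_in[OF n(1)] by simp
      also have "\<dots> = a \<odot>\<^bsub>Y\<^esub> (f n \<oplus>\<^bsub>Y\<^esub> s ?m)"
        using ax n m s car f.map_in[OF n(1)] fY.N.smult_r_distr[of a "f n" "s ?m"] by simp
      also have "f n \<oplus>\<^bsub>Y\<^esub> s ?m = x" using add n m s by simp
      finally show ?thesis .
    qed
    finally show ?thesis .
  qed
  have uniq: "\<delta> a (g x) = n" if "a \<in> carrier R" "x \<in> carrier X" "n \<in> carrier N" "a \<odot>\<^bsub>X\<^esub> x = f n \<oplus>\<^bsub>X\<^esub> a \<odot>\<^bsub>Y\<^esub> x" for a x n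
    using cancel[of "\<delta> a (g x)" n "a \<odot>\<^bsub>Y\<^esub> x"] key that \<delta>(1) Yc by simp
  have "is_der R M N \<delta>"
    unfolding is_der_def
  proof (intro conjI ballI)
    fix a m assume "a \<in> carrier R" "m \<in> carrier M"
    then show "\<delta> a m \<in> carrier N" by (rule \<delta>(1))
  next
    fix a m m' assume am: "a \<in> carrier R" "m \<in> carrier M" "m' \<in> carrier M"
    note c = s(1)[OF am(2)] s(1)[OF am(3)] \<delta>(1)[OF am(1,2)] \<delta>(1)[OF am(1,3)]
    have "a \<odot>\<^bsub>X\<^esub> (s m \<oplus>\<^bsub>X\<^esub> s m') = (f (\<delta> a m) \<oplus>\<^bsub>X\<^esub> a \<odot>\<^bsub>Y\<^esub> s m) \<oplus>\<^bsub>X\<^esub> (f (\<delta> a m') \<oplus>\<^bsub>X\<^esub> a \<odot>\<^bsub>Y\<^esub> s m')"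
      using am c f.N.smult_r_distr[of a "s m" "s m'"] \<delta>(2) by simp
    also have "\<dots> = (f (\<delta> a m) \<oplus>\<^bsub>X\<^esub> f (\<delta> a m')) \<oplus>\<^bsub>X\<^esub> (a \<odot>\<^bsub>Y\<^esub> s m \<oplus>\<^bsub>X\<^esub> a \<odot>\<^bsub>Y\<^esub> s m')"
      using am c Yc by (intro f.N.add_swap_middle) auto
    also have "a \<odot>\<^bsub>Y\<^esub> s m \<oplus>\<^bsub>X\<^esub> a \<odot>\<^bsub>Y\<^esub> s m' = a \<odot>\<^bsub>Y\<^esub> (s m \<oplus>\<^bsub>X\<^esub> s m')"
      using am c Yc add car fY.N.smult_r_distr[of a "s m" "s m'"] by simp
    also have "f (\<delta> a m) \<oplus>\<^bsub>X\<^esub> f (\<delta> a m') = f (\<delta> a m \<oplus>\<^bsub>N\<^esub> \<delta> a m')" using c by (simp add: f.map_add)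
    finally have "\<delta> a (g (s m \<oplus>\<^bsub>X\<^esub> s m')) = \<delta> a m \<oplus>\<^bsub>N\<^esub> \<delta> a m'" using am c by (intro uniq) auto
    then show "\<delta> a (m \<oplus>\<^bsub>M\<^esub> m') = \<delta> a m \<oplus>\<^bsub>N\<^esub> \<delta> a m'" using am s by (simp add: g.map_add)
  next
    fix a b m assume am: "a \<in> carrier R" "b \<in> carrier R" "m \<in> carrier M"
    note c = s(1)[OF am(3)] \<delta>(1)[OF am(1,3)] \<delta>(1)[OF am(2,3)]
    have "(a \<oplus>\<^bsub>R\<^esub> b) \<odot>\<^bsub>X\<^esub> s m = (f (\<delta> a m) \<oplus>\<^bsub>X\<^esub> a \<odot>\<^bsub>Y\<^esub> s m) \<oplus>\<^bsub>X\<^esub> (f (\<delta> b m) \<oplus>\<^bsub>X\<^esub> b \<odot>\<^bsub>Y\<^esub> s m)"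
      using am c f.N.smult_l_distr[of a b "s m"] \<delta>(2) by simp
    also have "\<dots> = (f (\<delta> a m) \<oplus>\<^bsub>X\<^esub> f (\<delta> b m)) \<oplus>\<^bsub>X\<^esub> (a \<odot>\<^bsub>Y\<^esub> s m \<oplus>\<^bsub>X\<^esub> b \<odot>\<^bsub>Y\<^esub> s m)"
      using am c Yc by (intro f.N.add_swap_middle) auto
    also have "a \<odot>\<^bsub>Y\<^esub> s m \<oplus>\<^bsub>X\<^esub> b \<odot>\<^bsub>Y\<^esub> s m = (a \<oplus>\<^bsub>R\<^esub> b) \<odot>\<^bsub>Y\<^esub> s m"
      using am c Yc add car fY.N.smult_l_distr[of a b "s m"] by simp
    also have "f (\<delta> a m) \<oplus>\<^bsub>X\<^esub> f (\<delta> b m) = f (\<delta> a m \<oplus>\<^bsub>N\<^esub> \<delta> b m)" using c by (simp add: f.map_add)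
    finally have "\<delta> (a \<oplus>\<^bsub>R\<^esub> b) (g (s m)) = \<delta> a m \<oplus>\<^bsub>N\<^esub> \<delta> b m" using am c by (intro uniq) auto
    then show "\<delta> (a \<oplus>\<^bsub>R\<^esub> b) m = \<delta> a m \<oplus>\<^bsub>N\<^esub> \<delta> b m" using am s by simp
  next
    fix a b m assume am: "a \<in> carrier R" "b \<in> carrier R" "m \<in> carrier M"
    note c = s(1)[OF am(3)] \<delta>(1)[OF am(1,3)] \<delta>(1)[OF am(2,3)]
    have bm: "b \<odot>\<^bsub>M\<^esub> m \<in> carrier M" using am by simp
    have bs: "b \<odot>\<^bsub>Y\<^esub> s m \<in> carrier X" using Yc am c by simp
    have gb: "g (b \<odot>\<^bsub>Y\<^esub> s m) = b \<odot>\<^bsub>M\<^esub> m" using gY.map_smult[of b "s m"] am c car s by simp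
    have "(a \<otimes>\<^bsub>R\<^esub> b) \<odot>\<^bsub>X\<^esub> s m = a \<odot>\<^bsub>X\<^esub> (f (\<delta> b m) \<oplus>\<^bsub>X\<^esub> b \<odot>\<^bsub>Y\<^esub> s m)"
      using am c f.N.smult_assoc1[of a b "s m"] \<delta>(2) by simp
    also have "\<dots> = f (a \<odot>\<^bsub>N\<^esub> \<delta> b m) \<oplus>\<^bsub>X\<^esub> a \<odot>\<^bsub>X\<^esub> (b \<odot>\<^bsub>Y\<^esub> s m)"
      using am c bs f.N.smult_r_distr[of a "f (\<delta> b m)" "b \<odot>\<^bsub>Y\<^esub> s m"] f.map_smult[of a "\<delta> b m"] by simp
    also have "a \<odot>\<^bsub>X\<^esub> (b \<odot>\<^bsub>Y\<^esub> s m) = f (\<delta> a (b \<odot>\<^bsub>M\<^esub> m)) \<oplus>\<^bsub>X\<^esub> a \<odot>\<^bsub>Y\<^esub> (b \<odot>\<^bsub>Y\<^esub> s m)"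
      using key[OF am(1) bs] gb by simp
    also have "a \<odot>\<^bsub>Y\<^esub> (b \<odot>\<^bsub>Y\<^esub> s m) = (a \<otimes>\<^bsub>R\<^esub> b) \<odot>\<^bsub>Y\<^esub> s m"
      using am c car fY.N.smult_assoc1[of a b "s m"] by simp
    also have "f (a \<odot>\<^bsub>N\<^esub> \<delta> b m) \<oplus>\<^bsub>X\<^esub> (f (\<delta> a (b \<odot>\<^bsub>M\<^esub> m)) \<oplus>\<^bsub>X\<^esub> (a \<otimes>\<^bsub>R\<^esub> b) \<odot>\<^bsub>Y\<^esub> s m) =
        f (a \<odot>\<^bsub>N\<^esub> \<delta> b m \<oplus>\<^bsub>N\<^esub> \<delta> a (b \<odot>\<^bsub>M\<^esub> m)) \<oplus>\<^bsub>X\<^esub> (a \<otimes>\<^bsub>R\<^esub> b) \<odot>\<^bsub>Y\<^esub> s m"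
      using am c bm \<delta>(1) Yc[of "a \<otimes>\<^bsub>R\<^esub> b" "s m"] by (simp add: f.map_add f.N.M.a_assoc)
    finally have "\<delta> (a \<otimes>\<^bsub>R\<^esub> b) (g (s m)) = a \<odot>\<^bsub>N\<^esub> \<delta> b m \<oplus>\<^bsub>N\<^esub> \<delta> a (b \<odot>\<^bsub>M\<^esub> m)"
      using am c bm \<delta>(1) by (intro uniq) auto
    then show "\<delta> (a \<otimes>\<^bsub>R\<^esub> b) m = a \<odot>\<^bsub>N\<^esub> \<delta> b m \<oplus>\<^bsub>N\<^esub> \<delta> a (b \<odot>\<^bsub>M\<^esub> m)" using am s by simp
  qed
  then have "(\<lambda>(a, x)\<in>carrier R \<times> carrier M. \<delta> a x) \<in> ders R M N"
    by (rule restrict_der[OF g.N.left_module_axioms])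
  then show ?thesis
    using key by (intro bexI[of _ "\<lambda>(a, x)\<in>carrier R \<times> carrier M. \<delta> a x"]) auto
qed

definition extension_of :: "('a, 'r) ring_scheme \<Rightarrow> ('a, nat) module \<Rightarrow> ('a, nat) module \<Rightarrow> ('a, nat) module \<Rightarrow> bool" where
  "extension_of R X M N \<longleftrightarrow> (\<exists>g. epi R X M g \<and> isomorphic R (sub_module X (ker_of X M g)) N)"

text \<open>A section of the quotient map gives coordinates in \<open>N \<times> M\<close>. All extensions then live on the
  same finite set, with the same maps \<open>n \<mapsto> (n, 0)\<close> and \<open>(n, m) \<mapsto> m\<close>.\<close>

lemma extension_normal_form:
  fixes X M N :: "('a, nat) module"
  assumes "X \<in> finite_modules R" "N \<in> finite_modules R" "extension_of R X M N"
  defines "f \<equiv> \<lambda>n. prod_encode (n, \<zero>\<^bsub>M\<^esub>)" and "g \<equiv> \<lambda>e. snd (prod_decode e)"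
  shows "\<exists>Y :: ('a, nat) module. isomorphic R X Y \<and> left_module R Y \<and>
    carrier Y = prod_encode ` (carrier N \<times> carrier M) \<and>
    lin_map R N (carrier N) Y f \<and> lin_map R Y (carrier Y) M g"
proof -
  obtain p where p: "epi R X M p" "isomorphic R (sub_module X (ker_of X M p)) N"
    using assms(3) unfolding extension_of_def by blast
  interpret p: lin_map R X "carrier X" M p using p by (simp add: epi_def)
  have pX: "p ` carrier X = carrier M" using p by (simp add: epi_def)
  interpret N: lmod R N using assms(2) by (intro lmod.intro) simp
  define U where "U = ker_of X M p"
  have sU: "submodule U R X" unfolding U_def by (rule ker_of_submodule[OF p(1)])
  note Uc = p.M.submodule_carr[OF sU]
  obtain j where j: "j \<in> module_iso R (sub_module X U) N" using p(2) unfolding isomorphic_def U_def by blast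
  have jm: "lin_map R (sub_module X U) U N j" "inj_on j U" "j ` U = carrier N"
    using module_iso_lin_map[OF p.M.sub_module_left_module[OF sU] N.left_module_axioms j] by simp_all
  interpret j: lin_map R "sub_module X U" U N j by (rule jm(1))
  have Uker: "x \<in> U \<longleftrightarrow> p x = \<zero>\<^bsub>M\<^esub>" if "x \<in> carrier X" for x using that by (simp add: U_def ker_of_def)
  \<comment> \<open>A section with \<open>s 0 = 0\<close>, so that the submodule corresponds to \<open>N \<times> {0}\<close>.\<close>
  define s where "s = (\<lambda>m. if m = \<zero>\<^bsub>M\<^esub> then \<zero>\<^bsub>X\<^esub> else inv_into (carrier X) p m)"
  have s: "s m \<in> carrier X" "p (s m) = m" if "m \<in> carrier M" for m
    using that pX f_inv_into_f[of m p "carrier X"] inv_into_into[of m p "carrier X"] by (auto simp: s_def)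
  have r: "x \<ominus>\<^bsub>X\<^esub> s (p x) \<in> U" if "x \<in> carrier X" for x
    using that s Uker by (simp add: p.map_minus)
  define k where "k = (\<lambda>x. prod_encode (j (x \<ominus>\<^bsub>X\<^esub> s (p x)), p x))"
  have inj: "inj_on k (carrier X)"
  proof (rule inj_onI)
    fix x y assume x: "x \<in> carrier X" "y \<in> carrier X" "k x = k y"
    then have eq: "p x = p y" "j (x \<ominus>\<^bsub>X\<^esub> s (p x)) = j (y \<ominus>\<^bsub>X\<^esub> s (p y))" by (auto simp: k_def)
    then have "x \<ominus>\<^bsub>X\<^esub> s (p x) = y \<ominus>\<^bsub>X\<^esub> s (p x)" 
      using inj_onD[OF jm(2) eq(2) r[OF x(1)] r[OF x(2)]] by simp
    then have "x \<ominus>\<^bsub>X\<^esub> s (p x) \<oplus>\<^bsub>X\<^esub> s (p x) = y \<ominus>\<^bsub>X\<^esub> s (p x) \<oplus>\<^bsub>X\<^esub> s (p x)" by simp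
    then show "x = y" using x s by simp
  qed
  have im: "k ` carrier X = prod_encode ` (carrier N \<times> carrier M)"
  proof
    show "k ` carrier X \<subseteq> prod_encode ` (carrier N \<times> carrier M)"
    proof (rule image_subsetI)
      fix x assume x: "x \<in> carrier X"
      show "k x \<in> prod_encode ` (carrier N \<times> carrier M)"
        unfolding k_def using j.map_in[OF r[OF x]] p.map_in[OF x] by blast
    qed
    show "prod_encode ` (carrier N \<times> carrier M) \<subseteq> k ` carrier X"
    proof (rule image_subsetI, elim SigmaE)
      fix z n m assume z: "z = (n, m)" "n \<in> carrier N" "m \<in> carrier M"
      then obtain u where u: "u \<in> U" "n = j u" using jm(3) by blast
      have uc: "u \<in> carrier X" and sc: "s m \<in> carrier X" using Uc u s z by auto
      have pm: "p (u \<oplus>\<^bsub>X\<^esub> s m) = m" using uc sc s z u Uker by (simp add: p.map_add)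
      have "u \<oplus>\<^bsub>X\<^esub> s m \<ominus>\<^bsub>X\<^esub> s m = u" using uc sc by (simp add: a_minus_def p.M.M.a_assoc p.M.M.r_neg)
      then have "k (u \<oplus>\<^bsub>X\<^esub> s m) = prod_encode z" by (simp add: k_def pm u(2) z(1))
      then show "prod_encode z \<in> k ` carrier X" using uc sc by (metis imageI p.M.M.a_closed)
    qed
  qed
  define Y where "Y = transport k X"
  interpret k: lin_map R X "carrier X" Y k unfolding Y_def by (rule p.M.transport_lin_map[OF inj])
  have carY: "carrier Y = k ` carrier X" by (simp add: Y_def transport_simps)
  have "isomorphic R X Y" using p.M.transport_iso[OF inj] unfolding Y_def isomorphic_def by blast
  moreover have "lin_map R N (carrier N) Y f"
  proof -
    interpret i: lin_map R N "j ` U" "sub_module X U" "inv_into U j" by (rule j.inverse_lin_map[OF jm(2)])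
    have fk: "f n = k (inv_into U j n)" if "n \<in> carrier N" for n
    proof -
      define u where "u = inv_into U j n"
      have u: "u \<in> U" "j u = n" using that jm(3) by (auto simp: u_def inv_into_into f_inv_into_f)
      then have "p u = \<zero>\<^bsub>M\<^esub>" using Uker Uc by blast
      moreover have "u \<ominus>\<^bsub>X\<^esub> \<zero>\<^bsub>X\<^esub> = u" using p.M.minus_add_cancel[OF Uc[OF u(1)] p.M.M.zero_closed] Uc[OF u(1)] by simp
      ultimately show ?thesis using u by (simp add: f_def k_def u_def[symmetric] s_def)
    qed
    have "lin_on R N (carrier N) X (inv_into U j)"
      using i.lin jm(3) Uc by (auto simp: lin_on_def)
    then have "lin_on R N (carrier N) Y (\<lambda>n. k (inv_into U j n))"
      by (rule lin_on_compose[OF _ k.lin]) (use i.map_in jm(3) Uc in auto)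
    then have "lin_on R N (carrier N) Y f" using fk by (simp add: lin_on_def Pi_iff)
    then show ?thesis using N.lmod_axioms k.N.lmod_axioms by (intro lin_map.intro lin_map_axioms.intro) auto
  qed
  moreover have "lin_map R Y (carrier Y) M g"
  proof -
    have gk: "g (k x) = p x" for x by (simp add: g_def k_def)
    have "lin_on R Y (carrier Y) M g"
      unfolding carY Y_def
      by (auto simp: lin_on_def gk transport_simps inj p.map_add p.map_smult)
    then show ?thesis using k.N.lmod_axioms p.N.lmod_axioms by (intro lin_map.intro lin_map_axioms.intro) auto
  qed
  ultimately show ?thesis using k.N.left_module_axioms carY im by auto
qed

text \<open>Only finitely many isomorphism classes occur: there are finitely many addition tables on
  \<open>N \<times> M\<close>, and for each of them the possible actions form a torsor under the derivations.\<close>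

lemma finite_extension_classes:
  fixes M N :: "('a, nat) module"
  assumes M: "M \<in> finite_modules R" and N: "N \<in> finite_modules R" and fin: "finite (ders R M N)"
  shows "\<exists>\<Y> :: ('a, nat) module set. finite \<Y> \<and> (\<forall>Y\<in>\<Y>. left_module R Y) \<and>
    (\<forall>X\<in>finite_modules R. extension_of R X M N \<longrightarrow> (\<exists>Y\<in>\<Y>. isomorphic R X Y))"
proof -
  interpret M: lmod R M using M by (intro lmod.intro) simp
  interpret N: lmod R N using N by (intro lmod.intro) simp
  define f where "f = (\<lambda>n. prod_encode (n, \<zero>\<^bsub>M\<^esub>))"
  define g where "g = (\<lambda>e. snd (prod_decode e))"
  define C where "C = prod_encode ` (carrier N \<times> carrier M)"
  define S :: "('a, nat) module set" where
    "S = {Y. left_module R Y \<and> carrier Y = C \<and> lin_map R N (carrier N) Y f \<and> lin_map R Y (carrier Y) M g}"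
  define table where "table = (\<lambda>Y :: ('a, nat) module. \<lambda>(x, y)\<in>C \<times> C. x \<oplus>\<^bsub>Y\<^esub> y)"
  \<comment> \<open>For each addition table one module with this table serves as the origin of the torsor.\<close>
  define base where "base = (\<lambda>t. SOME Y. Y \<in> S \<and> table Y = t)"
  have finC: "finite C" using M N by (simp add: C_def)
  have base: "base (table Y) \<in> S" "table (base (table Y)) = table Y" if "Y \<in> S" for Y
    using someI[of "\<lambda>Z. Z \<in> S \<and> table Z = table Y" Y] that by (auto simp: base_def)
  have tabD: "x \<oplus>\<^bsub>Y\<^esub> y = x \<oplus>\<^bsub>Z\<^esub> y" if "table Y = table Z" "x \<in> C" "y \<in> C" for Y Z x y
    using fun_cong[OF that(1), of "(x, y)"] that by (simp add: table_def)
  have inj: "inj_on f (carrier N)" by (auto simp: f_def inj_on_def)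
  have "\<exists>d\<in>ders R M N. \<forall>a\<in>carrier R. \<forall>x\<in>C. a \<odot>\<^bsub>Y\<^esub> x = f (d (a, g x)) \<oplus>\<^bsub>Y\<^esub> a \<odot>\<^bsub>base (table Y)\<^esub> x"
    if Y: "Y \<in> S" for Y
  proof -
    have car: "carrier Y = C" "carrier (base (table Y)) = C" using Y base[OF Y] by (auto simp: S_def)
    have "g ` C = carrier M" by (auto simp: C_def g_def image_iff) (use N.M.zero_closed in blast)
    moreover have "f ` carrier N = ker_of Y M g" by (auto simp: f_def g_def ker_of_def car C_def)
    ultimately show ?thesis
      using derivation_difference[of R N Y f "base (table Y)" M g] Y base[OF Y] car inj tabD[OF base(2)[OF Y]]
      by (auto simp: S_def)
  qed
  then obtain \<delta> where \<delta>: "\<And>Y. Y \<in> S \<Longrightarrow> \<delta> Y \<in> ders R M N"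
    "\<And>Y a x. \<lbrakk>Y \<in> S; a \<in> carrier R; x \<in> C\<rbrakk> \<Longrightarrow> a \<odot>\<^bsub>Y\<^esub> x = f (\<delta> Y (a, g x)) \<oplus>\<^bsub>Y\<^esub> a \<odot>\<^bsub>base (table Y)\<^esub> x"
    by metis
  define key where "key = (\<lambda>Y. (table Y, \<delta> Y))"
  have "table Y \<in> C \<times> C \<rightarrow>\<^sub>E C" if "Y \<in> S" for Y
  proof -
    interpret Y: lmod R Y using that by (intro lmod.intro) (simp add: S_def)
    have "carrier Y = C" using that by (simp add: S_def)
    then show ?thesis using Y.M.a_closed by (auto simp: table_def)
  qed
  then have "key ` S \<subseteq> (C \<times> C \<rightarrow>\<^sub>E C) \<times> ders R M N" using \<delta>(1) by (auto simp: key_def)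
  moreover have "finite ((C \<times> C \<rightarrow>\<^sub>E C) \<times> ders R M N)" using finC fin by (intro finite_cartesian_product finite_PiE) auto
  ultimately have finkey: "finite (key ` S)" using finite_subset by blast
  have same: "isomorphic R Y Z" if YZ: "Y \<in> S" "Z \<in> S" "key Y = key Z" for Y Z
  proof -
    have t: "table Y = table Z" "\<delta> Y = \<delta> Z" using YZ by (auto simp: key_def)
    have car: "carrier Y = C" "carrier Z = C" using YZ by (auto simp: S_def)
    interpret Y: lmod R Y using YZ by (intro lmod.intro) (simp add: S_def)
    interpret B: lmod R "base (table Y)" using base(1)[OF YZ(1)] by (intro lmod.intro) (simp add: S_def)
    have carB: "carrier (base (table Y)) = C" using base(1)[OF YZ(1)] by (simp add: S_def)
    have "a \<odot>\<^bsub>Y\<^esub> x = a \<odot>\<^bsub>Z\<^esub> x" if ax: "a \<in> carrier R" "x \<in> C" for a x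
    proof -
      have "g x \<in> carrier M" using ax by (auto simp: C_def g_def)
      then have "\<delta> Y (a, g x) \<in> carrier N" using \<delta>(1)[OF YZ(1)] ax by (auto simp: ders_def)
      then have "f (\<delta> Y (a, g x)) \<in> C" by (simp add: f_def C_def)
      moreover have "a \<odot>\<^bsub>base (table Y)\<^esub> x \<in> C" using B.smult_in[of a x] ax carB by simp
      ultimately show ?thesis using \<delta>(2)[OF YZ(1) ax] \<delta>(2)[OF YZ(2) ax] tabD[OF t(1)] t by simp
    qed
    then have "(\<lambda>x. x) \<in> module_iso R Y Z"
      using tabD[OF t(1)] car by (auto simp: module_iso_def module_hom_def bij_betw_def)
    then show ?thesis unfolding isomorphic_def by blast
  qed
  define \<Y> where "\<Y> = (\<lambda>k. SOME Y. Y \<in> S \<and> key Y = k) ` (key ` S)"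
  have "\<exists>Y\<in>\<Y>. isomorphic R X Y" if X: "X \<in> finite_modules R" "extension_of R X M N" for X
  proof -
    obtain Y where Y: "isomorphic R X Y" "Y \<in> S"
      using extension_normal_form[OF X(1) N X(2)] unfolding S_def C_def f_def g_def by auto
    define Z where "Z = (SOME Z. Z \<in> S \<and> key Z = key Y)"
    have "Z \<in> S \<and> key Z = key Y" unfolding Z_def by (rule someI[of _ Y]) (use Y in simp)
    then have "isomorphic R Y Z" using same[of Y Z] Y by simp
    moreover have "Z \<in> \<Y>" unfolding \<Y>_def Z_def using Y(2) by blast
    ultimately show ?thesis using isomorphic_trans[OF Y(1)] by blast
  qed
  moreover have "left_module R Y" if Y: "Y \<in> \<Y>" for Y
  proof -
    obtain Z where "Z \<in> S" "Y = (SOME Y. Y \<in> S \<and> key Y = key Z)" using Y unfolding \<Y>_def by blast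
    then have "Y \<in> S" using someI[of "\<lambda>Y. Y \<in> S \<and> key Y = key Z" Z] by simp
    then show ?thesis by (simp add: S_def)
  qed
  moreover have "finite \<Y>" unfolding \<Y>_def using finkey by simp
  ultimately show ?thesis by blast
qed

section \<open>Finite dimensional modules are the finite ones\<close>

lemma restrict_scalars_left_module:
  assumes "k_algebra K A" "left_module A M"
  shows "left_module K (restrict_scalars A M)"
proof -
  interpret M: lmod A M by (intro lmod.intro assms(2))
  interpret K: field K using assms(1) by (simp add: k_algebra_def)
  interpret A: module K A using assms(1) by (simp add: k_algebra_def)
  let ?e = "\<lambda>c. c \<odot>\<^bsub>A\<^esub> \<one>\<^bsub>A\<^esub>"
  have eq: "?e c \<otimes>\<^bsub>A\<^esub> ?e d = ?e (c \<otimes>\<^bsub>K\<^esub> d)" if "c \<in> carrier K" "d \<in> carrier K" for c d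
  proof -
    have "?e c \<otimes>\<^bsub>A\<^esub> ?e d = c \<odot>\<^bsub>A\<^esub> (\<one>\<^bsub>A\<^esub> \<otimes>\<^bsub>A\<^esub> ?e d)"
      using assms(1) that M.R.one_closed A.smult_closed[OF that(2) M.R.one_closed]
      unfolding k_algebra_def by blast
    also have "\<dots> = ?e (c \<otimes>\<^bsub>K\<^esub> d)"
      using that A.smult_closed[OF that(2) M.R.one_closed] by (simp add: A.smult_assoc1)
    finally show ?thesis .
  qed
  have [simp]: "?e c \<in> carrier A" if "c \<in> carrier K" for c using that by (simp add: A.smult_closed)
  have "abelian_group (restrict_scalars A M)"
  proof (rule abelian_groupI)
    fix x assume "x \<in> carrier (restrict_scalars A M)"
    then show "\<exists>y\<in>carrier (restrict_scalars A M).
        y \<oplus>\<^bsub>restrict_scalars A M\<^esub> x = \<zero>\<^bsub>restrict_scalars A M\<^esub>"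
      by (intro bexI[of _ "\<ominus>\<^bsub>M\<^esub> x"]) (auto simp: restrict_scalars_def M.M.l_neg)
  qed (auto simp: restrict_scalars_def M.M.a_assoc intro: M.M.a_comm)
  then show ?thesis
    unfolding left_module_def left_module_axioms_def
    using K.ring_axioms eq
    by (auto simp: restrict_scalars_def M.smult_r_distr M.smult_l_distr[symmetric] A.smult_l_distr
        M.smult_assoc1[symmetric] M.smult_one)
qed

lemma (in lmod) finite_submodule_spanned:
  assumes "finite (carrier R)" "finite B" "B \<subseteq> carrier M"
  shows "\<exists>W. finite W \<and> submodule W R M \<and> B \<subseteq> W"
  using assms(2,3)
proof (induction B rule: finite_induct)
  case empty
  then show ?case by (intro exI[of _ "{\<zero>}"]) simp
next
  case (insert b B)
  then obtain W where W: "finite W" "submodule W R M" "B \<subseteq> W" by auto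
  have b: "b \<in> carrier M" using insert.prems by simp
  define L where "L = (\<lambda>c. c \<odot> b) ` carrier R"
  have L: "submodule L R M"
  proof (rule submoduleI)
    show "L \<subseteq> carrier M" using b by (auto simp: L_def)
    show "\<zero> \<in> L" using b zero_smult[OF b] R.zero_closed unfolding L_def by (metis imageI)
    fix x y assume "x \<in> L" "y \<in> L"
    then obtain c d where "c \<in> carrier R" "d \<in> carrier R" "x = c \<odot> b" "y = d \<odot> b" by (auto simp: L_def)
    then show "x \<oplus> y \<in> L" using b by (auto simp: L_def smult_l_distr[symmetric])
  next
    fix a x assume "a \<in> carrier R" "x \<in> L"
    then obtain c where "a \<in> carrier R" "c \<in> carrier R" "x = c \<odot> b" by (auto simp: L_def)
    then show "a \<odot> x \<in> L" using b by (auto simp: L_def smult_assoc1[symmetric])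
  qed
  have "b \<in> L" using smult_one[OF b] R.one_closed unfolding L_def by (metis imageI)
  moreover have "finite (W <+>\<^bsub>M\<^esub> L)" using W(1) assms(1) by (simp add: set_add_def' L_def)
  ultimately show ?case
    using W L set_add_upper1[OF W(2) L] set_add_upper2[OF W(2) L]
    by (intro exI[of _ "W <+>\<^bsub>M\<^esub> L"]) auto
qed

text \<open>Over a finite field a single element spans finitely many multiples, and generators can be added
  one at a time.\<close>

lemma fd_modules_eq_finite_modules:
  assumes "finite (carrier K)" "k_algebra K A"
  shows "fd_modules K A = finite_modules A"
proof -
  have "finite_dimensional K (restrict_scalars A M) \<longleftrightarrow> finite (carrier M)" if "left_module A M" for M
  proof
    interpret V: lmod K "restrict_scalars A M"
      by (intro lmod.intro restrict_scalars_left_module[OF assms(2) that])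
    have car: "carrier (restrict_scalars A M) = carrier M" by (simp add: restrict_scalars_def)
    show "finite (carrier M)" if "finite_dimensional K (restrict_scalars A M)"
      using that V.finite_submodule_spanned[OF assms(1)] unfolding finite_dimensional_def car by metis
    show "finite_dimensional K (restrict_scalars A M)" if "finite (carrier M)"
      unfolding finite_dimensional_def using that V.submoduleD(1)
      by (intro exI[of _ "carrier M"]) (auto simp: car)
  qed
  then show ?thesis unfolding fd_modules_def by blast
qed

section \<open>Extensions and Hall numbers\<close>

lemma extension_of_isomorphic:
  assumes "extension_of R X M N" "left_module R X'" "left_module R M'"
    and "isomorphic R X' X" "isomorphic R M M'" "isomorphic R N N'"
  shows "extension_of R X' M' N'"
proof -
  obtain g where g: "epi R X M g" "isomorphic R (sub_module X (ker_of X M g)) N"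
    using assms(1) unfolding extension_of_def by blast
  interpret g: lin_map R X "carrier X" M g using g by (simp add: epi_def)
  obtain \<phi> where \<phi>: "\<phi> \<in> module_iso R X' X" using assms(4) unfolding isomorphic_def by blast
  obtain \<psi> where \<psi>: "\<psi> \<in> module_iso R M M'" using assms(5) unfolding isomorphic_def by blast
  note F = module_iso_lin_map[OF assms(2) g.M.left_module_axioms \<phi>]
  note P = module_iso_lin_map[OF g.N.left_module_axioms assms(3) \<psi>]
  interpret f: lin_map R X' "carrier X'" X \<phi> by (rule F(1))
  interpret p: lin_map R M "carrier M" M' \<psi> by (rule P(1))
  define h where "h = (\<lambda>x. \<psi> (g (\<phi> x)))"
  have "lin_on R X' (carrier X') M (\<lambda>x. g (\<phi> x))" by (rule lin_on_compose[OF f.lin g.lin]) auto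
  then have "lin_on R X' (carrier X') M' h" unfolding h_def by (rule lin_on_compose[OF _ p.lin]) auto
  moreover have "h ` carrier X' = carrier M'"
  proof -
    have "h ` carrier X' = \<psi> ` g ` \<phi> ` carrier X'" by (simp only: h_def image_image)
    then show ?thesis using F(3) P(3) g(1) by (simp add: epi_def)
  qed
  ultimately have h: "epi R X' M' h"
    using f.M.lmod_axioms p.N.lmod_axioms by (auto simp: epi_def intro!: lin_map.intro lin_map_axioms.intro)
  have "h x = \<zero>\<^bsub>M'\<^esub> \<longleftrightarrow> g (\<phi> x) = \<zero>\<^bsub>M\<^esub>" if "x \<in> carrier X'" for x
    using p.inj_on_kernel[OF P(2), of "g (\<phi> x)"] that by (auto simp: h_def)
  then have ker: "\<phi> ` ker_of X' M' h = ker_of X M g"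
  proof -
    have "\<phi> ` ker_of X' M' h = \<phi> ` {x \<in> carrier X'. g (\<phi> x) = \<zero>\<^bsub>M\<^esub>}"
      using \<open>\<And>x. x \<in> carrier X' \<Longrightarrow> h x = \<zero>\<^bsub>M'\<^esub> \<longleftrightarrow> g (\<phi> x) = \<zero>\<^bsub>M\<^esub>\<close> unfolding ker_of_def by (metis (lifting))
    also have "\<dots> = {y \<in> \<phi> ` carrier X'. g y = \<zero>\<^bsub>M\<^esub>}" by blast
    finally show ?thesis using F(3) by (simp add: ker_of_def)
  qed
  have sub: "ker_of X' M' h \<subseteq> carrier X'" by (auto simp: ker_of_def)
  have "\<phi> \<in> module_iso R (sub_module X' (ker_of X' M' h)) (sub_module X (ker_of X M g))"
    using inj_on_subset[OF F(2) sub] ker lin_on_subset[OF f.lin sub]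
    by (auto simp: module_iso_def module_hom_def bij_betw_def lin_on_def)
  then have "isomorphic R (sub_module X' (ker_of X' M' h)) (sub_module X (ker_of X M g))"
    unfolding isomorphic_def by blast
  then show ?thesis
    using h isomorphic_trans[OF isomorphic_trans[OF _ g(2)] assms(6)] unfolding extension_of_def by blast
qed

lemma hall_number_nonzero_iff:
  assumes "X \<in> finite_modules R" "M \<in> finite_modules R"
  shows "hall_number R X M N \<noteq> 0 \<longleftrightarrow> extension_of R X M N"
proof -
  interpret X: lmod R X using assms by (intro lmod.intro) simp
  interpret M: lmod R M using assms by (intro lmod.intro) simp
  let ?S = "{U. submodule U R X \<and> isomorphic R (sub_module X U) N \<and> isomorphic R (quot_module X U) M}"
  have "?S \<subseteq> Pow (carrier X)" using X.submoduleD(1) by blast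
  then have "finite ?S" using assms finite_subset by blast
  then have "hall_number R X M N \<noteq> 0 \<longleftrightarrow> ?S \<noteq> {}" by (simp add: hall_number_def)
  also have "\<dots> \<longleftrightarrow> extension_of R X M N"
  proof
    assume "?S \<noteq> {}"
    then obtain U where U: "submodule U R X" "isomorphic R (sub_module X U) N" "isomorphic R (quot_module X U) M"
      by blast
    note Q = X.quot_left_module[OF U(1)]
    obtain \<psi> where \<psi>: "\<psi> \<in> module_iso R (quot_module X U) M" using U(3) unfolding isomorphic_def by blast
    note P = module_iso_lin_map[OF Q M.left_module_axioms \<psi>]
    interpret p: lin_map R "quot_module X U" "carrier (quot_module X U)" M \<psi> by (rule P(1))
    interpret h: lin_map R X "carrier X" "quot_module X U" "\<lambda>x. U +>\<^bsub>X\<^esub> x"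
      using X.quot_epi(1)[OF U(1)] by (simp add: epi_def)
    define g where "g = (\<lambda>x. \<psi> (U +>\<^bsub>X\<^esub> x))"
    have "lin_on R X (carrier X) M g" unfolding g_def by (rule lin_on_compose[OF h.lin p.lin]) auto
    moreover have "g ` carrier X = carrier M"
      using P(3) X.quot_carrier[OF U(1)] by (simp add: g_def image_image)
    ultimately have g: "epi R X M g"
      using X.lmod_axioms M.lmod_axioms by (auto simp: epi_def intro!: lin_map.intro lin_map_axioms.intro)
    have "g x = \<zero>\<^bsub>M\<^esub> \<longleftrightarrow> x \<in> U" if "x \<in> carrier X" for x
      using p.inj_on_kernel[OF P(2) h.map_in[OF that]] X.quot_proj_kernel[OF U(1) that] by (auto simp: g_def)
    then have "ker_of X M g = U" using X.submoduleD(1)[OF U(1)] by (auto simp: ker_of_def)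
    then show "extension_of R X M N" using g U(2) unfolding extension_of_def by blast
  next
    assume "extension_of R X M N"
    then obtain g where g: "epi R X M g" "isomorphic R (sub_module X (ker_of X M g)) N"
      unfolding extension_of_def by blast
    note s = ker_of_submodule[OF g(1)]
    have "isomorphic R (quot_module X (ker_of X M g)) M"
      by (rule isomorphic_sym[OF M.left_module_axioms X.quot_left_module[OF s] epi_quot_isomorphic[OF g(1)]])
    then show "?S \<noteq> {}" using s g(2) by blast
  qed
  finally show ?thesis .
qed

section \<open>The coefficient ring\<close>

lemma hall_coeffsI: "finite I \<Longrightarrow> (\<Sum>i\<in>I. of_int (c i) * hall_v K powi i) \<in> hall_coeffs K"
  unfolding hall_coeffs_def by blast

lemma hall_coeffs_add:
  assumes "x \<in> hall_coeffs K" "y \<in> hall_coeffs K" shows "x + y \<in> hall_coeffs K"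
proof -
  obtain I c where x: "finite I" "x = (\<Sum>i\<in>I. of_int (c i) * hall_v K powi i)"
    using assms(1) unfolding hall_coeffs_def by blast
  obtain J d where y: "finite J" "y = (\<Sum>i\<in>J. of_int (d i) * hall_v K powi i)"
    using assms(2) unfolding hall_coeffs_def by blast
  let ?e = "\<lambda>i. (if i \<in> I then c i else 0) + (if i \<in> J then d i else 0)"
  have "x = (\<Sum>i\<in>I \<union> J. of_int (if i \<in> I then c i else 0) * hall_v K powi i)"
    unfolding x(2) using x(1) y(1) by (intro sum.mono_neutral_cong_left) auto
  moreover have "y = (\<Sum>i\<in>I \<union> J. of_int (if i \<in> J then d i else 0) * hall_v K powi i)"
    unfolding y(2) using x(1) y(1) by (intro sum.mono_neutral_cong_left) auto
  ultimately have "x + y = (\<Sum>i\<in>I \<union> J. of_int (?e i) * hall_v K powi i)"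
    by (simp add: sum.distrib[symmetric] distrib_right)
  then show ?thesis using hall_coeffsI[of "I \<union> J" ?e] x(1) y(1) by simp
qed

lemma hall_coeffs_monomial: "of_int n * hall_v K powi i \<in> hall_coeffs K"
  using hall_coeffsI[of "{i}" "\<lambda>_. n"] by simp

lemma hall_coeffs_of_int: "of_int n \<in> hall_coeffs K"
  using hall_coeffs_monomial[of n K 0] by simp

lemma hall_coeffs_consts: "0 \<in> hall_coeffs K" "1 \<in> hall_coeffs K" "real n \<in> hall_coeffs K"
  using hall_coeffs_of_int[of 0 K] hall_coeffs_of_int[of 1 K] hall_coeffs_of_int[of "int n" K] by simp_all

lemma hall_coeffs_sum: "(\<And>i. i \<in> I \<Longrightarrow> f i \<in> hall_coeffs K) \<Longrightarrow> (\<Sum>i\<in>I. f i) \<in> hall_coeffs K"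
  by (induction I rule: infinite_finite_induct) (auto intro: hall_coeffs_add hall_coeffs_consts)

lemma hall_coeffs_mult:
  assumes v: "hall_v K \<noteq> 0" and "x \<in> hall_coeffs K" "y \<in> hall_coeffs K" shows "x * y \<in> hall_coeffs K"
proof -
  obtain I c where x: "x = (\<Sum>i\<in>I. of_int (c i) * hall_v K powi i)"
    using assms(2) unfolding hall_coeffs_def by blast
  obtain J d where y: "y = (\<Sum>i\<in>J. of_int (d i) * hall_v K powi i)"
    using assms(3) unfolding hall_coeffs_def by blast
  have "(of_int (c i) * hall_v K powi i) * (of_int (d j) * hall_v K powi j) \<in> hall_coeffs K" for i j
    using hall_coeffs_monomial[of "c i * d j" K "i + j"] v by (simp add: power_int_add mult_ac)
  then show ?thesis unfolding x y sum_product by (intro hall_coeffs_sum)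
qed

lemma hall_coeffs_uminus: "x \<in> hall_coeffs K \<Longrightarrow> - x \<in> hall_coeffs K"
proof -
  assume "x \<in> hall_coeffs K"
  then obtain I c where x: "finite I" "x = (\<Sum>i\<in>I. of_int (c i) * hall_v K powi i)"
    unfolding hall_coeffs_def by blast
  have "- x = (\<Sum>i\<in>I. of_int (- c i) * hall_v K powi i)" unfolding x by (simp add: sum_negf)
  then show ?thesis using hall_coeffsI[OF x(1), of "\<lambda>i. - c i" K] by simp
qed

section \<open>Subrings of the Hall algebra\<close>

lemma hall_algebra_simps:
  "f \<in> carrier (hall_algebra K A) \<longleftrightarrow>
     finite {X. f X \<noteq> 0} \<and> {X. f X \<noteq> 0} \<subseteq> iso_classes K A \<and> range f \<subseteq> hall_coeffs K"
  "f \<otimes>\<^bsub>hall_algebra K A\<^esub> g = hall_mult K A f g"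
  "\<zero>\<^bsub>hall_algebra K A\<^esub> = (\<lambda>X. 0)"
  "f \<oplus>\<^bsub>hall_algebra K A\<^esub> g = (\<lambda>X. f X + g X)"
  "c \<odot>\<^bsub>hall_algebra K A\<^esub> f = (\<lambda>X. c * f X)"
  by (simp_all add: hall_algebra_def)

text \<open>The span of the classes in \<open>S\<close>, described by the coefficient functions themselves.\<close>

definition supported :: "'k ring \<Rightarrow> ('a, nat) module set set \<Rightarrow> (('a, nat) module set \<Rightarrow> real) set" where
  "supported K S = {f. finite {X. f X \<noteq> 0} \<and> {X. f X \<noteq> 0} \<subseteq> S \<and> range f \<subseteq> hall_coeffs K}"

lemma supported_add:
  assumes "f \<in> supported K S" "g \<in> supported K S" shows "(\<lambda>X. f X + g X) \<in> supported K S"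
proof -
  have "{X. f X + g X \<noteq> 0} \<subseteq> {X. f X \<noteq> 0} \<union> {X. g X \<noteq> 0}" by auto
  then show ?thesis
    using assms finite_subset[of "{X. f X + g X \<noteq> 0}" "{X. f X \<noteq> 0} \<union> {X. g X \<noteq> 0}"]
    by (auto simp: supported_def image_subset_iff intro!: hall_coeffs_add)
qed

lemma supported_uminus: "f \<in> supported K S \<Longrightarrow> (\<lambda>X. - f X) \<in> supported K S"
  by (auto simp: supported_def image_subset_iff intro!: hall_coeffs_uminus)

lemma supported_zero: "(\<lambda>X. 0) \<in> supported K S"
  by (auto simp: supported_def hall_coeffs_consts)

lemma hall_abelian_group: "abelian_group (hall_algebra K A)"
proof -
  have car: "carrier (hall_algebra K A) = supported K (iso_classes K A)"
    by (simp add: supported_def hall_algebra_def)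
  show ?thesis
  proof (rule abelian_groupI)
    fix f assume "f \<in> carrier (hall_algebra K A)"
    then show "\<exists>g\<in>carrier (hall_algebra K A). g \<oplus>\<^bsub>hall_algebra K A\<^esub> f = \<zero>\<^bsub>hall_algebra K A\<^esub>"
      using supported_uminus[of f K] unfolding car
      by (intro bexI[of _ "\<lambda>X. - f X"]) (auto simp: hall_algebra_simps)
  qed (auto simp: car supported_add supported_zero hall_algebra_simps(2-) add_ac)
qed

lemma hall_finsum:
  assumes "finite F" "F \<subseteq> iso_classes K A" "\<And>C. C \<in> F \<Longrightarrow> c C \<in> hall_coeffs K"
  shows "(\<Oplus>\<^bsub>hall_algebra K A\<^esub>C\<in>F. c C \<odot>\<^bsub>hall_algebra K A\<^esub> hall_basis C) = (\<lambda>X. if X \<in> F then c X else 0)"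
proof -
  interpret abelian_group "hall_algebra K A" by (rule hall_abelian_group)
  have el: "c C \<odot>\<^bsub>hall_algebra K A\<^esub> hall_basis C \<in> carrier (hall_algebra K A)" if "C \<in> F" for C
  proof -
    have sub: "{X. c C * hall_basis C X \<noteq> 0} \<subseteq> {C}" by (auto simp: hall_basis_def)
    then have "finite {X. c C * hall_basis C X \<noteq> 0}" by (rule finite_subset) simp
    moreover have "range (\<lambda>X. c C * hall_basis C X) \<subseteq> hall_coeffs K"
      using assms(3)[OF that] by (auto simp: hall_basis_def intro: hall_coeffs_consts)
    ultimately show ?thesis using sub assms(2) that by (auto simp: hall_algebra_simps)
  qed
  show ?thesis using assms(1) el
  proof (induction F rule: finite_induct)
    case empty
    then show ?case by (simp add: hall_algebra_simps)
  next
    case (insert C F)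
    then have "(\<Oplus>\<^bsub>hall_algebra K A\<^esub>C\<in>insert C F. c C \<odot>\<^bsub>hall_algebra K A\<^esub> hall_basis C) =
      (\<lambda>X. (c C \<odot>\<^bsub>hall_algebra K A\<^esub> hall_basis C) X + (if X \<in> F then c X else 0))"
      by (subst finsum_insert) (auto simp: hall_algebra_simps(4))
    also have "\<dots> = (\<lambda>X. if X \<in> insert C F then c X else 0)"
      using insert.hyps by (auto simp: hall_algebra_simps hall_basis_def)
    finally show ?case .
  qed
qed

lemma hall_span_eq_supported:
  assumes "S \<subseteq> iso_classes K A" shows "hall_span K A S = supported K S"
proof
  show "hall_span K A S \<subseteq> supported K S"
  proof
    fix f assume "f \<in> hall_span K A S"
    then obtain F c where F: "finite F" "F \<subseteq> S" "\<forall>C\<in>F. c C \<in> hall_coeffs K"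
      "f = (\<Oplus>\<^bsub>hall_algebra K A\<^esub>C\<in>F. c C \<odot>\<^bsub>hall_algebra K A\<^esub> hall_basis C)"
      unfolding hall_span_def by blast
    then have f: "f = (\<lambda>X. if X \<in> F then c X else 0)" using hall_finsum[of F K A c] assms by auto
    then have sub: "{X. f X \<noteq> 0} \<subseteq> F" by auto
    moreover have "finite {X. f X \<noteq> 0}" by (rule finite_subset[OF sub F(1)])
    moreover have "range f \<subseteq> hall_coeffs K"
      unfolding f using F(3) by (auto intro: hall_coeffs_consts)
    ultimately show "f \<in> supported K S" using F(2) by (auto simp: supported_def)
  qed
  show "supported K S \<subseteq> hall_span K A S"
  proof
    fix f assume f: "f \<in> supported K S"
    let ?F = "{X. f X \<noteq> 0}"
    have F: "finite ?F" "?F \<subseteq> S" "\<forall>C\<in>?F. f C \<in> hall_coeffs K" using f by (auto simp: supported_def)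
    have "(\<Oplus>\<^bsub>hall_algebra K A\<^esub>C\<in>?F. f C \<odot>\<^bsub>hall_algebra K A\<^esub> hall_basis C) = f"
      using hall_finsum[of ?F K A f] F assms by (simp add: fun_eq_iff subset_iff)
    then show "f \<in> hall_span K A S"
      unfolding hall_span_def using F by (intro CollectI exI[of _ ?F] exI[of _ f] conjI) simp_all
  qed
qed

locale hall =
  fixes K :: "'k ring" and A :: "('k, 'a) module"
  assumes field: "field K" and finite_field: "finite (carrier K)"
    and algebra: "k_algebra K A" and finitary: "finitary K A"
begin

lemma fd: "fd_modules K A = finite_modules A"
  by (rule fd_modules_eq_finite_modules[OF finite_field algebra])

lemma hall_v_nonzero: "hall_v K \<noteq> 0"
proof -
  interpret field K by (rule field)
  have "card (carrier K) \<noteq> 0" using finite_field zero_closed card_eq_0_iff by auto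
  then show ?thesis by (simp add: hall_v_def)
qed

lemma iso_class_eq:
  assumes "left_module A M" "left_module A N" "isomorphic A M N" shows "iso_class K A M = iso_class K A N"
  using isomorphic_trans[OF _ assms(3)] isomorphic_trans[OF _ isomorphic_sym[OF assms]]
  by (auto simp: iso_class_def)

lemma iso_class_self: "M \<in> finite_modules A \<Longrightarrow> M \<in> iso_class K A M"
  using isomorphic_refl by (auto simp: iso_class_def fd)

lemma class_rep:
  assumes "C \<in> iso_classes K A"
  shows "class_rep C \<in> finite_modules A" "iso_class K A (class_rep C) = C"
proof -
  obtain M where M: "M \<in> finite_modules A" "C = iso_class K A M" using assms by (auto simp: iso_classes_def fd)
  have "class_rep C \<in> C" unfolding class_rep_def using iso_class_self[OF M(1)] M(2) someI[of "\<lambda>X. X \<in> C"] by simp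
  then have "class_rep C \<in> finite_modules A" "isomorphic A (class_rep C) M" using M by (auto simp: iso_class_def fd)
  then show "class_rep C \<in> finite_modules A" "iso_class K A (class_rep C) = C" using M iso_class_eq by auto
qed

lemma class_rep_iso_class:
  assumes "M \<in> finite_modules A"
  shows "iso_class K A M \<in> iso_classes K A" "isomorphic A (class_rep (iso_class K A M)) M"
proof -
  show "iso_class K A M \<in> iso_classes K A" using assms by (simp add: iso_classes_def fd)
  then have "class_rep (iso_class K A M) \<in> iso_class K A M"
    using class_rep(2) iso_class_self[OF class_rep(1)] by simp
  then show "isomorphic A (class_rep (iso_class K A M)) M" by (simp add: iso_class_def)
qed

definition big_classes :: "nat \<Rightarrow> ('a, nat) module set set" where
  "big_classes r = {iso_class K A M | M. M \<in> fd_modules K A \<and> num_summands A M \<ge> r + 1}"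

lemma big_classes_subset: "big_classes r \<subseteq> iso_classes K A"
  by (auto simp: big_classes_def iso_classes_def)

lemma iso_class_big_iff:
  assumes "M \<in> finite_modules A" shows "iso_class K A M \<in> big_classes r \<longleftrightarrow> r < num_summands A M"
proof
  assume "iso_class K A M \<in> big_classes r"
  then obtain N where N: "N \<in> finite_modules A" "iso_class K A M = iso_class K A N" "r < num_summands A N"
    by (auto simp: big_classes_def fd)
  then have "isomorphic A M N" using iso_class_self[OF assms] by (auto simp: iso_class_def)
  then show "r < num_summands A M" using num_summands_isomorphic[of A M N] assms N by auto
qed (use assms in \<open>auto simp: big_classes_def fd\<close>)

lemma big_class_rep:
  assumes "C \<in> big_classes r" shows "r < num_summands A (class_rep C)"
proof -
  have C: "C \<in> iso_classes K A" using assms big_classes_subset by blast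
  show ?thesis using iso_class_big_iff[OF class_rep(1)[OF C], of r] class_rep(2)[OF C] assms by simp
qed

lemma D_r_eq: "D_r K A r = supported K (big_classes r)"
  unfolding D_r_def big_classes_def[symmetric] by (rule hall_span_eq_supported[OF big_classes_subset])

text \<open>The hypothesis that \<open>A\<close> is finitary enters here: without it the product of two basis elements
  need not have finite support.\<close>

lemma finite_products:
  assumes M: "M \<in> finite_modules A" and N: "N \<in> finite_modules A"
  shows "finite {C \<in> iso_classes K A. hall_number A (class_rep C) M N \<noteq> 0}"
proof -
  have "finite (ders A M N)"
  proof (rule finite_ders[OF _ M N])
    fix S T :: "('a, nat) module"
    assume "S \<in> finite_modules A" "T \<in> finite_modules A" "simple_module A S" "simple_module A T"
    then show "finite (ders A S T)"
      using finitary finite_ders_if_finite_Ext1[OF fd] unfolding finitary_def fd by blast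
  qed
  then obtain \<Y> :: "('a, nat) module set" where Y: "finite \<Y>" "\<forall>Y\<in>\<Y>. left_module A Y"
    "\<forall>X\<in>finite_modules A. extension_of A X M N \<longrightarrow> (\<exists>Y\<in>\<Y>. isomorphic A X Y)"
    using finite_extension_classes[OF M N] by blast
  have "{C \<in> iso_classes K A. hall_number A (class_rep C) M N \<noteq> 0} \<subseteq> iso_class K A ` \<Y>"
  proof
    fix C assume C: "C \<in> {C \<in> iso_classes K A. hall_number A (class_rep C) M N \<noteq> 0}"
    then have rep: "class_rep C \<in> finite_modules A" "iso_class K A (class_rep C) = C" using class_rep by auto
    then have "extension_of A (class_rep C) M N" using C hall_number_nonzero_iff[OF _ M] by blast
    then obtain Z where Z: "Z \<in> \<Y>" "isomorphic A (class_rep C) Z" using Y(3) rep(1) by blast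
    then have "iso_class K A (class_rep C) = iso_class K A Z" using iso_class_eq Y(2) rep(1) by blast
    then show "C \<in> iso_class K A ` \<Y>" using rep(2) Z(1) by blast
  qed
  then show ?thesis using Y(1) finite_subset by blast
qed

lemma hall_mult_supported:
  assumes "ext_closed A r" "f \<in> supported K (big_classes r)" "g \<in> supported K (big_classes r)"
  shows "hall_mult K A f g \<in> supported K (big_classes r)"
proof -
  let ?F = "{M. f M \<noteq> 0}" and ?G = "{N. g N \<noteq> 0}"
  have F: "finite ?F" "?F \<subseteq> big_classes r" "\<And>M. f M \<in> hall_coeffs K"
    and G: "finite ?G" "?G \<subseteq> big_classes r" "\<And>N. g N \<in> hall_coeffs K"
    using assms(2,3) by (auto simp: supported_def)
  have ex: "X \<in> iso_classes K A \<and> (\<exists>M\<in>?F. \<exists>N\<in>?G. hall_number A (class_rep X) (class_rep M) (class_rep N) \<noteq> 0)"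
    if "hall_mult K A f g X \<noteq> 0" for X
  proof (rule ccontr)
    assume no: "\<not> ?thesis"
    have "hall_mult K A f g X = 0"
    proof (cases "X \<in> iso_classes K A")
      case True
      then have "hall_number A (class_rep X) (class_rep M) (class_rep N) = 0" if "M \<in> ?F" "N \<in> ?G" for M N
        using no that by blast
      then show ?thesis using True by (simp add: hall_mult_def)
    qed (simp add: hall_mult_def)
    then show False using that by simp
  qed
  have rep: "class_rep M \<in> finite_modules A" "r < num_summands A (class_rep M)" if "M \<in> big_classes r" for M
    using that class_rep(1) big_class_rep big_classes_subset by blast+
  have "{X. hall_mult K A f g X \<noteq> 0} \<subseteq>
      (\<Union>M\<in>?F. \<Union>N\<in>?G. {X \<in> iso_classes K A. hall_number A (class_rep X) (class_rep M) (class_rep N) \<noteq> 0})"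
    using ex by blast
  moreover have "finite (\<Union>M\<in>?F. \<Union>N\<in>?G. {X \<in> iso_classes K A. hall_number A (class_rep X) (class_rep M) (class_rep N) \<noteq> 0})"
    using F G rep by (intro finite_UN_I finite_products) auto
  ultimately have "finite {X. hall_mult K A f g X \<noteq> 0}" using finite_subset by blast
  moreover have "{X. hall_mult K A f g X \<noteq> 0} \<subseteq> big_classes r"
  proof
    fix X assume "X \<in> {X. hall_mult K A f g X \<noteq> 0}"
    then obtain M N where X: "X \<in> iso_classes K A" and M: "M \<in> ?F" and N: "N \<in> ?G"
      and hn: "hall_number A (class_rep X) (class_rep M) (class_rep N) \<noteq> 0" using ex by blast
    have MN: "M \<in> big_classes r" "N \<in> big_classes r" using M N F(2) G(2) by blast+
    note rX = class_rep[OF X]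
    have "extension_of A (class_rep X) (class_rep M) (class_rep N)"
      using hn hall_number_nonzero_iff[OF rX(1) rep(1)[OF MN(1)]] by blast
    then obtain p where p: "epi A (class_rep X) (class_rep M) p"
      "isomorphic A (sub_module (class_rep X) (ker_of (class_rep X) (class_rep M) p)) (class_rep N)"
      unfolding extension_of_def by blast
    let ?U = "ker_of (class_rep X) (class_rep M) p"
    interpret p: lin_map A "class_rep X" "carrier (class_rep X)" "class_rep M" p using p by (simp add: epi_def)
    have fin: "finite (carrier (class_rep X))" "finite (carrier (class_rep M))" "finite ?U"
      using rX rep(1)[OF MN(1)] by (auto simp: ker_of_def)
    note sU = ker_of_submodule[OF p(1)]
    have "num_summands A (sub_module (class_rep X) ?U) = num_summands A (class_rep N)"
      using num_summands_isomorphic[OF p.M.sub_module_left_module[OF sU] _ p(2)] rep(1)[OF MN(2)] fin(3) by simp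
    then have "dec A (class_rep X) ?U (num_summands A (class_rep N))"
      using p.M.dec_num_summands_sub_module[OF sU fin(3)] by simp
    then have "r < num_summands A (class_rep X)"
      using assms(1) fin(1) p(1) p.N.dec_num_summands[OF fin(2)] p.M.dec_num_summands[OF fin(1)]
        rep(2)[OF MN(1)] rep(2)[OF MN(2)] unfolding ext_closed_def by blast
    then show "X \<in> big_classes r" using iso_class_big_iff[OF rX(1)] rX(2) by simp
  qed
  moreover have "range (hall_mult K A f g) \<subseteq> hall_coeffs K"
  proof -
    have "f M * g N * real n \<in> hall_coeffs K" for M N n
      by (intro hall_coeffs_mult[OF hall_v_nonzero] F(3) G(3) hall_coeffs_consts)
    then show ?thesis by (auto simp: hall_mult_def intro!: hall_coeffs_sum hall_coeffs_consts)
  qed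
  ultimately show ?thesis by (simp add: supported_def)
qed

lemma hall_basis_supported:
  assumes "C \<in> S" shows "hall_basis C \<in> supported K S"
proof -
  have "{X. hall_basis C X \<noteq> 0} = {C}" by (auto simp: hall_basis_def)
  then show ?thesis using assms hall_coeffs_consts by (auto simp: supported_def hall_basis_def)
qed

lemma hall_mult_basis:
  assumes "X \<in> iso_classes K A"
  shows "hall_mult K A (hall_basis C) (hall_basis C') X =
    real (hall_number A (class_rep X) (class_rep C) (class_rep C'))"
proof -
  have "{X. hall_basis C X \<noteq> 0} = {C}" for C :: "('a, nat) module set" by (auto simp: hall_basis_def)
  then show ?thesis using assms by (simp add: hall_mult_def) (simp add: hall_basis_def)
qed

text \<open>Structure constants are numbers of submodules. A product of two basis elements therefore contains
  every extension with a nonzero coefficient, and one extension outside \<open>D\<^sub>r\<close> is enough to leave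
  \<open>D\<^sub>r\<close>.\<close>

theorem D_r_subring_iff: "nonunital_subring (D_r K A r) (hall_algebra K A) \<longleftrightarrow> ext_closed A r"
proof
  assume closed: "ext_closed A r"
  interpret H: abelian_group "hall_algebra K A" by (rule hall_abelian_group)
  have sub: "supported K (big_classes r) \<subseteq> carrier (hall_algebra K A)"
    using big_classes_subset[of r] by (auto simp: supported_def hall_algebra_simps)
  have inv: "\<ominus>\<^bsub>hall_algebra K A\<^esub> f = (\<lambda>X. - f X)" if "f \<in> supported K (big_classes r)" for f
    using that sub supported_uminus[OF that]
    by (intro H.minus_equality) (auto simp: hall_algebra_simps(3,4))
  have "subgroup (supported K (big_classes r)) (add_monoid (hall_algebra K A))"
  proof (rule H.add.subgroupI)
    show "supported K (big_classes r) \<subseteq> carrier (hall_algebra K A)" by (rule sub)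
    show "supported K (big_classes r) \<noteq> {}" using supported_zero by blast
  qed (auto simp: inv supported_uminus hall_algebra_simps(4) supported_add)
  then show "nonunital_subring (D_r K A r) (hall_algebra K A)"
    unfolding nonunital_subring_def D_r_eq
    using hall_mult_supported[OF closed] by (simp add: hall_algebra_simps(2))
next
  assume ring: "nonunital_subring (D_r K A r) (hall_algebra K A)"
  show "ext_closed A r"
    unfolding ext_closed_def
  proof (intro allI impI, elim conjE)
    fix X M :: "('a, nat) module" and g a b n
    assume fin: "finite (carrier X)" and g: "epi A X M g" and a: "dec A X (ker_of X M g) a" and
      b: "dec A M (carrier M) b" and n: "dec A X (carrier X) n" and "r < a" "r < b"
    interpret g: lin_map A X "carrier X" M g using g by (simp add: epi_def)
    define N where "N = sub_module X (ker_of X M g)"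
    have finN: "finite (ker_of X M g)" using fin by (simp add: ker_of_def)
    have X: "X \<in> finite_modules A" using fin g.M.left_module_axioms by simp
    have M: "M \<in> finite_modules A" using epi_finite[OF g fin] g.N.left_module_axioms by simp
    have N: "N \<in> finite_modules A"
      using finN g.M.sub_module_left_module[OF ker_of_submodule[OF g]] by (simp add: N_def)
    have "num_summands A M = b" using g.N.num_summands_eqI[OF _ b] M by simp
    moreover have "num_summands A N = a" unfolding N_def by (rule g.M.num_summands_sub_module_eqI[OF a finN])
    ultimately have "iso_class K A M \<in> big_classes r" "iso_class K A N \<in> big_classes r"
      using iso_class_big_iff M N \<open>r < a\<close> \<open>r < b\<close> by blast+
    then have "hall_mult K A (hall_basis (iso_class K A M)) (hall_basis (iso_class K A N)) \<in> supported K (big_classes r)"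
      using ring hall_basis_supported unfolding nonunital_subring_def D_r_eq hall_algebra_simps(2) by blast
    then have imp: "hall_number A (class_rep (iso_class K A X)) (class_rep (iso_class K A M)) (class_rep (iso_class K A N)) \<noteq> 0
        \<Longrightarrow> iso_class K A X \<in> big_classes r"
      using hall_mult_basis[OF class_rep_iso_class(1)[OF X]] by (auto simp: supported_def)
    have reps: "class_rep (iso_class K A Y) \<in> finite_modules A" "isomorphic A (class_rep (iso_class K A Y)) Y"
      if "Y \<in> finite_modules A" for Y
      using class_rep(1)[OF class_rep_iso_class(1)[OF that]] class_rep_iso_class(2)[OF that] by auto
    have "extension_of A X M N" unfolding extension_of_def N_def using g isomorphic_refl by blast
    then have "extension_of A (class_rep (iso_class K A X)) (class_rep (iso_class K A M)) (class_rep (iso_class K A N))"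
    proof (rule extension_of_isomorphic)
      show "left_module A (class_rep (iso_class K A X))" "left_module A (class_rep (iso_class K A M))"
        using reps(1) X M by blast+
      show "isomorphic A (class_rep (iso_class K A X)) X" by (rule reps(2)[OF X])
      show "isomorphic A M (class_rep (iso_class K A M))" "isomorphic A N (class_rep (iso_class K A N))"
        using isomorphic_sym[OF _ _ reps(2)[OF M]] isomorphic_sym[OF _ _ reps(2)[OF N]]
          reps(1)[OF M] reps(1)[OF N] M N by simp_all
    qed
    then have "iso_class K A X \<in> big_classes r"
      using imp hall_number_nonzero_iff[OF reps(1)[OF X] reps(1)[OF M]] by blast
    then have "r < num_summands A X" using iso_class_big_iff[OF X] by blast
    then show "r < n" using g.M.num_summands_eqI[OF fin n] by simp
  qed
qed

end

theorem theorem1p2: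
  fixes K :: "'k ring" and A :: "('k, 'a) module"
  assumes "field K" and "finite (carrier K)" and "k_algebra K A" and "finitary K A"
  shows
    "let I = (\<forall>M\<in>fd_modules K A. indecomposable A M \<longrightarrow> simple_socle A M);
         I' = (\<forall>M\<in>fd_modules K A. indecomposable A M \<longrightarrow> simple_top A M);
         II = (\<forall>M\<in>fd_modules K A. indecomposable A M \<longrightarrow> simple_top A M \<or> simple_socle A M);
         III = (\<forall>r\<ge>1. nonunital_subring (D_r K A r) (hall_algebra K A));
         IV = (\<exists>r\<ge>2. nonunital_subring (D_r K A r) (hall_algebra K A));
         V = nonunital_subring (D K A) (hall_algebra K A)
     in ((I \<or> I') \<longleftrightarrow> III) \<and> (III \<longleftrightarrow> IV) \<and>
        ((I \<or> I') \<longrightarrow> II) \<and> (III \<longrightarrow> II) \<and> (IV \<longrightarrow> II) \<and>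
        (II \<longrightarrow> V)"
proof -
  interpret hall K A using assms by (rule hall.intro)
  define I where "I = (\<forall>M\<in>finite_modules A. indecomposable A M \<longrightarrow> simple_socle A M)"
  define I' where "I' = (\<forall>M\<in>finite_modules A. indecomposable A M \<longrightarrow> simple_top A M)"
  define II where "II = (\<forall>M\<in>finite_modules A. indecomposable A M \<longrightarrow> simple_top A M \<or> simple_socle A M)"
  have 1: "ext_closed A r" if "I \<or> I'" for r
    using that ext_closed_if_simple_socle ext_closed_if_simple_top unfolding I_def I'_def by blast
  have 2: "I \<or> I'" if "ext_closed A r" "2 \<le> r" for r
    using simple_top_or_socle_if_ext_closed[OF that] unfolding I_def I'_def by blast
  have 3: "ext_closed A 1" if II
    using that ext_closed_1_if_simple_top_or_socle unfolding II_def by blast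
  have 4: "II" if "I \<or> I'" using that unfolding I_def I'_def II_def by blast
  have 5: "(\<forall>r\<ge>1. ext_closed A r) \<longleftrightarrow> I \<or> I'" "(\<exists>r\<ge>2. ext_closed A r) \<longleftrightarrow> I \<or> I'"
    using 1 2 by (auto, (meson one_le_numeral order_refl)+)
  show ?thesis
    unfolding Let_def D_def D_r_subring_iff fd I_def[symmetric] I'_def[symmetric] II_def[symmetric] 5
    using 3 4 by blast
qed

end
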